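(* Let $f:\mathcal{M}_1\to\mathcal{M}_2$ be a smooth map between oriented, compact, $d$-dimensional Riemannian manifolds with boundaries $(\mathcal{M}_1,\mathfrak{g}_1)$ and $(\mathcal{M}_2,\mathfrak{g}_2)$. For any vector field $X\in\Gamma(T\mathcal{M}_2)$, $$\operatorname{div}\operatorname{Piola}(X)=\big((\operatorname{div}X)\circ f\big)\,\operatorname{Det}df-\left\langle f^*X,\ \delta_{\nabla^{f^*T\mathcal{M}_2}}\operatorname{Cof}df\right\rangle .$$
   Context: For an oriented $d$-dimensional inner-product space $V$, let $\Lambda_k(V)$ be its $k$-th exterior power and $\star_V^k:\Lambda_k(V)\to\Lambda_{d-k}(V)$ the Hodge-dual operator ($\alpha\wedge\star_V^k\beta=\langle\alpha,\beta\rangle\, e_1\wedge\dots\wedge e_d$ for a positively-oriented orthonormal basis $(e_i)$). For a linear map $A:V\to W$ between oriented $d$-dimensional inner-product spaces, $\operatorname{Det}A:=\star_W^d\circ\bigwedge^dA\circ\star_V^0\in\mathbb{R}$ and $\operatorname{Cof}A:=(-1)^{d-1}\star_W^{d-1}\circ\bigwedge^{d-1}A\circ\star_V^1:V\to W$. (In positively-oriented orthonormal bases these are the determinant and the matrix-cofactor, i.e. transpose of the adjugate, of the matrix of $A$.) For $f:\mathcal{M}_1\to\mathcal{M}_2$, the differential is viewed as a bundle map $df:T\mathcal{M}_1\to f^*T\mathcal{M}_2$, and $\operatorname{Det}df\in C^\infty(\mathcal{M}_1)$, $\operatorname{Cof}df\in\Gamma(T^*\mathcal{M}_1\otimes f^*T\mathcal{M}_2)=\Omega^1(\mathcal{M}_1;f^*T\mathcal{M}_2)$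 are defined fiberwise. For a vector field $X$ on $\mathcal{M}_2$, $f^*X=X\circ f\in\Gamma(f^*T\mathcal{M}_2)$ is its pullback, and its Piola transform is the vector field on $\mathcal{M}_1$ given by $\operatorname{Piola}(X)=(\operatorname{Cof}df)^T(f^*X)$, the transpose being taken with respect to the metrics. $\operatorname{div}$ is the Riemannian divergence on $\mathcal{M}_1$ (left side) and on $\mathcal{M}_2$ (right side). The bundle $f^*T\mathcal{M}_2$ carries the pullback metric (denoted $\langle\cdot,\cdot\rangle$) and the pullback $\nabla^{f^*T\mathcal{M}_2}$ of the Levi-Civita connection of $\mathcal{M}_2$. For $\omega\in\Omega^1(\mathcal{M}_1;f^*T\mathcal{M}_2)$, the coderivative is $\delta_{\nabla^{f^*T\mathcal{M}_2}}\omega=-\sum_{i=1}^d(\nabla_{E_i}\omega)(E_i)\in\Gamma(f^*T\mathcal{M}_2)$, where $(E_i)$ is any local orthonormal frame of $T\mathcal{M}_1$ and $\nabla$ is the connection on $T^*\mathcal{M}_1\otimes f^*T\mathcal{M}_2$ induced by the Levi-Civita connection of $\mathcal{M}_1$ and $\nabla^{f^*T\mathcal{M}_2}$ (it is the formal adjoint of $\nabla^{f^*T\mathcal{M}_2}$ acting on sections). *)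

theory Defs
  imports
    "HOL-Analysis.Analysis"
    "HOL-Library.Function_Algebras"
    "HOL-Combinatorics.Permutations"
begin

text \<open>Tangent vectors and multivectors below are encoded as functions; functions into a real
  vector space form a real vector space under the pointwise operations.\<close>

instantiation "fun" :: (type, real_vector) real_vector
begin

definition scaleR_fun :: "real \<Rightarrow> ('a \<Rightarrow> 'b) \<Rightarrow> 'a \<Rightarrow> 'b"
  where "scaleR_fun a f = (\<lambda>x. a *\<^sub>R f x)"

instance
  by standard (auto simp: scaleR_fun_def plus_fun_def fun_eq_iff scaleR_add_right scaleR_add_left)

end


section \<open>Exterior powers\<close>

text \<open>Vector spaces are subspaces \<open>V\<close> of a type of class \<open>real_vector\<close>.  Maps whose domain is a
  space given as a set are required to vanish off that set wherever they have to be compared by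
  equality.\<close>

definition dual_space :: "'v::real_vector set \<Rightarrow> ('v \<Rightarrow> real) set"
  where "dual_space V = {\<phi>. (\<forall>x\<in>V. \<forall>y\<in>V. \<phi> (x + y) = \<phi> x + \<phi> y) \<and>
     (\<forall>a. \<forall>x\<in>V. \<phi> (a *\<^sub>R x) = a * \<phi> x) \<and> (\<forall>x. x \<notin> V \<longrightarrow> \<phi> x = 0)}"

type_synonym 'v multivector = "('v \<Rightarrow> real) list \<Rightarrow> real"

text \<open>\<open>\<Lambda>\<^sub>k(V)\<close>, for finite-dimensional \<open>V\<close>, realised as the alternating \<open>k\<close>-linear forms on the dual
  space of \<open>V\<close>.\<close>

definition ext_power :: "nat \<Rightarrow> 'v::real_vector set \<Rightarrow> 'v multivector set"
  where "ext_power k V = {\<omega>.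
     (\<forall>\<phi>s. \<not> (length \<phi>s = k \<and> set \<phi>s \<subseteq> dual_space V) \<longrightarrow> \<omega> \<phi>s = 0) \<and>
     (\<forall>\<phi>s i \<phi> \<psi> a b. length \<phi>s = k \<longrightarrow> set \<phi>s \<subseteq> dual_space V \<longrightarrow> i < k \<longrightarrow>
        \<phi> \<in> dual_space V \<longrightarrow> \<psi> \<in> dual_space V \<longrightarrow>
        \<omega> (\<phi>s[i := a *\<^sub>R \<phi> + b *\<^sub>R \<psi>]) = a * \<omega> (\<phi>s[i := \<phi>]) + b * \<omega> (\<phi>s[i := \<psi>])) \<and>
     (\<forall>\<phi>s. \<not> distinct \<phi>s \<longrightarrow> \<omega> \<phi>s = 0)}"

text \<open>The product of \<open>\<alpha> \<in> \<Lambda>\<^sub>k(V)\<close> and \<open>\<beta> \<in> \<Lambda>\<^sub>l(V)\<close>, normalised so that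
  \<open>(v\<^sub>1 \<and> \<dots> \<and> v\<^sub>k)(\<phi>\<^sub>1, \<dots>, \<phi>\<^sub>k) = det (\<phi>\<^sub>i(v\<^sub>j))\<close>.\<close>

definition wedge :: "nat \<Rightarrow> nat \<Rightarrow> 'v::real_vector multivector \<Rightarrow> 'v multivector \<Rightarrow> 'v multivector"
  where "wedge k l \<alpha> \<beta> = (\<lambda>\<phi>s. if length \<phi>s = k + l
     then (\<Sum>\<sigma> | \<sigma> permutes {..<k + l}. of_int (sign \<sigma>) *
             \<alpha> (map (\<lambda>i. \<phi>s ! \<sigma> i) [0..<k]) * \<beta> (map (\<lambda>i. \<phi>s ! \<sigma> i) [k..<k + l]))
          / (fact k * fact l)
     else 0)"

text \<open>\<open>v\<^sub>1 \<and> \<dots> \<and> v\<^sub>k\<close>\<close>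

definition wedge_vectors :: "'v::real_vector set \<Rightarrow> 'v list \<Rightarrow> 'v multivector"
  where "wedge_vectors V vs = (\<lambda>\<phi>s. if length \<phi>s = length vs \<and> set \<phi>s \<subseteq> dual_space V
     then (\<Sum>\<sigma> | \<sigma> permutes {..<length vs}. of_int (sign \<sigma>) *
             (\<Prod>i<length vs. (\<phi>s ! i) (vs ! \<sigma> i)))
     else 0)"

text \<open>The map \<open>\<Lambda>\<^sub>k(V) \<rightarrow> \<Lambda>\<^sub>k(W)\<close> induced by \<open>A : V \<rightarrow> W\<close>; it sends \<open>v\<^sub>1 \<and> \<dots> \<and> v\<^sub>k\<close> to
  \<open>A v\<^sub>1 \<and> \<dots> \<and> A v\<^sub>k\<close>.\<close>

definition ext_map ::
  "nat \<Rightarrow> 'v::real_vector set \<Rightarrow> 'w::real_vector set \<Rightarrow> ('v \<Rightarrow> 'w) \<Rightarrow> 'v multivector \<Rightarrow> 'w multivector"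
  where "ext_map k V W A \<omega> = (\<lambda>\<psi>s. if length \<psi>s = k \<and> set \<psi>s \<subseteq> dual_space W
     then \<omega> (map (\<lambda>\<psi> x. if x \<in> V then \<psi> (A x) else 0) \<psi>s) else 0)"

text \<open>The identifications of \<open>\<real>\<close> with \<open>\<Lambda>\<^sub>0(V)\<close> and of \<open>V\<close> with \<open>\<Lambda>\<^sub>1(V)\<close>.\<close>

definition scalar_embed :: "real \<Rightarrow> 'v::real_vector multivector"
  where "scalar_embed r = (\<lambda>\<phi>s. if \<phi>s = [] then r else 0)"

abbreviation vector_embed :: "'v::real_vector set \<Rightarrow> 'v \<Rightarrow> 'v multivector"
  where "vector_embed V v \<equiv> wedge_vectors V [v]"


section \<open>Oriented inner-product spaces\<close>

text \<open>An orientation is represented by the set of positively oriented ordered bases.\<close>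

record 'v oriented_ips =
  ips_space :: "'v set"
  ips_inner :: "'v \<Rightarrow> 'v \<Rightarrow> real"
  ips_positive :: "'v list set"

definition ordered_bases :: "'v::real_vector set \<Rightarrow> 'v list set"
  where "ordered_bases V = {b. distinct b \<and> independent (set b) \<and> span (set b) = V}"

definition is_orientation :: "'v::real_vector set \<Rightarrow> 'v list set \<Rightarrow> bool"
  where "is_orientation V P \<longleftrightarrow> P \<noteq> {} \<and> P \<subseteq> ordered_bases V \<and>
     (\<forall>b\<in>P. \<forall>b'\<in>ordered_bases V.
        b' \<in> P \<longleftrightarrow> (\<exists>c>0. wedge_vectors V b' = c *\<^sub>R wedge_vectors V b))"

definition is_inner_product :: "'v::real_vector set \<Rightarrow> ('v \<Rightarrow> 'v \<Rightarrow> real) \<Rightarrow> bool"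
  where "is_inner_product V B \<longleftrightarrow>
     (\<forall>x\<in>V. \<forall>y\<in>V. B x y = B y x) \<and>
     (\<forall>x\<in>V. \<forall>y\<in>V. \<forall>z\<in>V. B (x + y) z = B x z + B y z) \<and>
     (\<forall>a. \<forall>x\<in>V. \<forall>y\<in>V. B (a *\<^sub>R x) y = a * B x y) \<and>
     (\<forall>x\<in>V. x \<noteq> 0 \<longrightarrow> B x x > 0)"

definition oriented_inner_product_space :: "'v::real_vector oriented_ips \<Rightarrow> bool"
  where "oriented_inner_product_space V \<longleftrightarrow>
     subspace (ips_space V) \<and> (\<exists>S. finite S \<and> span S = ips_space V) \<and>
     is_inner_product (ips_space V) (ips_inner V) \<and>
     is_orientation (ips_space V) (ips_positive V)"

definition orthonormal_basis :: "'v::real_vector oriented_ips \<Rightarrow> 'v list \<Rightarrow> bool"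
  where "orthonormal_basis V e \<longleftrightarrow> e \<in> ordered_bases (ips_space V) \<and>
     (\<forall>i<length e. \<forall>j<length e. ips_inner V (e ! i) (e ! j) = (if i = j then 1 else 0))"

definition some_orthonormal_basis :: "'v::real_vector oriented_ips \<Rightarrow> 'v list"
  where "some_orthonormal_basis V = (SOME e. orthonormal_basis V e)"

definition flat :: "'v::real_vector oriented_ips \<Rightarrow> 'v \<Rightarrow> 'v \<Rightarrow> real"
  where "flat V v = (\<lambda>x. if x \<in> ips_space V then ips_inner V v x else 0)"

text \<open>The inner product on \<open>\<Lambda>\<^sub>k(V)\<close> for which \<open>e\<^bsub>i\<^sub>1\<^esub> \<and> \<dots> \<and> e\<^bsub>i\<^sub>k\<^esub>\<close>, \<open>i\<^sub>1 < \<dots> < i\<^sub>k\<close>, are orthonormal,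
  where \<open>e\<close> is an orthonormal basis of \<open>V\<close>; it does not depend on \<open>e\<close>.  The coefficient of \<open>\<omega>\<close> at
  such a multivector is the value of \<open>\<omega>\<close> on the corresponding elements of the dual basis.\<close>

definition ext_inner ::
  "nat \<Rightarrow> 'v::real_vector oriented_ips \<Rightarrow> 'v multivector \<Rightarrow> 'v multivector \<Rightarrow> real"
  where "ext_inner k V \<omega> \<eta> =
     (let e = some_orthonormal_basis V in
      \<Sum>I | I \<subseteq> {..<length e} \<and> card I = k.
        \<omega> (map (\<lambda>i. flat V (e ! i)) (sorted_list_of_set I)) *
        \<eta> (map (\<lambda>i. flat V (e ! i)) (sorted_list_of_set I)))"

definition hodge :: "nat \<Rightarrow> 'v::real_vector oriented_ips \<Rightarrow> 'v multivector \<Rightarrow> 'v multivector"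
  where "hodge k V \<beta> =
     (let d = dim (ips_space V) in
      THE \<gamma>. \<gamma> \<in> ext_power (d - k) (ips_space V) \<and>
        (\<forall>\<alpha>\<in>ext_power k (ips_space V). \<forall>e\<in>ips_positive V. orthonormal_basis V e \<longrightarrow>
           wedge k (d - k) \<alpha> \<gamma> = ext_inner k V \<alpha> \<beta> *\<^sub>R wedge_vectors (ips_space V) e))"

definition Det ::
  "'v::real_vector oriented_ips \<Rightarrow> 'w::real_vector oriented_ips \<Rightarrow> ('v \<Rightarrow> 'w) \<Rightarrow> real"
  where "Det V W A =
     (let d = dim (ips_space V) in
      THE r. scalar_embed r =
        hodge d W (ext_map d (ips_space V) (ips_space W) A (hodge 0 V (scalar_embed 1))))"

definition Cof ::
  "'v::real_vector oriented_ips \<Rightarrow> 'w::real_vector oriented_ips \<Rightarrow> ('v \<Rightarrow> 'w) \<Rightarrow> 'v \<Rightarrow> 'w"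
  where "Cof V W A v =
     (let d = dim (ips_space V) in
      THE w. w \<in> ips_space W \<and>
        vector_embed (ips_space W) w = (-1) ^ (d - 1) *\<^sub>R
          hodge (d - 1) W (ext_map (d - 1) (ips_space V) (ips_space W) A
            (hodge 1 V (vector_embed (ips_space V) v))))"

definition metric_transpose ::
  "'v::real_vector oriented_ips \<Rightarrow> 'w::real_vector oriented_ips \<Rightarrow> ('v \<Rightarrow> 'w) \<Rightarrow> 'w \<Rightarrow> 'v"
  where "metric_transpose V W A w =
     (THE v. v \<in> ips_space V \<and> (\<forall>u\<in>ips_space V. ips_inner V v u = ips_inner W w (A u)))"


section \<open>Smooth functions on subsets of Euclidean space\<close>

primrec Ck_on :: "nat \<Rightarrow> 'a::euclidean_space set \<Rightarrow> ('a \<Rightarrow> 'b::real_normed_vector) \<Rightarrow> bool"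
  where
    "Ck_on 0 U f \<longleftrightarrow> continuous_on U f"
  | "Ck_on (Suc k) U f \<longleftrightarrow> (\<forall>x\<in>U. f differentiable (at x)) \<and>
       (\<forall>v. Ck_on k U (\<lambda>x. frechet_derivative f (at x) v))"

text \<open>Smoothness on an arbitrary set means local extendability to a smooth function on an open
  set.\<close>

definition smooth_on :: "'a::euclidean_space set \<Rightarrow> ('a \<Rightarrow> 'b::real_normed_vector) \<Rightarrow> bool"
  where "smooth_on S f \<longleftrightarrow>
     (\<forall>x\<in>S. \<exists>U g. open U \<and> x \<in> U \<and> (\<forall>k. Ck_on k U g) \<and> (\<forall>y\<in>U \<inter> S. g y = f y))"


section \<open>Oriented Riemannian manifolds with boundary\<close>

text \<open>A chart is a pair of its domain and its map.  A tangent vector at \<open>p\<close> is the family of its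
  components with respect to all charts of the atlas around \<open>p\<close>, related by the chain rule (and
  \<open>0\<close> at pairs that are not such charts).  The dimension of the manifold is \<open>CARD('n)\<close>.\<close>

type_synonym ('a, 'n) chart = "'a set \<times> ('a \<Rightarrow> real ^ 'n)"
type_synonym ('a, 'n) tangent_vector = "('a, 'n) chart \<Rightarrow> real ^ 'n"

record ('a, 'n::finite) riem_mfd =
  mfd_top :: "'a topology"
  atlas :: "('a, 'n) chart set"
  riem_metric :: "'a \<Rightarrow> ('a, 'n) tangent_vector \<Rightarrow> ('a, 'n) tangent_vector \<Rightarrow> real"
  positive_bases :: "'a \<Rightarrow> ('a, 'n) tangent_vector list set"

abbreviation points :: "('a, 'n::finite) riem_mfd \<Rightarrow> 'a set"
  where "points M \<equiv> topspace (mfd_top M)"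

definition chart_inv :: "('a, 'n::finite) chart \<Rightarrow> real ^ 'n \<Rightarrow> 'a"
  where "chart_inv c = inv_into (fst c) (snd c)"

definition is_chart :: "'a topology \<Rightarrow> ('a, 'n::finite) chart \<Rightarrow> bool"
  where "is_chart X c \<longleftrightarrow> openin X (fst c) \<and>
     (open (snd c ` fst c) \<or>
      (\<exists>i. openin (top_of_set {x. 0 \<le> x $ i}) (snd c ` fst c))) \<and>
     homeomorphic_map (subtopology X (fst c)) (top_of_set (snd c ` fst c)) (snd c)"

definition smooth_manifold_with_boundary :: "('a, 'n::finite) riem_mfd \<Rightarrow> bool"
  where "smooth_manifold_with_boundary M \<longleftrightarrow>
     Hausdorff_space (mfd_top M) \<and> second_countable (mfd_top M) \<and>
     (\<forall>c\<in>atlas M. is_chart (mfd_top M) c) \<and>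
     (\<Union>c\<in>atlas M. fst c) = points M \<and>
     (\<forall>c\<in>atlas M. \<forall>c'\<in>atlas M. smooth_on (snd c ` (fst c \<inter> fst c')) (snd c' \<circ> chart_inv c))"

definition charts_at :: "('a, 'n::finite) riem_mfd \<Rightarrow> 'a \<Rightarrow> ('a, 'n) chart set"
  where "charts_at M p = {c \<in> atlas M. p \<in> fst c}"

definition chart_at :: "('a, 'n::finite) riem_mfd \<Rightarrow> 'a \<Rightarrow> ('a, 'n) chart"
  where "chart_at M p = (SOME c. c \<in> charts_at M p)"

text \<open>Derivative at \<open>p\<close> of a function \<open>h\<close> defined near \<open>p\<close>, in the direction with components \<open>w\<close>
  with respect to the chart \<open>c\<close>.  At boundary points the derivative relative to the chart image is
  still unique.\<close>

definition chart_deriv ::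
  "('a, 'n::finite) chart \<Rightarrow> ('a \<Rightarrow> 'b::real_normed_vector) \<Rightarrow> 'a \<Rightarrow> real ^ 'n \<Rightarrow> 'b"
  where "chart_deriv c h p w =
     frechet_derivative (h \<circ> chart_inv c) (at (snd c p) within snd c ` fst c) w"

definition tangent_space :: "('a, 'n::finite) riem_mfd \<Rightarrow> 'a \<Rightarrow> ('a, 'n) tangent_vector set"
  where "tangent_space M p = {v.
     (\<forall>c\<in>charts_at M p. \<forall>c'\<in>charts_at M p. v c' = chart_deriv c (snd c') p (v c)) \<and>
     (\<forall>c. c \<notin> charts_at M p \<longrightarrow> v c = 0)}"

text \<open>The tangent vector at \<open>p\<close> with components \<open>w\<close> with respect to the chart \<open>c\<close>.\<close>

definition coord_vector ::
  "('a, 'n::finite) riem_mfd \<Rightarrow> ('a, 'n) chart \<Rightarrow> 'a \<Rightarrow> real ^ 'n \<Rightarrow> ('a, 'n) tangent_vector"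
  where "coord_vector M c p w =
     (\<lambda>c'. if c' \<in> charts_at M p then chart_deriv c (snd c') p w else 0)"

definition tangent_ips :: "('a, 'n::finite) riem_mfd \<Rightarrow> 'a \<Rightarrow> ('a, 'n) tangent_vector oriented_ips"
  where "tangent_ips M p =
     \<lparr>ips_space = tangent_space M p, ips_inner = riem_metric M p, ips_positive = positive_bases M p\<rparr>"

definition metric_coeff ::
  "('a, 'n::finite) riem_mfd \<Rightarrow> ('a, 'n) chart \<Rightarrow> real ^ 'n \<Rightarrow> real ^ 'n \<Rightarrow> 'a \<Rightarrow> real"
  where "metric_coeff M c v w = (\<lambda>q. riem_metric M q (coord_vector M c q v) (coord_vector M c q w))"

text \<open>The last conjunct is the continuity of the orientation: around every point some frame with
  constant components in a chart is positively oriented.\<close>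

definition oriented_riemannian_manifold_with_boundary :: "('a, 'n::finite) riem_mfd \<Rightarrow> bool"
  where "oriented_riemannian_manifold_with_boundary M \<longleftrightarrow>
     smooth_manifold_with_boundary M \<and>
     (\<forall>p\<in>points M. oriented_inner_product_space (tangent_ips M p)) \<and>
     (\<forall>c\<in>atlas M. \<forall>v w. smooth_on (snd c ` fst c) (metric_coeff M c v w \<circ> chart_inv c)) \<and>
     (\<forall>p\<in>points M. \<exists>c\<in>charts_at M p. \<exists>U bs. openin (mfd_top M) U \<and> p \<in> U \<and> U \<subseteq> fst c \<and>
        (\<forall>q\<in>U. map (coord_vector M c q) bs \<in> positive_bases M q))"

definition smooth_map ::
  "('a, 'n::finite) riem_mfd \<Rightarrow> ('b, 'm::finite) riem_mfd \<Rightarrow> ('a \<Rightarrow> 'b) \<Rightarrow> bool"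
  where "smooth_map M N f \<longleftrightarrow> continuous_map (mfd_top M) (mfd_top N) f \<and>
     (\<forall>c\<in>atlas M. \<forall>c'\<in>atlas N.
        smooth_on (snd c ` {p \<in> fst c. f p \<in> fst c'}) (snd c' \<circ> f \<circ> chart_inv c))"

definition smooth_vector_field ::
  "('a, 'n::finite) riem_mfd \<Rightarrow> ('a \<Rightarrow> ('a, 'n) tangent_vector) \<Rightarrow> bool"
  where "smooth_vector_field M X \<longleftrightarrow> (\<forall>p\<in>points M. X p \<in> tangent_space M p) \<and>
     (\<forall>c\<in>atlas M. smooth_on (snd c ` fst c) ((\<lambda>q. X q c) \<circ> chart_inv c))"

text \<open>Derivative of a function along a tangent vector; the choice of the chart is immaterial.\<close>

definition tangent_deriv ::
  "('a, 'n::finite) riem_mfd \<Rightarrow> ('a \<Rightarrow> 'b::real_normed_vector) \<Rightarrow> 'a \<Rightarrow> ('a, 'n) tangent_vector \<Rightarrow> 'b"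
  where "tangent_deriv M h p u = chart_deriv (chart_at M p) h p (u (chart_at M p))"

definition differential ::
  "('a, 'n::finite) riem_mfd \<Rightarrow> ('b, 'm::finite) riem_mfd \<Rightarrow> ('a \<Rightarrow> 'b) \<Rightarrow> 'a \<Rightarrow>
     ('a, 'n) tangent_vector \<Rightarrow> ('b, 'm) tangent_vector"
  where "differential M N f p u =
     (\<lambda>c. if c \<in> charts_at N (f p) then tangent_deriv M (snd c \<circ> f) p u else 0)"


section \<open>Connections, divergence and coderivative\<close>

text \<open>The Christoffel map \<open>\<Gamma>(u, v)\<^sup>k = \<Gamma>\<^sup>k\<^sub>i\<^sub>j u\<^sup>i v\<^sup>j\<close> of the Levi-Civita connection in the chart \<open>c\<close>:
  the unique bilinear map that is symmetric (no torsion) and compatible with the metric.\<close>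

definition christoffel ::
  "('a, 'n::finite) riem_mfd \<Rightarrow> ('a, 'n) chart \<Rightarrow> 'a \<Rightarrow> real ^ 'n \<Rightarrow> real ^ 'n \<Rightarrow> real ^ 'n"
  where "christoffel M c p =
     (THE \<Gamma>. bilinear \<Gamma> \<and> (\<forall>u v. \<Gamma> u v = \<Gamma> v u) \<and>
        (\<forall>u v w. chart_deriv c (metric_coeff M c v w) p u =
           metric_coeff M c (\<Gamma> u v) w p + metric_coeff M c v (\<Gamma> u w) p))"

text \<open>\<open>(\<nabla>\<^sub>u Y)(p)\<close> for the Levi-Civita connection, with components
  \<open>u(Y\<^sup>k) + \<Gamma>\<^sup>k\<^sub>i\<^sub>j u\<^sup>i Y\<^sup>j\<close> in every chart.\<close>

definition levi_civita ::
  "('a, 'n::finite) riem_mfd \<Rightarrow> ('a \<Rightarrow> ('a, 'n) tangent_vector) \<Rightarrow> 'a \<Rightarrow>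
     ('a, 'n) tangent_vector \<Rightarrow> ('a, 'n) tangent_vector"
  where "levi_civita M Y p u =
     (\<lambda>c. if c \<in> charts_at M p
          then tangent_deriv M (\<lambda>q. Y q c) p u + christoffel M c p (u c) (Y p c) else 0)"

definition divergence ::
  "('a, 'n::finite) riem_mfd \<Rightarrow> ('a \<Rightarrow> ('a, 'n) tangent_vector) \<Rightarrow> 'a \<Rightarrow> real"
  where "divergence M Y p =
     (\<Sum>e\<leftarrow>some_orthonormal_basis (tangent_ips M p). riem_metric M p (levi_civita M Y p e) e)"

text \<open>\<open>(\<nabla>\<^sub>u s)(p)\<close> for a section \<open>s\<close> of \<open>f\<^sup>*TN\<close> and the pullback of the Levi-Civita connection of
  \<open>N\<close>, with components \<open>u(s\<^sup>k) + \<Gamma>\<^sup>k\<^sub>i\<^sub>j(f(p)) (df u)\<^sup>i s\<^sup>j\<close> in every chart of \<open>N\<close>.\<close>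

definition pullback_connection ::
  "('a, 'n::finite) riem_mfd \<Rightarrow> ('b, 'm::finite) riem_mfd \<Rightarrow> ('a \<Rightarrow> 'b) \<Rightarrow>
     ('a \<Rightarrow> ('b, 'm) tangent_vector) \<Rightarrow> 'a \<Rightarrow> ('a, 'n) tangent_vector \<Rightarrow> ('b, 'm) tangent_vector"
  where "pullback_connection M N f s p u =
     (\<lambda>c. if c \<in> charts_at N (f p)
          then tangent_deriv M (\<lambda>q. s q c) p u +
               christoffel N c (f p) (differential M N f p u c) (s p c)
          else 0)"

text \<open>\<open>(\<nabla>\<^sub>u \<omega>)(v) = \<nabla>\<^sub>u(\<omega>(Y)) - \<omega>(\<nabla>\<^sub>u Y)\<close> for a 1-form \<open>\<omega>\<close> with values in \<open>f\<^sup>*TN\<close> and tangent vectors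
  \<open>u\<close>, \<open>v\<close> at \<open>p\<close>, where \<open>Y\<close> is a vector field near \<open>p\<close> with \<open>Y(p) = v\<close>.  The value does not depend
  on \<open>Y\<close>; the field with constant components in a chart is used.\<close>

definition hom_connection ::
  "('a, 'n::finite) riem_mfd \<Rightarrow> ('b, 'm::finite) riem_mfd \<Rightarrow> ('a \<Rightarrow> 'b) \<Rightarrow>
     ('a \<Rightarrow> ('a, 'n) tangent_vector \<Rightarrow> ('b, 'm) tangent_vector) \<Rightarrow> 'a \<Rightarrow>
     ('a, 'n) tangent_vector \<Rightarrow> ('a, 'n) tangent_vector \<Rightarrow> ('b, 'm) tangent_vector"
  where "hom_connection M N f \<omega> p u v =
     (let Y = (\<lambda>q. coord_vector M (chart_at M p) q (v (chart_at M p))) in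
      pullback_connection M N f (\<lambda>q. \<omega> q (Y q)) p u - \<omega> p (levi_civita M Y p u))"

definition coderivative ::
  "('a, 'n::finite) riem_mfd \<Rightarrow> ('b, 'm::finite) riem_mfd \<Rightarrow> ('a \<Rightarrow> 'b) \<Rightarrow>
     ('a \<Rightarrow> ('a, 'n) tangent_vector \<Rightarrow> ('b, 'm) tangent_vector) \<Rightarrow> 'a \<Rightarrow> ('b, 'm) tangent_vector"
  where "coderivative M N f \<omega> p =
     - (\<Sum>e\<leftarrow>some_orthonormal_basis (tangent_ips M p). hom_connection M N f \<omega> p e e)"

definition Det_d ::
  "('a, 'n::finite) riem_mfd \<Rightarrow> ('b, 'n) riem_mfd \<Rightarrow> ('a \<Rightarrow> 'b) \<Rightarrow> 'a \<Rightarrow> real"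
  where "Det_d M N f p = Det (tangent_ips M p) (tangent_ips N (f p)) (differential M N f p)"

definition Cof_d ::
  "('a, 'n::finite) riem_mfd \<Rightarrow> ('b, 'n) riem_mfd \<Rightarrow> ('a \<Rightarrow> 'b) \<Rightarrow> 'a \<Rightarrow>
     ('a, 'n) tangent_vector \<Rightarrow> ('b, 'n) tangent_vector"
  where "Cof_d M N f p = Cof (tangent_ips M p) (tangent_ips N (f p)) (differential M N f p)"

definition Piola ::
  "('a, 'n::finite) riem_mfd \<Rightarrow> ('b, 'n) riem_mfd \<Rightarrow> ('a \<Rightarrow> 'b) \<Rightarrow>
     ('b \<Rightarrow> ('b, 'n) tangent_vector) \<Rightarrow> 'a \<Rightarrow> ('a, 'n) tangent_vector"
  where "Piola M N f X p =
     metric_transpose (tangent_ips M p) (tangent_ips N (f p)) (Cof_d M N f p) (X (f p))"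

end

theory Submission
  imports Defs "Jordan_Normal_Form.Determinant"
begin

text \<open>The Piola transform is characterised by
  \<open>\<langle>Piola X, W\<rangle> = \<langle>X \<circ> f, Cof df W\<rangle>\<close> for all vector fields \<open>W\<close>.  Differentiate this along a vector
  \<open>e\<close>, using that the Levi-Civita connection and its pullback are compatible with the metrics.  With
  \<open>C = Cof df\<close>, the terms containing \<open>\<nabla>W\<close> assemble to the covariant derivative of \<open>C\<close>:
  \<open>\<langle>\<nabla>\<^sub>e Piola X, e\<rangle> = \<langle>\<nabla>\<^bsub>df e\<^esub> X, C e\<rangle> + \<langle>X \<circ> f, (\<nabla>\<^sub>e C) e\<rangle>\<close>
  (\<open>divergence_integrand\<close>).  Sum over an orthonormal basis.  The last terms add up to minus the
  pairing of \<open>X \<circ> f\<close> with the coderivative of \<open>C\<close>.  The others add up to the trace of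
  \<open>C\<^sup>T \<circ> \<nabla>X \<circ> df\<close>, which is \<open>Det df\<close> times the trace of \<open>\<nabla>X\<close> because \<open>df \<circ> C\<^sup>T = Det df\<close>
  (\<open>trace_Cof\<close>).  No information on the derivative of \<open>C\<close> enters, only that \<open>C\<close> is differentiable.

  Two things have to be supplied.  The first is a usable form of the cofactor, which is given by Hodge
  duals in exterior powers.  The multivectors of degree \<open>0\<close>, \<open>1\<close>, \<open>d - 1\<close> and \<open>d\<close> are, respectively,
  scalars, vectors, contractions of the volume multivector with vectors, and multiples of it; this
  makes the four Hodge duals explicit and leads to
  \<open>\<langle>Cof A v, u\<rangle> = Det (A + u \<otimes> v) - Det A\<close> (\<open>Cof_eq\<close>).  In arbitrary positive frames \<open>b\<close>, \<open>b'\<close> the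
  determinant is \<open>det \<langle>b'\<^sub>i, A b\<^sub>j\<rangle>\<close> divided by the root of the two Gram determinants
  (\<open>det_between_positive_bases\<close>).  Together these formulas give the trace identity by multiplicativity
  of determinants, and the differentiability of the cofactor and of the Piola transform by evaluating
  them in frames with constant components.

  The second is that covariant derivatives are tangent vectors, although they are defined by
  components in each chart separately.  This is the transformation law of the Christoffel forms
  (\<open>christoffel_transform\<close>), which follows from their uniqueness and from the symmetry of the second
  derivatives of coordinate changes, at boundary points as well.\<close>

no_notation Matrix.vec_index (infixl "$" 100)

section \<open>Determinants of real families\<close>

text \<open>Bases are lists, so matrices are indexed by natural numbers; this evaluates a family of entries
  without carrying around matrices with a fixed carrier.\<close>

definition fdet :: "nat \<Rightarrow> (nat \<Rightarrow> nat \<Rightarrow> real) \<Rightarrow> real"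
  where "fdet d F = Determinant.det (Matrix.mat d d (\<lambda>(i, j). F i j))"

lemma fdet_cong:
  assumes "\<And>i j. i < d \<Longrightarrow> j < d \<Longrightarrow> F i j = G i j"
  shows "fdet d F = fdet d G"
  unfolding fdet_def by (rule arg_cong[where f = Determinant.det]) (auto simp: assms)

lemma fdet_permutations:
  "fdet d F = (\<Sum>\<sigma> | \<sigma> permutes {..<d}. of_int (sign \<sigma>) * (\<Prod>i<d. F i (\<sigma> i)))"
proof -
  have "fdet d F = (\<Sum>p | p permutes {0..<d}. of_int (sign p) * (\<Prod>i = 0..<d. Matrix.mat d d (\<lambda>(i, j). F i j) $$ (i, p i)))"
    unfolding fdet_def by (rule Determinant.det_def') auto
  also have "\<dots> = (\<Sum>\<sigma> | \<sigma> permutes {..<d}. of_int (sign \<sigma>) * (\<Prod>i<d. F i (\<sigma> i)))"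
    unfolding atLeast0LessThan
  proof (rule sum.cong[OF refl])
    fix p assume "p \<in> {p. p permutes {..<d}}"
    then have "p i < d" if "i < d" for i using permutes_in_image[of p "{..<d}" i] that by simp
    then show "of_int (sign p) * (\<Prod>i<d. Matrix.mat d d (\<lambda>(i, j). F i j) $$ (i, p i)) =
        of_int (sign p) * (\<Prod>i<d. F i (p i))" by simp
  qed
  finally show ?thesis .
qed

lemma fdet_transpose: "fdet d (\<lambda>i j. F j i) = fdet d F"
proof -
  have "fdet d (\<lambda>i j. F j i) = Determinant.det (transpose_mat (Matrix.mat d d (\<lambda>(i, j). F i j)))"
    unfolding fdet_def by (rule arg_cong[where f = Determinant.det]) auto
  also have "\<dots> = fdet d F"
    unfolding fdet_def by (rule Determinant.det_transpose) auto
  finally show ?thesis .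
qed

lemma fdet_mult: "fdet d (\<lambda>i j. \<Sum>k<d. F i k * G k j) = fdet d F * fdet d G"
proof -
  have "fdet d (\<lambda>i j. \<Sum>k<d. F i k * G k j) =
    Determinant.det (Matrix.mat d d (\<lambda>(i, j). F i j) * Matrix.mat d d (\<lambda>(i, j). G i j))"
    unfolding fdet_def
    by (rule arg_cong[where f = Determinant.det])
      (auto simp: scalar_prod_def atLeast0LessThan)
  also have "\<dots> = fdet d F * fdet d G"
    unfolding fdet_def by (rule Determinant.det_mult) auto
  finally show ?thesis .
qed

lemma fdet_identical_rows:
  assumes "i < d" "j < d" "i \<noteq> j" "F i = F j"
  shows "fdet d F = 0"
  unfolding fdet_def
  by (rule Determinant.det_identical_rows[where n = d and i = i and j = j]) (use assms in auto)

lemma fdet_row_linear: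
  assumes "i < d"
  shows "fdet d (F(i := \<lambda>j. a * v j + b * w j)) = a * fdet d (F(i := v)) + b * fdet d (F(i := w))"
proof -
  have prod: "(\<Prod>k<d. (F(i := x)) k (\<sigma> k)) = x (\<sigma> i) * (\<Prod>k\<in>{..<d} - {i}. F k (\<sigma> k))" for x \<sigma>
    using assms by (subst prod.remove[of _ i]) auto
  show ?thesis
    unfolding fdet_permutations prod sum_distrib_left sum.distrib[symmetric]
    by (intro sum.cong) (auto simp: algebra_simps)
qed

lemma fdet_row_add_multiple:
  assumes "i < d" "m < d" "i \<noteq> m"
  shows "fdet d (F(i := \<lambda>j. F i j + c * F m j)) = fdet d F"
proof -
  have "fdet d (F(i := \<lambda>j. 1 * F i j + c * F m j)) = 1 * fdet d (F(i := F i)) + c * fdet d (F(i := F m))"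
    by (rule fdet_row_linear) fact
  also have "fdet d (F(i := F m)) = 0"
    by (rule fdet_identical_rows[of i d m]) (use assms in auto)
  finally show ?thesis by (simp add: fun_upd_def)
qed

text \<open>Row operations: multiples of row \<open>m\<close> may be added to the rows above it, one after the other.\<close>

lemma fdet_clear_multiples:
  assumes "m < d" "k \<le> m"
  shows "fdet d (\<lambda>i j. if i < k then F i j + u i * F m j else F i j) = fdet d F"
  using assms(2)
proof (induction k)
  case 0 then show ?case by simp
next
  case (Suc k)
  let ?G = "\<lambda>i j. if i < k then F i j + u i * F m j else F i j"
  have "(\<lambda>i j. if i < Suc k then F i j + u i * F m j else F i j) = ?G(k := \<lambda>j. ?G k j + u k * ?G m j)"
    using Suc.prems by (auto simp: fun_eq_iff)
  then show ?case
    using fdet_row_add_multiple[of k d m ?G "u k"] Suc assms(1) by simp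
qed

text \<open>The rows are perturbed one at a time.  Perturbing row \<open>k\<close> adds \<open>u k\<close> times the determinant with
  row \<open>k\<close> replaced by \<open>v\<close>, and in that determinant the earlier perturbations, being multiples of the
  row \<open>v\<close>, can be cleared.  This formula is what turns the cofactor into a difference of two
  determinants.\<close>

lemma fdet_rank_one:
  "fdet d (\<lambda>i j. F i j + u i * v j) = fdet d F + (\<Sum>i<d. u i * fdet d (F(i := v)))"
proof -
  let ?P = "\<lambda>k i j. if i < k then F i j + u i * v j else F i j"
  have "k \<le> d \<Longrightarrow> fdet d (?P k) = fdet d F + (\<Sum>i<k. u i * fdet d (F(i := v)))" for k
  proof (induction k)
    case 0 then show ?case by simp
  next
    case (Suc k)
    then have k: "k < d" by simp
    have "?P (Suc k) = (?P k)(k := \<lambda>j. 1 * F k j + u k * v j)"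
      by (auto simp: fun_eq_iff less_Suc_eq)
    then have "fdet d (?P (Suc k)) = fdet d ((?P k)(k := F k)) + u k * fdet d ((?P k)(k := v))"
      using fdet_row_linear[OF k, of "?P k" 1 "F k" "u k" v] by simp
    also have "(?P k)(k := F k) = ?P k" by (auto simp: fun_eq_iff)
    also have "fdet d ((?P k)(k := v)) = fdet d (F(k := v))"
    proof -
      have "(?P k)(k := v) = (\<lambda>i j. if i < k then (F(k := v)) i j + u i * (F(k := v)) k j else (F(k := v)) i j)"
        by (auto simp: fun_eq_iff)
      then show ?thesis using fdet_clear_multiples[OF k order_refl, of "F(k := v)" u] by simp
    qed
    finally show ?case using Suc by (simp add: fun_upd_def)
  qed
  from this[of d] show ?thesis
    by (smt (verit) fdet_cong order_refl)
qed

lemma fdet_identity: "fdet d (\<lambda>i j. if i = j then 1 else 0) = 1"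
proof -
  have "Matrix.mat d d (\<lambda>(i, j). if i = j then 1 else 0) = (1\<^sub>m d :: real mat)" by auto
  then show ?thesis unfolding fdet_def by simp
qed

lemma fdet_identity_replace_row:
  assumes "i < d"
  shows "fdet d ((\<lambda>i j. if i = j then 1 else 0)(i := v)) = v i"
proof -
  let ?I = "\<lambda>i j. if i = j then 1 else 0 :: real"
  \<comment> \<open>Only the identity permutation avoids the zero entries of the other rows.\<close>
  have zero: "(\<Prod>k<d. (?I(i := v)) k (\<sigma> k)) = 0" if "\<sigma> permutes {..<d}" "\<sigma> \<noteq> id" for \<sigma>
  proof -
    have "\<exists>k<d. k \<noteq> i \<and> \<sigma> k \<noteq> k"
    proof (rule ccontr)
      assume "\<not> ?thesis"
      then have id_off: "\<sigma> k = k" if "k \<noteq> i" for k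
        using that \<open>\<sigma> permutes {..<d}\<close> by (metis lessThan_iff permutes_not_in)
      then have "\<sigma> i = i" using permutes_inj[OF \<open>\<sigma> permutes {..<d}\<close>] by (metis injD)
      with id_off have "\<sigma> = id" by (intro ext) (metis id_apply)
      with that show False by simp
    qed
    then obtain k where "k < d" "k \<noteq> i" "\<sigma> k \<noteq> k" by blast
    then show ?thesis by (intro prod_zero) (auto intro!: bexI[of _ k])
  qed
  have "fdet d (?I(i := v)) = (\<Sum>\<sigma>\<in>{id}. of_int (sign \<sigma>) * (\<Prod>k<d. (?I(i := v)) k (\<sigma> k)))"
    unfolding fdet_permutations
    by (rule sum.mono_neutral_right) (use zero in \<open>auto simp: finite_permutations permutes_id simp del: prod_zero_iff\<close>)
  also have "\<dots> = (\<Prod>k<d. (?I(i := v)) k k)" by (simp add: sign_id)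
  also have "\<dots> = v i" using assms by (subst prod.remove[of _ i]) auto
  finally show ?thesis .
qed

text \<open>The perturbed matrix is the product of \<open>F\<close> with \<open>1 + u v\<^sup>T\<close>.\<close>

lemma fdet_mult_rank_one:
  "fdet d (\<lambda>i j. F i j + (\<Sum>k<d. F i k * u k) * v j) = fdet d F * (1 + (\<Sum>i<d. u i * v i))"
proof -
  let ?I = "\<lambda>i j. if i = j then 1 else 0 :: real"
  have "(\<Sum>k<d. F i k * (?I k j + u k * v j)) = F i j + (\<Sum>k<d. F i k * u k) * v j" if "j < d" for i j
    using that by (simp add: distrib_left sum.distrib sum_distrib_right mult.assoc if_distrib[of "(*) _"] sum.delta cong: if_cong)
  then have "fdet d (\<lambda>i j. F i j + (\<Sum>k<d. F i k * u k) * v j) =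
      fdet d (\<lambda>i j. \<Sum>k<d. F i k * (?I k j + u k * v j))"
    by (intro fdet_cong) simp
  also have "\<dots> = fdet d F * fdet d (\<lambda>i j. ?I i j + u i * v j)" by (rule fdet_mult)
  also have "fdet d (\<lambda>i j. ?I i j + u i * v j) = 1 + (\<Sum>i<d. u i * v i)"
    by (simp add: fdet_rank_one fdet_identity fdet_identity_replace_row)
  finally show ?thesis .
qed

section \<open>Alternating forms on the dual space\<close>

lemma finite_dual_sum:
  assumes "finite J" "\<And>j. j \<in> J \<Longrightarrow> \<psi> j \<in> dual_space V"
  shows "(\<lambda>x. \<Sum>j\<in>J. c j * \<psi> j x) \<in> dual_space V"
  using assms(2) unfolding dual_space_def
  by (auto simp: sum.distrib distrib_left sum_distrib_left mult.left_commute intro!: sum.cong sum.neutral)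

lemma dual_space_combination:
  assumes "\<phi> \<in> dual_space V" "\<psi> \<in> dual_space V"
  shows "a *\<^sub>R \<phi> + b *\<^sub>R \<psi> \<in> dual_space V"
  using assms unfolding dual_space_def
  by (auto simp: scaleR_fun_def plus_fun_def algebra_simps)

lemma ext_power_linear:
  assumes "\<omega> \<in> ext_power k V" "length \<phi>s = k" "set \<phi>s \<subseteq> dual_space V" "i < k"
    "\<phi> \<in> dual_space V" "\<psi> \<in> dual_space V"
  shows "\<omega> (\<phi>s[i := a *\<^sub>R \<phi> + b *\<^sub>R \<psi>]) = a * \<omega> (\<phi>s[i := \<phi>]) + b * \<omega> (\<phi>s[i := \<psi>])"
  using assms unfolding ext_power_def by blast

lemma ext_power_outside:
  assumes "\<omega> \<in> ext_power k V" "\<not> (length \<phi>s = k \<and> set \<phi>s \<subseteq> dual_space V)"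
  shows "\<omega> \<phi>s = 0"
  using assms unfolding ext_power_def by blast

lemma ext_power_repeated:
  assumes "\<omega> \<in> ext_power k V" "\<not> distinct \<phi>s"
  shows "\<omega> \<phi>s = 0"
  using assms unfolding ext_power_def by blast

lemma ext_power_sum:
  assumes \<omega>: "\<omega> \<in> ext_power k V" "length \<phi>s = k" "set \<phi>s \<subseteq> dual_space V" "i < k"
    and J: "finite J" "\<And>j. j \<in> J \<Longrightarrow> \<psi> j \<in> dual_space V"
  shows "\<omega> (\<phi>s[i := (\<lambda>x. \<Sum>j\<in>J. c j * \<psi> j x)]) = (\<Sum>j\<in>J. c j * \<omega> (\<phi>s[i := \<psi> j]))"
  using J
proof (induction J rule: finite_induct)
  case empty
  have "(\<lambda>x. 0) \<in> dual_space V" by (auto simp: dual_space_def)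
  from ext_power_linear[OF \<omega> this this, of 0 0] show ?case
    by (simp add: scaleR_fun_def plus_fun_def)
next
  case (insert j J)
  let ?\<chi> = "\<lambda>x. \<Sum>j\<in>J. c j * \<psi> j x"
  have \<chi>: "?\<chi> \<in> dual_space V" using insert by (intro finite_dual_sum) auto
  have "(\<lambda>x. \<Sum>j\<in>insert j J. c j * \<psi> j x) = c j *\<^sub>R \<psi> j + 1 *\<^sub>R ?\<chi>"
    using insert by (simp add: scaleR_fun_def plus_fun_def fun_eq_iff)
  then show ?case using ext_power_linear[OF \<omega>, of "\<psi> j" ?\<chi> "c j" 1] \<chi> insert by simp
qed

text \<open>Polarisation: expand the vanishing value at the list with \<open>\<phi> + \<psi>\<close> in both places.\<close>

lemma ext_power_swap:
  assumes \<omega>: "\<omega> \<in> ext_power k V" "length \<phi>s = k" "set \<phi>s \<subseteq> dual_space V"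
    and ij: "i < k" "j < k" "i \<noteq> j"
  shows "\<omega> (\<phi>s[i := \<phi>s ! j, j := \<phi>s ! i]) = - \<omega> \<phi>s"
proof -
  let ?x = "\<phi>s ! i" and ?y = "\<phi>s ! j"
  have x: "?x \<in> dual_space V" and y: "?y \<in> dual_space V" using assms nth_mem by blast+
  have xy: "1 *\<^sub>R ?x + 1 *\<^sub>R ?y \<in> dual_space V" by (rule dual_space_combination[OF x y])
  have same: "\<omega> (\<phi>s[i := z, j := z]) = 0" for z
  proof (rule ext_power_repeated[OF \<omega>(1)])
    have "\<phi>s[i := z, j := z] ! i = \<phi>s[i := z, j := z] ! j"
      using ij \<omega>(2) by (simp add: nth_list_update)
    then show "\<not> distinct (\<phi>s[i := z, j := z])"
      using ij \<omega>(2) by (metis length_list_update nth_eq_iff_index_eq)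
  qed
  have split_j: "\<omega> (\<phi>s[i := z, j := 1 *\<^sub>R ?x + 1 *\<^sub>R ?y]) = \<omega> (\<phi>s[i := z, j := ?x]) + \<omega> (\<phi>s[i := z, j := ?y])"
    if "z \<in> dual_space V" for z
    using ext_power_linear[OF \<omega>(1), of "\<phi>s[i := z]" j ?x ?y 1 1] x y that ij \<omega>(2,3)
    by (simp add: set_update_subsetI)
  have split_i: "\<omega> (\<phi>s[i := 1 *\<^sub>R ?x + 1 *\<^sub>R ?y, j := z]) = \<omega> (\<phi>s[i := ?x, j := z]) + \<omega> (\<phi>s[i := ?y, j := z])"
    if "z \<in> dual_space V" for z
    unfolding list_update_swap[OF ij(3)]
    using ext_power_linear[OF \<omega>(1), of "\<phi>s[j := z]" i ?x ?y 1 1] x y that ij \<omega>(2,3)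
    by (simp add: set_update_subsetI)
  have "\<omega> (\<phi>s[i := ?x, j := ?y]) + \<omega> (\<phi>s[i := ?y, j := ?x]) = 0"
    using same[of "1 *\<^sub>R ?x + 1 *\<^sub>R ?y"] split_j[OF xy] split_i[OF x] split_i[OF y] same[of ?x] same[of ?y]
    by simp
  then show ?thesis by simp
qed

lemma ext_power_permute:
  assumes \<omega>: "\<omega> \<in> ext_power k V" and "\<sigma> permutes {..<k}"
    and "length \<phi>s = k" "set \<phi>s \<subseteq> dual_space V"
  shows "\<omega> (permute_list \<sigma> \<phi>s) = of_int (sign \<sigma>) * \<omega> \<phi>s"
  using assms(2) finite_lessThan assms(3,4)
proof (induction \<sigma> arbitrary: \<phi>s rule: permutes_induct)
  case id
  then show ?case by (simp add: sign_id)
next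
  case (swap a b p)
  let ?\<tau> = "Transposition.transpose a b"
  have p: "permutation p" using swap by (auto simp: permutation_permutes)
  have \<tau>: "?\<tau> permutes {..<length \<phi>s}" using swap by (auto intro: permutes_swap_id)
  have list: "permute_list ?\<tau> \<phi>s = \<phi>s[a := \<phi>s ! b, b := \<phi>s ! a]"
    using swap(1,2,6) by (intro nth_equalityI) (auto simp: permute_list_def nth_list_update Transposition.transpose_def)
  show ?case
  proof (cases "a = b")
    case True
    then show ?thesis using swap by simp
  next
    case False
    have "permute_list (?\<tau> \<circ> p) \<phi>s = permute_list p (permute_list ?\<tau> \<phi>s)"
      using swap by (intro permute_list_compose) auto
    also have "\<omega> \<dots> = of_int (sign p) * \<omega> (permute_list ?\<tau> \<phi>s)"
      using swap \<tau> by (intro swap.IH) auto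
    also have "\<omega> (permute_list ?\<tau> \<phi>s) = - \<omega> \<phi>s"
      unfolding list using swap False by (intro ext_power_swap[OF \<omega>]) auto
    also have "of_int (sign p) * - \<omega> \<phi>s = of_int (sign (?\<tau> \<circ> p)) * \<omega> \<phi>s"
      unfolding sign_compose[OF permutation_swap_id p] sign_swap_id using False by simp
    finally show ?thesis .
  qed
qed

lemma ext_power_move_last:
  assumes \<omega>: "\<omega> \<in> ext_power k V" and "length (xs @ y # zs) = k" "set (xs @ y # zs) \<subseteq> dual_space V"
  shows "\<omega> (xs @ y # zs) = (-1) ^ length xs * \<omega> (y # xs @ zs)"
  using assms(2,3)
proof (induction xs arbitrary: zs rule: rev_induct)
  case Nil then show ?case by simp
next
  case (snoc x xs)
  have "\<omega> (xs @ x # y # zs) = - \<omega> (xs @ y # x # zs)"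
    using ext_power_swap[OF \<omega>, of "xs @ y # x # zs" "length xs" "Suc (length xs)"] snoc.prems
    by (simp add: nth_append list_update_append)
  also have "\<omega> (xs @ y # x # zs) = (-1) ^ length xs * \<omega> (y # xs @ x # zs)"
    using snoc.prems by (intro snoc.IH) auto
  finally show ?case by simp
qed

text \<open>The factor by which the normalisation of \<open>wedge\<close> overcounts when one of the factors has degree one.\<close>

lemma sum_permutations_at:
  fixes g :: "nat \<Rightarrow> real"
  assumes "k < d"
  shows "(\<Sum>\<sigma> | \<sigma> permutes {..<d}. g (\<sigma> k)) = fact (d - 1) * (\<Sum>i<d. g i)"
proof -
  let ?P = "{\<sigma>. \<sigma> permutes {..<d}}"
  let ?c = "\<lambda>i. card {\<sigma> \<in> ?P. \<sigma> k = i}"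
  have fin: "finite ?P" by (simp add: finite_permutations)
  \<comment> \<open>Composition with a transposition shows that all values of \<open>\<sigma> k\<close> are taken equally often.\<close>
  have eq: "?c i = ?c k" if "i < d" for i
  proof (rule bij_betw_same_card)
    let ?\<tau> = "Transposition.transpose i k"
    have \<tau>: "Transposition.transpose i k \<circ> \<sigma> permutes {..<d}"
      if "\<sigma> permutes {..<d}" "i < d" for \<sigma> i
      using that assms by (intro permutes_compose permutes_swap_id) auto
    show "bij_betw ((\<circ>) ?\<tau>) {\<sigma> \<in> ?P. \<sigma> k = i} {\<sigma> \<in> ?P. \<sigma> k = k}"
      using \<open>i < d\<close> by (intro bij_betw_byWitness[where f' = "(\<circ>) ?\<tau>"])
        (auto simp: comp_assoc[symmetric] intro: \<tau>)
  qed
  have by_value: "(\<Sum>\<sigma>\<in>?P. h (\<sigma> k)) = (\<Sum>i<d. real (?c i) * h i)" for h :: "nat \<Rightarrow> real"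
  proof -
    have "(\<Sum>\<sigma>\<in>?P. h (\<sigma> k)) = (\<Sum>i\<in>{..<d}. \<Sum>\<sigma>\<in>{\<sigma> \<in> ?P. \<sigma> k = i}. h (\<sigma> k))"
      using fin assms by (intro sum.group[symmetric]) (auto simp: permutes_in_image[of _ "{..<d}", simplified])
    then show ?thesis by simp
  qed
  have "real (fact d) = (\<Sum>i<d. real (?c i))"
    using by_value[of "\<lambda>_. 1"] by (simp add: card_permutations)
  also have "\<dots> = (\<Sum>i<d. real (?c k))" by (rule sum.cong[OF refl]) (simp only: lessThan_iff eq)
  also have "\<dots> = real d * real (?c k)" by simp
  finally have "real d * fact (d - 1) = real d * real (?c k)"
    using assms by (simp add: fact_reduce)
  then have "real (?c k) = fact (d - 1)" using assms by simp
  then have "real (?c i) = fact (d - 1)" if "i < d" for i using eq[OF that] by simp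
  then show ?thesis unfolding by_value sum_distrib_left by (intro sum.cong) auto
qed

section \<open>Orthonormal bases and the Riesz isomorphism\<close>

text \<open>The spaces are nonzero, so that an orthonormal basis can be adapted to the orientation by reversing
  one of its vectors.\<close>

locale oriented_ips =
  fixes V :: "'v::real_vector oriented_ips"
  assumes oriented_ips: "oriented_inner_product_space V"
    and dim_positive: "dim (ips_space V) > 0"
begin

abbreviation S where "S \<equiv> ips_space V"
abbreviation ip where "ip \<equiv> ips_inner V"
abbreviation d where "d \<equiv> dim S"

lemma subspace: "subspace S" and inner_product: "is_inner_product S ip"
  and orientation: "is_orientation S (ips_positive V)"
  using oriented_ips unfolding oriented_inner_product_space_def by auto

lemmas space_closed = subspace_0[OF subspace] subspace_add[OF subspace] subspace_diff[OF subspace]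
  subspace_scale[OF subspace] subspace_neg[OF subspace] subspace_sum[OF subspace]

lemma ip_commute: "x \<in> S \<Longrightarrow> y \<in> S \<Longrightarrow> ip x y = ip y x"
  and ip_add_left: "x \<in> S \<Longrightarrow> y \<in> S \<Longrightarrow> z \<in> S \<Longrightarrow> ip (x + y) z = ip x z + ip y z"
  and ip_scale_left: "x \<in> S \<Longrightarrow> y \<in> S \<Longrightarrow> ip (a *\<^sub>R x) y = a * ip x y"
  and ip_positive: "x \<in> S \<Longrightarrow> x \<noteq> 0 \<Longrightarrow> ip x x > 0"
  using inner_product unfolding is_inner_product_def by auto

lemma ip_add_right:
  assumes "x \<in> S" "y \<in> S" "z \<in> S"
  shows "ip z (x + y) = ip z x + ip z y"
  using ip_add_left[OF assms] ip_commute[of z "x + y"] ip_commute[of z x] ip_commute[of z y] assms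
  by (simp add: space_closed)

lemma ip_scale_right:
  assumes "x \<in> S" "y \<in> S"
  shows "ip y (a *\<^sub>R x) = a * ip y x"
  using ip_scale_left[OF assms] ip_commute[of y "a *\<^sub>R x"] ip_commute[of y x] assms
  by (simp add: space_closed)

lemma ip_zero: "x \<in> S \<Longrightarrow> ip 0 x = 0" "x \<in> S \<Longrightarrow> ip x 0 = 0"
  using ip_scale_left[of 0 x 0] ip_scale_right[of 0 x 0] space_closed(1) by auto

lemma ip_minus_left: "x \<in> S \<Longrightarrow> y \<in> S \<Longrightarrow> ip (- x) y = - ip x y"
  and ip_minus_right: "x \<in> S \<Longrightarrow> y \<in> S \<Longrightarrow> ip y (- x) = - ip y x"
  using ip_scale_left[of x y "-1"] ip_scale_right[of x y "-1"] by auto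

lemma ip_diff_left: "x \<in> S \<Longrightarrow> y \<in> S \<Longrightarrow> z \<in> S \<Longrightarrow> ip (x - y) z = ip x z - ip y z"
  using ip_add_left[of x "- y" z] ip_minus_left[of y z] space_closed by simp

lemma ip_sum_left:
  "finite J \<Longrightarrow> (\<And>j. j \<in> J \<Longrightarrow> x j \<in> S) \<Longrightarrow> y \<in> S \<Longrightarrow> ip (\<Sum>j\<in>J. x j) y = (\<Sum>j\<in>J. ip (x j) y)"
  by (induction J rule: finite_induct) (auto simp: ip_zero ip_add_left space_closed)

lemma ip_sum_right:
  "finite J \<Longrightarrow> (\<And>j. j \<in> J \<Longrightarrow> x j \<in> S) \<Longrightarrow> y \<in> S \<Longrightarrow> ip y (\<Sum>j\<in>J. x j) = (\<Sum>j\<in>J. ip y (x j))"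
  by (induction J rule: finite_induct) (auto simp: ip_zero ip_add_right space_closed)

lemma ip_eqI:
  assumes "x \<in> S" "y \<in> S" "\<And>z. z \<in> S \<Longrightarrow> ip x z = ip y z"
  shows "x = y"
proof (rule ccontr)
  assume "x \<noteq> y"
  then have "ip (x - y) (x - y) > 0" using assms space_closed by (intro ip_positive) auto
  moreover have "ip (x - y) (x - y) = 0" using assms space_closed by (simp add: ip_diff_left)
  ultimately show False by simp
qed

lemma ordered_basis_facts:
  assumes "b \<in> ordered_bases S"
  shows "length b = d" "distinct b" "independent (set b)" "span (set b) = S" "\<And>i. i < d \<Longrightarrow> b ! i \<in> S"
proof -
  show b: "distinct b" "independent (set b)" "span (set b) = S"
    using assms unfolding ordered_bases_def by auto
  then show len: "length b = d" using dim_span_eq_card_independent[of "set b"] distinct_card[of b] by simp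
  show "b ! i \<in> S" if "i < d" for i
    using that len b(3) span_base[OF nth_mem[of i b]] by simp
qed

lemma ordered_basis_expansion:
  assumes "b \<in> ordered_bases S" "x \<in> S"
  obtains c where "x = (\<Sum>i<d. c i *\<^sub>R b ! i)"
proof -
  note b = ordered_basis_facts[OF assms(1)]
  have "x \<in> span (set b)" using b assms by simp
  then obtain u where "x = (\<Sum>v\<in>set b. u v *\<^sub>R v)" unfolding span_finite[OF finite_set] by auto
  also have "\<dots> = (\<Sum>i<d. u (b ! i) *\<^sub>R b ! i)"
    using bij_betw_nth[OF b(2) refl refl] b(1) by (intro sum.reindex_bij_betw[symmetric]) (simp add: lessThan_def)
  finally show ?thesis by (rule that)
qed

lemma orthonormal_independent:
  assumes "finite T" "T \<subseteq> S" "\<And>x y. x \<in> T \<Longrightarrow> y \<in> T \<Longrightarrow> ip x y = (if x = y then 1 else 0)"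
  shows "independent T"
  unfolding independent_explicit_finite_subsets
proof (intro allI impI ballI)
  fix A u v assume A: "A \<subseteq> T" "finite A" and 0: "(\<Sum>v\<in>A. u v *\<^sub>R v) = 0" and v: "v \<in> A"
  have "0 = ip (\<Sum>v\<in>A. u v *\<^sub>R v) v" using 0 v A assms by (auto simp: ip_zero)
  also have "\<dots> = (\<Sum>w\<in>A. ip (u w *\<^sub>R w) v)"
    using A v assms(2) by (intro ip_sum_left) (auto intro!: space_closed)
  also have "\<dots> = (\<Sum>w\<in>A. if w = v then u v else 0)"
    using A v assms by (intro sum.cong refl) (auto simp: ip_scale_left subset_eq)
  also have "\<dots> = u v" using A v by simp
  finally show "u v = 0" by simp
qed

lemma finite_spanning: obtains T where "finite T" "span T = S"
  using oriented_ips unfolding oriented_inner_product_space_def by auto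

lemma ex_orthonormal_basis: "\<exists>e. orthonormal_basis V e"
proof -
  obtain T where T: "finite T" "span T = S" by (rule finite_spanning)
  let ?on = "\<lambda>E. finite E \<and> E \<subseteq> S \<and> (\<forall>x\<in>E. \<forall>y\<in>E. ip x y = (if x = y then 1 else 0))"
  have bound: "card E \<le> card T" if "?on E" for E
  proof -
    have "independent E" using that by (intro orthonormal_independent) simp_all
    then show ?thesis using independent_span_bound[OF T(1), of E] that T(2) by simp
  qed
  \<comment> \<open>An orthonormal set of maximal cardinality spans: a vector outside its span could be
    projected, normalised and added.\<close>
  have "\<exists>E. ?on E \<and> (\<forall>F. ?on F \<longrightarrow> card F \<le> card E)"
    by (rule ex_has_greatest_nat[of ?on "{}" card "Suc (card T)"]) (auto simp: less_Suc_eq_le intro: bound)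
  then obtain E where E: "?on E" and max: "\<And>F. ?on F \<Longrightarrow> card F \<le> card E" by blast
  have "span E = S"
  proof (rule ccontr)
    assume "span E \<noteq> S"
    moreover have "span E \<subseteq> S" using E subspace by (intro span_minimal) auto
    ultimately obtain v where v: "v \<in> S" "v \<notin> span E" by blast
    define p where "p = (\<Sum>x\<in>E. ip v x *\<^sub>R x)"
    have p: "p \<in> span E" unfolding p_def by (intro span_sum span_scale span_base)
    have pS: "p \<in> S" using p \<open>span E \<subseteq> S\<close> by blast
    define w where "w = v - p"
    have w: "w \<in> S" "w \<noteq> 0" using v p pS space_closed(3)[of v p] unfolding w_def by auto
    have orth: "ip w y = 0" if "y \<in> E" for y
    proof -
      have y: "y \<in> S" using E subsetD[of E S y] that by simp
      have "ip p y = (\<Sum>x\<in>E. ip (ip v x *\<^sub>R x) y)"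
        unfolding p_def using E y by (intro ip_sum_left space_closed(4)) auto
      also have "\<dots> = (\<Sum>x\<in>E. if x = y then ip v y else 0)"
        using E that y by (intro sum.cong refl) (auto simp: ip_scale_left subset_eq)
      also have "\<dots> = ip v y" using E that by simp
      finally show ?thesis unfolding w_def using ip_diff_left[OF v(1) pS y] by simp
    qed
    define n where "n = (1 / sqrt (ip w w)) *\<^sub>R w"
    have pos: "ip w w > 0" using w by (rule ip_positive)
    have n: "n \<in> S" unfolding n_def using w(1) by (rule space_closed(4))
    have "ip n n = (1 / sqrt (ip w w)) * ((1 / sqrt (ip w w)) * ip w w)"
      unfolding n_def using w(1) by (simp only: ip_scale_left ip_scale_right space_closed(4))
    also have "\<dots> = ip w w / (sqrt (ip w w))\<^sup>2" by (simp add: power2_eq_square)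
    finally have nn: "ip n n = 1" using pos by simp
    have ny: "ip n y = 0" "ip y n = 0" if "y \<in> E" for y
    proof -
      have y: "y \<in> S" using E subsetD[of E S y] that by simp
      show "ip n y = 0" unfolding n_def using ip_scale_left[OF w(1) y] orth[OF that] by simp
      then show "ip y n = 0" using ip_commute[OF n y] by simp
    qed
    have "n \<notin> E" using ny(1) nn by force
    moreover have "?on (insert n E)" using E n nn ny \<open>n \<notin> E\<close> by auto
    ultimately show False using max[of "insert n E"] E by simp
  qed
  moreover obtain e where e: "set e = E" "distinct e" using finite_distinct_list[of E] E by metis
  moreover have "independent E" using E by (intro orthonormal_independent) simp_all
  ultimately have "e \<in> ordered_bases S" unfolding ordered_bases_def by simp
  moreover have "ip (e ! i) (e ! j) = (if i = j then 1 else 0)" if "i < length e" "j < length e" for i j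
    using E nth_mem[OF that(1)] nth_mem[OF that(2)] nth_eq_iff_index_eq[OF e(2) that] e(1) by simp
  ultimately show ?thesis unfolding orthonormal_basis_def by blast
qed

lemma some_orthonormal_basis: "orthonormal_basis V (some_orthonormal_basis V)"
  unfolding some_orthonormal_basis_def using ex_orthonormal_basis by (rule someI_ex)

lemma orthonormal_basisD:
  assumes "orthonormal_basis V e"
  shows "e \<in> ordered_bases S" "length e = d" "\<And>i. i < d \<Longrightarrow> e ! i \<in> S"
    "\<And>i j. i < d \<Longrightarrow> j < d \<Longrightarrow> ip (e ! i) (e ! j) = (if i = j then 1 else 0)"
proof -
  show e: "e \<in> ordered_bases S" using assms unfolding orthonormal_basis_def by blast
  show len: "length e = d" by (rule ordered_basis_facts(1)[OF e])
  show "e ! i \<in> S" if "i < d" for i using that by (rule ordered_basis_facts(5)[OF e])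
  show "ip (e ! i) (e ! j) = (if i = j then 1 else 0)" if "i < d" "j < d" for i j
    using assms that unfolding orthonormal_basis_def len by blast
qed

lemma orthonormal_expansion:
  assumes e: "orthonormal_basis V e" and x: "x \<in> S"
  shows "x = (\<Sum>i<d. ip x (e ! i) *\<^sub>R e ! i)"
proof -
  note e = orthonormal_basisD[OF e]
  obtain c where c: "x = (\<Sum>i<d. c i *\<^sub>R e ! i)" by (rule ordered_basis_expansion[OF e(1) x])
  have "ip x (e ! j) = c j" if "j < d" for j
  proof -
    have "ip x (e ! j) = (\<Sum>i<d. ip (c i *\<^sub>R e ! i) (e ! j))"
      unfolding c using e that by (intro ip_sum_left) (auto intro!: space_closed)
    also have "\<dots> = (\<Sum>i<d. if i = j then c j else 0)"
      using e that by (intro sum.cong refl) (auto simp: ip_scale_left)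
    also have "\<dots> = c j" using that by simp
    finally show ?thesis .
  qed
  then show ?thesis using c by simp
qed

lemma parseval:
  assumes e: "orthonormal_basis V e" and "x \<in> S" "y \<in> S"
  shows "ip x y = (\<Sum>i<d. ip x (e ! i) * ip y (e ! i))"
proof -
  have "ip x y = ip (\<Sum>i<d. ip x (e ! i) *\<^sub>R e ! i) y"
    using orthonormal_expansion[OF e \<open>x \<in> S\<close>] by simp
  also have "\<dots> = (\<Sum>i<d. ip (ip x (e ! i) *\<^sub>R e ! i) y)"
    using orthonormal_basisD[OF e] assms by (intro ip_sum_left) (auto intro!: space_closed)
  also have "\<dots> = (\<Sum>i<d. ip x (e ! i) * ip y (e ! i))"
    using orthonormal_basisD[OF e] assms by (intro sum.cong refl) (auto simp: ip_scale_left ip_commute)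
  finally show ?thesis .
qed

abbreviation fl where "fl \<equiv> flat V"

lemma flat_apply: "x \<in> S \<Longrightarrow> fl v x = ip v x" by (simp add: flat_def)

lemma flat_dual: "v \<in> S \<Longrightarrow> fl v \<in> dual_space S"
  unfolding flat_def dual_space_def by (auto simp: ip_add_right ip_scale_right space_closed)

lemma flat_linear:
  "x \<in> S \<Longrightarrow> y \<in> S \<Longrightarrow> fl (a *\<^sub>R x + b *\<^sub>R y) = a *\<^sub>R fl x + b *\<^sub>R fl y"
  unfolding flat_def scaleR_fun_def plus_fun_def
  by (auto simp: fun_eq_iff ip_add_left ip_scale_left space_closed)

lemma dual_sum:
  assumes \<phi>: "\<phi> \<in> dual_space S" and "finite J" "\<And>j. j \<in> J \<Longrightarrow> x j \<in> S"
  shows "\<phi> (\<Sum>j\<in>J. c j *\<^sub>R x j) = (\<Sum>j\<in>J. c j * \<phi> (x j))"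
  using assms(2,3)
proof (induction J rule: finite_induct)
  case empty
  have "\<phi> (0 *\<^sub>R 0) = 0 * \<phi> 0" using \<phi> space_closed(1) unfolding dual_space_def by blast
  then show ?case by simp
next
  case (insert j J)
  then have "(\<Sum>j\<in>J. c j *\<^sub>R x j) \<in> S" "c j *\<^sub>R x j \<in> S" "x j \<in> S" by (auto intro!: space_closed)
  then show ?case using \<phi> insert unfolding dual_space_def by auto
qed

lemma dual_expansion:
  assumes e: "orthonormal_basis V e" and \<phi>: "\<phi> \<in> dual_space S"
  shows "\<phi> = (\<lambda>x. \<Sum>i<d. \<phi> (e ! i) * fl (e ! i) x)"
proof
  fix x
  show "\<phi> x = (\<Sum>i<d. \<phi> (e ! i) * fl (e ! i) x)"
  proof (cases "x \<in> S")
    case True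
    then have "\<phi> x = \<phi> (\<Sum>i<d. ip x (e ! i) *\<^sub>R e ! i)"
      using orthonormal_expansion[OF e] by simp
    also have "\<dots> = (\<Sum>i<d. ip x (e ! i) * \<phi> (e ! i))"
      using orthonormal_basisD[OF e] by (intro dual_sum[OF \<phi>]) auto
    also have "\<dots> = (\<Sum>i<d. \<phi> (e ! i) * fl (e ! i) x)"
      using True orthonormal_basisD[OF e] by (intro sum.cong refl) (auto simp: flat_apply ip_commute)
    finally show ?thesis .
  next
    case False
    then show ?thesis using \<phi> unfolding dual_space_def flat_def by auto
  qed
qed

lemma riesz:
  assumes \<phi>: "\<phi> \<in> dual_space S"
  obtains v where "v \<in> S" "\<phi> = fl v"
proof -
  let ?e = "some_orthonormal_basis V"
  note e = some_orthonormal_basis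
  let ?v = "\<Sum>i<d. \<phi> (?e ! i) *\<^sub>R ?e ! i"
  have v: "?v \<in> S" using orthonormal_basisD[OF e] by (auto intro!: space_closed)
  moreover have "\<phi> = fl ?v"
  proof
    fix x
    show "\<phi> x = fl ?v x"
    proof (cases "x \<in> S")
      case True
      then have "fl ?v x = (\<Sum>i<d. ip (\<phi> (?e ! i) *\<^sub>R ?e ! i) x)"
        using orthonormal_basisD[OF e] by (simp add: flat_apply) (intro ip_sum_left, auto intro!: space_closed)
      also have "\<dots> = (\<Sum>i<d. \<phi> (?e ! i) * fl (?e ! i) x)"
        using True orthonormal_basisD[OF e] by (intro sum.cong refl) (auto simp: flat_apply ip_scale_left)
      finally show ?thesis using fun_cong[OF dual_expansion[OF e \<phi>], of x] by simp
    next
      case False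
      then show ?thesis using \<phi> unfolding dual_space_def flat_def by auto
    qed
  qed
  ultimately show ?thesis by (rule that)
qed

text \<open>A multivector is determined by its values on the increasing lists of a dual basis: lists of basis
  covectors are permutations of increasing ones, and in a general list the entries are expanded along
  the basis one after the other.  All uniqueness statements about Hodge duals rest on this.\<close>

lemma ext_power_eqI:
  assumes e: "orthonormal_basis V e" and \<omega>: "\<omega> \<in> ext_power k S" and \<eta>: "\<eta> \<in> ext_power k S"
    and eq: "\<And>I. I \<subseteq> {..<d} \<Longrightarrow> card I = k \<Longrightarrow>
      \<omega> (map (\<lambda>i. fl (e ! i)) (sorted_list_of_set I)) = \<eta> (map (\<lambda>i. fl (e ! i)) (sorted_list_of_set I))"
  shows "\<omega> = \<eta>"
proof -
  let ?\<theta> = "\<lambda>i. fl (e ! i)"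
  have \<theta>: "?\<theta> i \<in> dual_space S" if "i < d" for i using orthonormal_basisD[OF e] that by (intro flat_dual)
  have basis: "\<omega> (map ?\<theta> js) = \<eta> (map ?\<theta> js)" if js: "length js = k" "set js \<subseteq> {..<d}" for js
  proof (cases "distinct js")
    case False
    then have "\<not> distinct (map ?\<theta> js)" by (simp add: distinct_map)
    then show ?thesis using ext_power_repeated[OF \<omega>, of "map ?\<theta> js"] ext_power_repeated[OF \<eta>, of "map ?\<theta> js"] by simp
  next
    case True
    let ?s = "sorted_list_of_set (set js)"
    have len: "length ?s = k" using True js distinct_card by auto
    have "mset js = mset ?s" using True by (metis mset_set_set sorted_list_of_set.set_sorted_key_list_of_set
          finite_set set_eq_iff_mset_eq_distinct sorted_list_of_set.distinct_sorted_key_list_of_set)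
    then obtain p where p: "p permutes {..<length ?s}" "permute_list p ?s = js"
      by (rule mset_eq_permutation)
    have map: "map ?\<theta> js = permute_list p (map ?\<theta> ?s)" using p permute_list_map by metis
    have "\<omega> (map ?\<theta> ?s) = \<eta> (map ?\<theta> ?s)" using js True distinct_card by (intro eq) auto
    moreover have "set (map ?\<theta> ?s) \<subseteq> dual_space S" using js \<theta> by auto
    ultimately show ?thesis
      unfolding map using ext_power_permute[OF \<omega>, of p "map ?\<theta> ?s"] ext_power_permute[OF \<eta>, of p "map ?\<theta> ?s"] p len
      by simp
  qed
  have partial: "\<omega> \<phi>s = \<eta> \<phi>s"
    if "length \<phi>s = k" "set \<phi>s \<subseteq> dual_space S" "m \<le> k" "\<And>i. m \<le> i \<Longrightarrow> i < k \<Longrightarrow> \<phi>s ! i \<in> ?\<theta> ` {..<d}"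
    for m \<phi>s
    using that
  proof (induction m arbitrary: \<phi>s)
    case 0
    then have "set \<phi>s \<subseteq> ?\<theta> ` {..<d}" by (auto simp: set_conv_nth)
    then have "\<phi>s \<in> lists (?\<theta> ` {..<d})" by auto
    then have "\<phi>s \<in> map ?\<theta> ` lists {..<d}" unfolding lists_image .
    then obtain js where "\<phi>s = map ?\<theta> js" "set js \<subseteq> {..<d}" by auto
    then show ?case using basis 0 by auto
  next
    case (Suc m)
    let ?\<phi> = "\<phi>s ! m"
    have m: "m < k" using Suc.prems by simp
    have \<phi>: "?\<phi> \<in> dual_space S" using Suc.prems nth_mem[of m \<phi>s] m by auto
    have expand: "\<phi>s = \<phi>s[m := (\<lambda>x. \<Sum>i<d. ?\<phi> (e ! i) * ?\<theta> i x)]"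
      using dual_expansion[OF e \<phi>] by simp
    have IH: "\<omega> (\<phi>s[m := ?\<theta> i]) = \<eta> (\<phi>s[m := ?\<theta> i])" if "i < d" for i
    proof (rule Suc.IH)
      show "\<phi>s[m := ?\<theta> i] ! j \<in> ?\<theta> ` {..<d}" if "m \<le> j" "j < k" for j
        using Suc.prems that \<open>i < d\<close> by (cases "j = m") auto
      show "set (\<phi>s[m := ?\<theta> i]) \<subseteq> dual_space S"
        using Suc.prems \<theta>[OF that] by (intro set_update_subsetI) auto
    qed (use Suc.prems in auto)
    have "\<omega> \<phi>s = (\<Sum>i<d. ?\<phi> (e ! i) * \<omega> (\<phi>s[m := ?\<theta> i]))"
      using Suc.prems \<theta> m by (subst expand, intro ext_power_sum[OF \<omega>]) auto
    moreover have "\<eta> \<phi>s = (\<Sum>i<d. ?\<phi> (e ! i) * \<eta> (\<phi>s[m := ?\<theta> i]))"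
      using Suc.prems \<theta> m by (subst expand, intro ext_power_sum[OF \<eta>]) auto
    ultimately show ?case using IH by simp
  qed
  show ?thesis
  proof
    fix \<phi>s
    show "\<omega> \<phi>s = \<eta> \<phi>s"
    proof (cases "length \<phi>s = k \<and> set \<phi>s \<subseteq> dual_space S")
      case True
      then show ?thesis by (intro partial[of \<phi>s k]) auto
    next
      case False
      then show ?thesis using ext_power_outside[OF \<omega> False] ext_power_outside[OF \<eta> False] by simp
    qed
  qed
qed

end

section \<open>Orientation and the volume multivector\<close>

lemma wedge_vectors_eq_fdet:
  assumes "length vs = k" "length \<phi>s = k" "set \<phi>s \<subseteq> dual_space V"
  shows "wedge_vectors V vs \<phi>s = fdet k (\<lambda>i j. (\<phi>s ! i) (vs ! j))"
  using assms unfolding wedge_vectors_def fdet_permutations by simp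

lemma wedge_vectors_ext_power:
  assumes "length vs = k"
  shows "wedge_vectors V vs \<in> ext_power k V"
  unfolding ext_power_def mem_Collect_eq
proof (intro conjI allI impI)
  fix \<phi>s assume "\<not> (length \<phi>s = k \<and> set \<phi>s \<subseteq> dual_space V)"
  then show "wedge_vectors V vs \<phi>s = 0" using assms unfolding wedge_vectors_def by auto
next
  fix \<phi>s :: "('a \<Rightarrow> real) list" and i \<phi> \<psi> and a b :: real
  assume \<phi>s: "length \<phi>s = k" "set \<phi>s \<subseteq> dual_space V" "i < k" and \<phi>: "\<phi> \<in> dual_space V" "\<psi> \<in> dual_space V"
  have row: "wedge_vectors V vs (\<phi>s[i := \<zeta>]) = fdet k ((\<lambda>i j. (\<phi>s ! i) (vs ! j))(i := \<lambda>j. \<zeta> (vs ! j)))"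
    if "\<zeta> \<in> dual_space V" for \<zeta>
  proof -
    have "set (\<phi>s[i := \<zeta>]) \<subseteq> dual_space V" using that \<phi>s by (intro set_update_subsetI)
    then have "wedge_vectors V vs (\<phi>s[i := \<zeta>]) = fdet k (\<lambda>i' j. (\<phi>s[i := \<zeta>] ! i') (vs ! j))"
      using assms \<phi>s by (intro wedge_vectors_eq_fdet) auto
    also have "\<dots> = fdet k ((\<lambda>i j. (\<phi>s ! i) (vs ! j))(i := \<lambda>j. \<zeta> (vs ! j)))"
      using \<phi>s by (intro fdet_cong) (auto simp: nth_list_update)
    finally show ?thesis .
  qed
  show "wedge_vectors V vs (\<phi>s[i := a *\<^sub>R \<phi> + b *\<^sub>R \<psi>]) =
      a * wedge_vectors V vs (\<phi>s[i := \<phi>]) + b * wedge_vectors V vs (\<phi>s[i := \<psi>])"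
    unfolding row[OF dual_space_combination[OF \<phi>]] row[OF \<phi>(1)] row[OF \<phi>(2)]
    using fdet_row_linear[OF \<phi>s(3)] by (simp add: scaleR_fun_def plus_fun_def)
next
  fix \<phi>s :: "('a \<Rightarrow> real) list"
  assume "\<not> distinct \<phi>s"
  then obtain i j where ij: "i < length \<phi>s" "j < length \<phi>s" "i \<noteq> j" "\<phi>s ! i = \<phi>s ! j"
    by (auto simp: distinct_conv_nth)
  show "wedge_vectors V vs \<phi>s = 0"
  proof (cases "length \<phi>s = k \<and> set \<phi>s \<subseteq> dual_space V")
    case True
    then show ?thesis using wedge_vectors_eq_fdet[OF assms] fdet_identical_rows[of i k j] ij by auto
  next
    case False
    then show ?thesis using assms unfolding wedge_vectors_def by auto
  qed
qed

lemma vector_embed_apply: "\<phi> \<in> dual_space V \<Longrightarrow> vector_embed V v [\<phi>] = \<phi> v"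
proof -
  assume "\<phi> \<in> dual_space V"
  then have "vector_embed V v [\<phi>] = fdet 1 (\<lambda>i j. ([\<phi>] ! i) ([v] ! j))"
    by (intro wedge_vectors_eq_fdet) auto
  also have "\<dots> = fdet 1 ((\<lambda>i j. if i = j then 1 else 0)(0 := \<lambda>j. \<phi> v))"
    by (intro fdet_cong) auto
  also have "\<dots> = \<phi> v" by (rule fdet_identity_replace_row) simp
  finally show ?thesis .
qed

lemma ext_power_0: "\<omega> \<in> ext_power 0 V \<Longrightarrow> \<omega> = scalar_embed (\<omega> [])"
  using ext_power_outside[of \<omega> 0 V] by (auto simp: scalar_embed_def fun_eq_iff)

lemma scalar_embed_ext_power: "scalar_embed r \<in> ext_power 0 V"
  unfolding ext_power_def scalar_embed_def by auto

lemma scaleR_ext_power: "\<omega> \<in> ext_power k V \<Longrightarrow> c *\<^sub>R \<omega> \<in> ext_power k V"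
  unfolding ext_power_def scaleR_fun_def by (auto simp: algebra_simps)

definition others :: "nat \<Rightarrow> nat \<Rightarrow> nat list"
  where "others d j = sorted_list_of_set ({..<d} - {j})"

text \<open>The sign \<open>(-1)\<^sup>j\<close>, as the sign of the permutation that moves \<open>j\<close> to the front.\<close>

definition others_sign :: "nat \<Rightarrow> nat \<Rightarrow> real"
  where "others_sign d j =
    of_int (sign (SOME \<sigma>. \<sigma> permutes {..<d} \<and> permute_list \<sigma> [0..<d] = j # others d j))"

lemma others_facts: "set (others d j) = {..<d} - {j}" "distinct (others d j)"
  "j < d \<Longrightarrow> length (others d j) = d - 1"
  unfolding others_def by auto

lemma others_sign_square: "others_sign d j * others_sign d j = 1"
  unfolding others_sign_def by (simp add: sign_def)

text \<open>Moving the first entry into the gap at position \<open>j\<close> costs the same sign for every form on every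
  space, so that these signs cancel when a form on the domain of a map meets one on its target.\<close>

lemma ext_power_others:
  assumes j: "j < d" and \<omega>: "\<omega> \<in> ext_power d V" and "\<zeta> \<in> dual_space V" "\<And>i. i < d \<Longrightarrow> \<psi> i \<in> dual_space V"
  shows "\<omega> (\<zeta> # map \<psi> (others d j)) = others_sign d j * \<omega> ((map \<psi> [0..<d])[j := \<zeta>])"
proof -
  have "mset (j # others d j) = mset [0..<d]"
    by (rule set_eq_iff_mset_eq_distinct[THEN iffD1]) (use j in \<open>auto simp: others_facts\<close>)
  then obtain \<tau> where "\<tau> permutes {..<length [0..<d]} \<and> permute_list \<tau> [0..<d] = j # others d j"
    by (metis mset_eq_permutation)
  then have "\<exists>\<sigma>. \<sigma> permutes {..<d} \<and> permute_list \<sigma> [0..<d] = j # others d j" by auto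
  then obtain \<sigma> where \<sigma>: "\<sigma> permutes {..<d}" "permute_list \<sigma> [0..<d] = j # others d j"
    and s: "others_sign d j = of_int (sign \<sigma>)"
    unfolding others_sign_def by (metis (mono_tags, lifting) someI_ex)
  let ?\<phi> = "\<psi>(j := \<zeta>)"
  have "permute_list \<sigma> (map ?\<phi> [0..<d]) = map ?\<phi> (permute_list \<sigma> [0..<d])"
    using \<sigma>(1) by (intro permute_list_map) simp
  also have "\<dots> = \<zeta> # map \<psi> (others d j)" unfolding \<sigma>(2) by (auto simp: others_facts)
  finally have list: "\<zeta> # map \<psi> (others d j) = permute_list \<sigma> (map ?\<phi> [0..<d])" ..
  have upd: "map ?\<phi> [0..<d] = (map \<psi> [0..<d])[j := \<zeta>]"
    using j by (intro nth_equalityI) (auto simp: nth_list_update)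
  have "\<omega> (permute_list \<sigma> (map ?\<phi> [0..<d])) = of_int (sign \<sigma>) * \<omega> (map ?\<phi> [0..<d])"
    using assms by (intro ext_power_permute[OF \<omega> \<sigma>(1)]) auto
  then show ?thesis unfolding list s upd .
qed

context oriented_ips
begin

lemma wedge_vectors_change_basis:
  assumes "length vs = d" "length ws = d" "\<And>i. i < d \<Longrightarrow> vs ! i \<in> S"
    and ws: "\<And>j. j < d \<Longrightarrow> ws ! j = (\<Sum>k<d. m k j *\<^sub>R vs ! k)"
  shows "wedge_vectors S ws = fdet d m *\<^sub>R wedge_vectors S vs"
proof
  fix \<phi>s
  show "wedge_vectors S ws \<phi>s = (fdet d m *\<^sub>R wedge_vectors S vs) \<phi>s"
  proof (cases "length \<phi>s = d \<and> set \<phi>s \<subseteq> dual_space S")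
    case True
    then have dual: "\<phi>s ! i \<in> dual_space S" if "i < d" for i using that nth_mem[of i \<phi>s] by auto
    have "(\<phi>s ! i) (ws ! j) = (\<Sum>k<d. (\<phi>s ! i) (vs ! k) * m k j)" if "i < d" "j < d" for i j
      using that assms dual_sum[OF dual, of i "{..<d}" "\<lambda>k. vs ! k" "\<lambda>k. m k j"]
      by (simp add: mult.commute)
    then have "fdet d (\<lambda>i j. (\<phi>s ! i) (ws ! j)) = fdet d (\<lambda>i j. \<Sum>k<d. (\<phi>s ! i) (vs ! k) * m k j)"
      by (intro fdet_cong)
    then show ?thesis
      using True assms(1,2) by (simp add: wedge_vectors_eq_fdet fdet_mult scaleR_fun_def)
  next
    case False
    then show ?thesis using assms(1,2) by (auto simp: wedge_vectors_def scaleR_fun_def)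
  qed
qed

text \<open>By Parseval the matrix of inner products is a product of the two matrices of coordinates.\<close>

lemma gram_change_basis:
  assumes e: "orthonormal_basis V e" and "\<And>j. j < d \<Longrightarrow> x j \<in> S" "\<And>j. j < d \<Longrightarrow> y j \<in> S"
  shows "fdet d (\<lambda>i j. ip (x i) (y j)) = fdet d (\<lambda>i j. ip (x j) (e ! i)) * fdet d (\<lambda>i j. ip (y j) (e ! i))"
proof -
  have "fdet d (\<lambda>i j. ip (x i) (y j)) = fdet d (\<lambda>i j. \<Sum>k<d. ip (x i) (e ! k) * ip (y j) (e ! k))"
    using parseval[OF e] assms by (intro fdet_cong) auto
  also have "\<dots> = fdet d (\<lambda>i j. ip (x i) (e ! j)) * fdet d (\<lambda>i j. ip (y j) (e ! i))"
    by (rule fdet_mult)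
  finally show ?thesis by (simp only: fdet_transpose[of d "\<lambda>i j. ip (x j) (e ! i)"])
qed

lemma wedge_vectors_orthonormal_expansion:
  assumes e: "orthonormal_basis V e" and b: "length b = d" "\<And>j. j < d \<Longrightarrow> b ! j \<in> S"
  shows "wedge_vectors S b = fdet d (\<lambda>i j. ip (b ! j) (e ! i)) *\<^sub>R wedge_vectors S e"
  using orthonormal_expansion[OF e b(2)] orthonormal_basisD[OF e] b
  by (intro wedge_vectors_change_basis) auto

lemma orthonormal_gram:
  assumes e: "orthonormal_basis V e" and a: "orthonormal_basis V a"
  shows "fdet d (\<lambda>i j. ip (a ! j) (e ! i)) * fdet d (\<lambda>i j. ip (a ! j) (e ! i)) = 1"
proof -
  have "fdet d (\<lambda>i j. ip (a ! i) (a ! j)) = fdet d (\<lambda>i j. if i = j then 1 else 0)"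
    using orthonormal_basisD[OF a] by (intro fdet_cong) auto
  then show ?thesis
    using gram_change_basis[OF e, of "\<lambda>i. a ! i" "\<lambda>i. a ! i"] orthonormal_basisD(3)[OF a] fdet_identity
    by simp
qed

lemma positive_basis_iff:
  assumes "b \<in> ips_positive V" "b' \<in> ordered_bases S"
  shows "b' \<in> ips_positive V \<longleftrightarrow> (\<exists>c>0. wedge_vectors S b' = c *\<^sub>R wedge_vectors S b)"
  using orientation assms unfolding is_orientation_def by blast

lemma positive_basis_ordered: "b \<in> ips_positive V \<Longrightarrow> b \<in> ordered_bases S"
  using orientation unfolding is_orientation_def by blast

text \<open>The wedge of any ordered orthonormal basis is a nonzero multiple of the wedge of a positive basis.
  If the factor is negative, reversing the first vector corrects it.\<close>

lemma ex_positive_orthonormal_basis: "\<exists>e. e \<in> ips_positive V \<and> orthonormal_basis V e"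
proof -
  obtain b where b: "b \<in> ips_positive V" using orientation unfolding is_orientation_def by blast
  note b' = ordered_basis_facts[OF positive_basis_ordered[OF b]]
  obtain e where e: "orthonormal_basis V e" using ex_orthonormal_basis by blast
  note e' = orthonormal_basisD[OF e]
  define c where "c = fdet d (\<lambda>i j. ip (b ! j) (e ! i))"
  have bc: "wedge_vectors S b = c *\<^sub>R wedge_vectors S e"
    unfolding c_def using b' by (intro wedge_vectors_orthonormal_expansion[OF e])
  have "c \<noteq> 0"
  proof
    assume "c = 0"
    \<comment> \<open>Expanded along \<open>b\<close>, the wedge of \<open>e\<close> is a multiple of that of \<open>b\<close> and would vanish, but its
      value on the dual basis is \<open>1\<close>.\<close>
    have "\<exists>c. j < d \<longrightarrow> e ! j = (\<Sum>k<d. c k *\<^sub>R b ! k)" for j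
    proof (cases "j < d")
      case True
      from ordered_basis_expansion[OF positive_basis_ordered[OF b] e'(3)[OF True]] show ?thesis by blast
    qed simp
    then have "\<exists>m. \<forall>j. j < d \<longrightarrow> e ! j = (\<Sum>k<d. m j k *\<^sub>R b ! k)" by (intro choice allI)
    then obtain m where "\<And>j. j < d \<Longrightarrow> e ! j = (\<Sum>k<d. m j k *\<^sub>R b ! k)" by blast
    then have "wedge_vectors S e = fdet d (\<lambda>k j. m j k) *\<^sub>R wedge_vectors S b"
      using b' e' by (intro wedge_vectors_change_basis) auto
    then have "wedge_vectors S e = 0" unfolding bc \<open>c = 0\<close> by simp
    moreover have "wedge_vectors S e (map fl e) = 1"
    proof -
      have "wedge_vectors S e (map fl e) = fdet d (\<lambda>i j. (map fl e ! i) (e ! j))"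
        using e' by (intro wedge_vectors_eq_fdet) (auto simp: set_conv_nth intro!: flat_dual)
      also have "\<dots> = fdet d (\<lambda>i j. if i = j then 1 else 0)"
        using e' by (intro fdet_cong) (auto simp: flat_apply)
      finally show ?thesis by (simp add: fdet_identity)
    qed
    ultimately show False by (simp add: zero_fun_def)
  qed
  show ?thesis
  proof (cases "c > 0")
    case True
    then have "wedge_vectors S e = (1 / c) *\<^sub>R wedge_vectors S b" unfolding bc by simp
    moreover have "1 / c > 0" using True by simp
    ultimately have "e \<in> ips_positive V" using positive_basis_iff[OF b e'(1)] by blast
    then show ?thesis using e by blast
  next
    case False
    \<comment> \<open>Reversing the first vector reverses the orientation.\<close>
    define e1 where "e1 = e[0 := - e ! 0]"
    have e1: "length e1 = d" "\<And>i. i < d \<Longrightarrow> e1 ! i \<in> S" "\<And>i. i < d \<Longrightarrow> e1 ! i = (if i = 0 then - e ! 0 else e ! i)"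
      unfolding e1_def using e' dim_positive by (auto simp: nth_list_update intro: space_closed)
    have on: "ip (e1 ! i) (e1 ! j) = (if i = j then 1 else 0)" if "i < d" "j < d" for i j
      using that e' e1(3) dim_positive
      by (auto simp: ip_minus_left ip_minus_right space_closed)
    have dist: "distinct e1"
      unfolding distinct_conv_nth using on e1(1) by (metis zero_neq_one)
    have S1: "set e1 \<subseteq> S" using e1 by (auto simp: set_conv_nth)
    have ind: "independent (set e1)"
    proof (rule orthonormal_independent[OF finite_set S1])
      fix x y assume "x \<in> set e1" "y \<in> set e1"
      then obtain i j where "i < d" "j < d" "x = e1 ! i" "y = e1 ! j" using e1(1) by (metis in_set_conv_nth)
      then show "ip x y = (if x = y then 1 else 0)" using on dist e1(1) nth_eq_iff_index_eq by metis
    qed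
    have "e ! i \<in> span (set e1)" if "i < d" for i
    proof -
      have "e1 ! i \<in> span (set e1)" using that e1(1) by (intro span_base) auto
      then show ?thesis using e1(3)[OF that] span_neg by (cases "i = 0") fastforce+
    qed
    then have "set e \<subseteq> span (set e1)" using e'(2) by (auto simp: set_conv_nth)
    then have "S \<subseteq> span (set e1)" using e'(1) span_minimal[OF _ subspace_span] ordered_basis_facts(4) by metis
    moreover have "span (set e1) \<subseteq> S" using S1 subspace by (rule span_minimal)
    ultimately have bas: "e1 \<in> ordered_bases S" using dist ind unfolding ordered_bases_def by auto
    have "wedge_vectors S e1 = fdet d (\<lambda>i j. ip (e1 ! j) (e ! i)) *\<^sub>R wedge_vectors S e"
      by (rule wedge_vectors_orthonormal_expansion[OF e e1(1,2)])
    also have "fdet d (\<lambda>i j. ip (e1 ! j) (e ! i)) = fdet d ((\<lambda>i j. if i = j then 1 else 0)(0 := \<lambda>j. - (if j = 0 then 1 else 0)))"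
      using e' e1(3) dim_positive by (intro fdet_cong) (auto simp: ip_minus_left)
    also have "\<dots> = -1" using fdet_identity_replace_row[OF dim_positive] by simp
    also have "(-1) *\<^sub>R wedge_vectors S e = (- 1 / c) *\<^sub>R wedge_vectors S b"
      unfolding bc scaleR_scaleR using \<open>c \<noteq> 0\<close> by (intro arg_cong2[where f = scaleR]) auto
    finally have "wedge_vectors S e1 = (- 1 / c) *\<^sub>R wedge_vectors S b" .
    moreover have "- 1 / c > 0" using False \<open>c \<noteq> 0\<close> by simp
    ultimately have "e1 \<in> ips_positive V" using positive_basis_iff[OF b bas] by blast
    moreover have "orthonormal_basis V e1" unfolding orthonormal_basis_def using bas on e1(1) by simp
    ultimately show ?thesis by blast
  qed
qed

definition pos_onb where "pos_onb = (SOME e. e \<in> ips_positive V \<and> orthonormal_basis V e)"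

lemma pos_onb_positive: "pos_onb \<in> ips_positive V" and pos_onb: "orthonormal_basis V pos_onb"
  using someI_ex[OF ex_positive_orthonormal_basis] unfolding pos_onb_def by auto

lemmas pos_onbD = orthonormal_basisD[OF pos_onb]

text \<open>The positive unit multivector of top degree; by \<open>vol_unique\<close> it is independent of the basis.\<close>

definition vol where "vol = wedge_vectors S pos_onb"

lemma vol_ext_power: "vol \<in> ext_power d S"
  unfolding vol_def using pos_onbD by (intro wedge_vectors_ext_power)

lemma vol_apply:
  "length \<phi>s = d \<Longrightarrow> set \<phi>s \<subseteq> dual_space S \<Longrightarrow> vol \<phi>s = fdet d (\<lambda>i j. (\<phi>s ! i) (pos_onb ! j))"
  unfolding vol_def using pos_onbD by (intro wedge_vectors_eq_fdet)

lemma positive_gram: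
  assumes "b \<in> ips_positive V"
  shows "fdet d (\<lambda>i j. ip (b ! j) (pos_onb ! i)) > 0"
proof -
  note b = ordered_basis_facts[OF positive_basis_ordered[OF assms]]
  obtain c where c: "c > 0" "wedge_vectors S b = c *\<^sub>R vol"
    using positive_basis_iff[OF pos_onb_positive positive_basis_ordered[OF assms]] assms unfolding vol_def by blast
  have "vol (map fl pos_onb) = fdet d (\<lambda>i j. if i = j then 1 else 0)"
    using pos_onbD by (subst vol_apply) (auto simp: set_conv_nth flat_apply intro!: flat_dual fdet_cong)
  then have one: "vol (map fl pos_onb) = 1" by (simp add: fdet_identity)
  have "wedge_vectors S b = fdet d (\<lambda>i j. ip (b ! j) (pos_onb ! i)) *\<^sub>R vol"
    unfolding vol_def using b by (intro wedge_vectors_orthonormal_expansion[OF pos_onb])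
  then have "c *\<^sub>R vol = fdet d (\<lambda>i j. ip (b ! j) (pos_onb ! i)) *\<^sub>R vol" using c by simp
  from fun_cong[OF this, of "map fl pos_onb"] show ?thesis using c one by (simp add: scaleR_fun_def)
qed

text \<open>The change of basis is orthogonal, so its determinant is \<open>\<plusminus>1\<close>, and it is positive.\<close>

lemma vol_unique:
  assumes "e \<in> ips_positive V" "orthonormal_basis V e"
  shows "wedge_vectors S e = vol"
proof -
  let ?c = "fdet d (\<lambda>i j. ip (e ! j) (pos_onb ! i))"
  have "?c > 0" "?c * ?c = 1" using positive_gram[OF assms(1)] orthonormal_gram[OF pos_onb assms(2)] by auto
  then have "?c = 1" using square_eq_1_iff[of ?c] by linarith
  then show ?thesis
    using wedge_vectors_orthonormal_expansion[OF pos_onb, of e] orthonormal_basisD[OF assms(2)] unfolding vol_def by simp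
qed

end

section \<open>Multivectors of degree one, codimension one and top degree\<close>

context oriented_ips
begin

lemma vol_basis: "vol (map fl pos_onb) = 1"
proof -
  have "vol (map fl pos_onb) = fdet d (\<lambda>i j. if i = j then 1 else 0)"
    using pos_onbD by (subst vol_apply) (auto simp: set_conv_nth flat_apply intro!: flat_dual fdet_cong)
  then show ?thesis by (simp add: fdet_identity)
qed

lemma vol_scale_inject: "a *\<^sub>R vol = b *\<^sub>R vol \<longleftrightarrow> a = b"
proof
  assume "a *\<^sub>R vol = b *\<^sub>R vol"
  from fun_cong[OF this, of "map fl pos_onb"] show "a = b" by (simp add: scaleR_fun_def vol_basis)
qed simp

lemma map_pos_onb: "map fl pos_onb = map (\<lambda>i. fl (pos_onb ! i)) [0..<d]"
  using pos_onbD(2) by (intro nth_equalityI) auto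

lemma map_basis_facts:
  assumes "orthonormal_basis V e"
  shows "length (map (\<lambda>i. fl (e ! i)) [0..<d]) = d" "set (map (\<lambda>i. fl (e ! i)) [0..<d]) \<subseteq> dual_space S"
  using orthonormal_basisD[OF assms] by (auto intro: flat_dual)

text \<open>There is only one increasing list of full length.\<close>

lemma top_form:
  assumes "\<omega> \<in> ext_power d S"
  shows "\<omega> = \<omega> (map fl pos_onb) *\<^sub>R vol"
proof (rule ext_power_eqI[OF pos_onb assms scaleR_ext_power[OF vol_ext_power]])
  fix I assume "I \<subseteq> {..<d}" "card I = d"
  then have "I = {..<d}" by (intro card_subset_eq) auto
  then have "sorted_list_of_set I = [0..<d]" using sorted_list_of_set_range[of 0 d] by (simp add: lessThan_atLeast0)
  then show "\<omega> (map (\<lambda>i. fl (pos_onb ! i)) (sorted_list_of_set I)) =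
      (\<omega> (map fl pos_onb) *\<^sub>R vol) (map (\<lambda>i. fl (pos_onb ! i)) (sorted_list_of_set I))"
    using vol_basis unfolding map_pos_onb by (simp add: scaleR_fun_def)
qed

text \<open>The contraction of the volume multivector with a vector.  Every multivector of codimension one has
  this form (\<open>codim_one_form\<close>), and \<open>contract_vol u\<close> is the Hodge dual of \<open>u\<close> (\<open>hodge_1\<close>).\<close>

definition contract_vol where "contract_vol u = (\<lambda>\<phi>s. vol (fl u # \<phi>s))"

lemma contract_vol_ext_power:
  assumes u: "u \<in> S"
  shows "contract_vol u \<in> ext_power (d - 1) S"
  unfolding ext_power_def mem_Collect_eq contract_vol_def
proof (intro conjI allI impI)
  fix \<phi>s assume "\<not> (length \<phi>s = d - 1 \<and> set \<phi>s \<subseteq> dual_space S)"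
  then show "vol (fl u # \<phi>s) = 0"
    using dim_positive by (intro ext_power_outside[OF vol_ext_power]) auto
next
  fix \<phi>s i \<phi> \<psi> and a b :: real
  assume "length \<phi>s = d - 1" "set \<phi>s \<subseteq> dual_space S" "i < d - 1" "\<phi> \<in> dual_space S" "\<psi> \<in> dual_space S"
  then show "vol (fl u # \<phi>s[i := a *\<^sub>R \<phi> + b *\<^sub>R \<psi>]) = a * vol (fl u # \<phi>s[i := \<phi>]) + b * vol (fl u # \<phi>s[i := \<psi>])"
    using ext_power_linear[OF vol_ext_power, of "fl u # \<phi>s" "Suc i" \<phi> \<psi> a b] flat_dual[OF u] by simp
next
  fix \<phi>s :: "('v \<Rightarrow> real) list"
  assume "\<not> distinct \<phi>s"
  then show "vol (fl u # \<phi>s) = 0" by (intro ext_power_repeated[OF vol_ext_power]) simp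
qed

lemma vol_replace:
  assumes e: "orthonormal_basis V e" and j: "j < d" and u: "u \<in> S"
  shows "vol ((map (\<lambda>i. fl (e ! i)) [0..<d])[j := fl u]) = ip u (e ! j) * vol (map (\<lambda>i. fl (e ! i)) [0..<d])"
proof -
  let ?\<theta>s = "map (\<lambda>i. fl (e ! i)) [0..<d]"
  note f = map_basis_facts[OF e] and e' = orthonormal_basisD[OF e]
  have "vol (?\<theta>s[j := fl u]) = vol (?\<theta>s[j := (\<lambda>x. \<Sum>i<d. fl u (e ! i) * fl (e ! i) x)])"
    using dual_expansion[OF e flat_dual[OF u]] by simp
  also have "\<dots> = (\<Sum>i<d. fl u (e ! i) * vol (?\<theta>s[j := fl (e ! i)]))"
    using e' j by (intro ext_power_sum[OF vol_ext_power f j]) (auto intro: flat_dual)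
  also have "\<dots> = (\<Sum>i<d. if i = j then ip u (e ! j) * vol ?\<theta>s else 0)"
  proof (intro sum.cong refl)
    fix i assume i: "i \<in> {..<d}"
    show "fl u (e ! i) * vol (?\<theta>s[j := fl (e ! i)]) = (if i = j then ip u (e ! j) * vol ?\<theta>s else 0)"
    proof (cases "i = j")
      case True
      then have "?\<theta>s[j := fl (e ! i)] = ?\<theta>s" using list_update_id[of ?\<theta>s j] j by simp
      then show ?thesis using True e' j by (simp add: flat_apply)
    next
      case False
      have "vol (?\<theta>s[j := fl (e ! i)]) = 0"
      proof (rule ext_power_repeated[OF vol_ext_power])
        have "?\<theta>s[j := fl (e ! i)] ! i = ?\<theta>s[j := fl (e ! i)] ! j" using False i j by simp
        then show "\<not> distinct (?\<theta>s[j := fl (e ! i)])"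
          using False i j nth_eq_iff_index_eq[of "?\<theta>s[j := fl (e ! i)]" i j] by auto
      qed
      then show ?thesis using False by simp
    qed
  qed
  also have "\<dots> = ip u (e ! j) * vol ?\<theta>s" using j by simp
  finally show ?thesis .
qed

lemma contract_vol_others:
  assumes e: "orthonormal_basis V e" and j: "j < d" and u: "u \<in> S"
  shows "contract_vol u (map (\<lambda>i. fl (e ! i)) (others d j)) =
    others_sign d j * (ip u (e ! j) * vol (map (\<lambda>i. fl (e ! i)) [0..<d]))"
  unfolding contract_vol_def using orthonormal_basisD[OF e] flat_dual[OF u]
  by (subst ext_power_others[OF j vol_ext_power]) (auto intro: flat_dual simp: vol_replace[OF e j u])

lemma subset_card_pred:
  assumes "I \<subseteq> {..<d}" "card I = d - 1"
  obtains j where "j < d" "I = {..<d} - {j}"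
proof -
  have "card ({..<d} - I) = 1" using assms dim_positive by (simp add: card_Diff_subset finite_subset)
  then obtain j where "{..<d} - I = {j}" by (rule card_1_singletonE)
  then show ?thesis using that[of j] assms by blast
qed

text \<open>The value of \<open>contract_vol u\<close> on the dual basis without its \<open>j\<close>-th member is, up to sign, the
  \<open>j\<close>-th coordinate of \<open>u\<close>; this dictates \<open>u\<close>.\<close>

lemma codim_one_form:
  assumes \<omega>: "\<omega> \<in> ext_power (d - 1) S"
  obtains u where "u \<in> S" "\<omega> = contract_vol u"
proof -
  let ?c = "\<lambda>j. others_sign d j * \<omega> (map (\<lambda>i. fl (pos_onb ! i)) (others d j))"
  define u where "u = (\<Sum>j<d. ?c j *\<^sub>R pos_onb ! j)"
  have u: "u \<in> S" unfolding u_def using pos_onbD by (intro space_closed(6) space_closed(4)) auto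
  have coord: "ip u (pos_onb ! j) = ?c j" if "j < d" for j
  proof -
    have "ip u (pos_onb ! j) = (\<Sum>i<d. ip (?c i *\<^sub>R pos_onb ! i) (pos_onb ! j))"
      unfolding u_def using that pos_onbD by (intro ip_sum_left space_closed(4)) auto
    also have "\<dots> = (\<Sum>i<d. if i = j then ?c j else 0)"
      using that pos_onbD by (intro sum.cong refl) (simp add: ip_scale_left)
    finally show ?thesis using that by simp
  qed
  have "\<omega> = contract_vol u"
  proof (rule ext_power_eqI[OF pos_onb \<omega> contract_vol_ext_power[OF u]])
    fix I assume "I \<subseteq> {..<d}" "card I = d - 1"
    then obtain j where j: "j < d" "I = {..<d} - {j}" by (rule subset_card_pred)
    have "contract_vol u (map (\<lambda>i. fl (pos_onb ! i)) (others d j)) = others_sign d j * ?c j"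
      using contract_vol_others[OF pos_onb j(1) u] coord[OF j(1)] vol_basis unfolding map_pos_onb by simp
    also have "\<dots> = \<omega> (map (\<lambda>i. fl (pos_onb ! i)) (others d j))"
      using others_sign_square[of d j] by (simp flip: mult.assoc)
    finally show "\<omega> (map (\<lambda>i. fl (pos_onb ! i)) (sorted_list_of_set I)) = contract_vol u (map (\<lambda>i. fl (pos_onb ! i)) (sorted_list_of_set I))"
      unfolding j(2) others_def by simp
  qed
  with u show ?thesis by (rule that)
qed

lemma degree_one_form:
  assumes \<omega>: "\<omega> \<in> ext_power 1 S"
  obtains w where "w \<in> S" "\<omega> = vector_embed S w"
proof -
  let ?c = "\<lambda>i. \<omega> [fl (pos_onb ! i)]"
  define w where "w = (\<Sum>j<d. ?c j *\<^sub>R pos_onb ! j)"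
  have w: "w \<in> S" unfolding w_def using pos_onbD by (intro space_closed(6) space_closed(4)) auto
  have "\<omega> = vector_embed S w"
  proof (rule ext_power_eqI[OF pos_onb \<omega> wedge_vectors_ext_power])
    fix I :: "nat set" assume "I \<subseteq> {..<d}" "card I = 1"
    then obtain i where "I = {i}" by (metis card_1_singletonE)
    with \<open>I \<subseteq> {..<d}\<close> have i: "I = {i}" "i < d" by auto
    have "vector_embed S w [fl (pos_onb ! i)] = fl (pos_onb ! i) w" using i pos_onbD by (intro vector_embed_apply flat_dual)
    also have "\<dots> = (\<Sum>j<d. ?c j * fl (pos_onb ! i) (pos_onb ! j))"
      unfolding w_def using i pos_onbD by (intro dual_sum flat_dual) auto
    also have "\<dots> = (\<Sum>j<d. if j = i then ?c i else 0)"
      using i pos_onbD by (intro sum.cong refl) (auto simp: flat_apply)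
    also have "\<dots> = ?c i" using i by simp
    finally show "\<omega> (map (\<lambda>i. fl (pos_onb ! i)) (sorted_list_of_set I)) =
        vector_embed S w (map (\<lambda>i. fl (pos_onb ! i)) (sorted_list_of_set I))"
      using i by simp
  qed simp
  with w show ?thesis by (rule that)
qed

lemma vector_embed_flat: "w \<in> S \<Longrightarrow> u \<in> S \<Longrightarrow> vector_embed S w [fl u] = ip u w"
  using vector_embed_apply[OF flat_dual] by (simp add: flat_apply)

lemma vector_embed_inject:
  assumes "v \<in> S" "w \<in> S" "vector_embed S v = vector_embed S w"
  shows "v = w"
proof (rule ip_eqI[OF assms(1,2)])
  fix z assume z: "z \<in> S"
  then show "ip v z = ip w z"
    using vector_embed_flat[OF assms(1) z] vector_embed_flat[OF assms(2) z] assms ip_commute by simp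
qed

text \<open>Cramer's rule.  Summing the determinants with one replaced row, weighted by the coordinates
  \<open>\<phi>\<^sub>i(a)\<close>, is a rank-one perturbation of the matrix of the \<open>\<phi>\<^sub>i\<close>, and since the weights are
  themselves in the range of that matrix the perturbation is multiplicative.\<close>

lemma vol_replace_sum:
  assumes \<phi>s: "length \<phi>s = d" "set \<phi>s \<subseteq> dual_space S" and a: "a \<in> S" and u: "u \<in> S"
  shows "(\<Sum>i<d. (\<phi>s ! i) a * vol (\<phi>s[i := fl u])) = ip a u * vol \<phi>s"
proof -
  let ?F = "\<lambda>i j. (\<phi>s ! i) (pos_onb ! j)" and ?v = "\<lambda>j. ip u (pos_onb ! j)" and ?a = "\<lambda>k. ip a (pos_onb ! k)"
  have dual: "\<phi>s ! i \<in> dual_space S" if "i < d" for i using \<phi>s that nth_mem[of i \<phi>s] by auto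
  have upd: "vol (\<phi>s[i := fl u]) = fdet d (?F(i := ?v))" if "i < d" for i
  proof -
    have "set (\<phi>s[i := fl u]) \<subseteq> dual_space S" using \<phi>s flat_dual[OF u] by (intro set_update_subsetI)
    then have "vol (\<phi>s[i := fl u]) = fdet d (\<lambda>k j. (\<phi>s[i := fl u] ! k) (pos_onb ! j))"
      using \<phi>s by (intro vol_apply) auto
    also have "\<dots> = fdet d (?F(i := ?v))"
      using \<phi>s pos_onbD by (intro fdet_cong) (auto simp: nth_list_update flat_apply)
    finally show ?thesis .
  qed
  have apply_a: "(\<phi>s ! i) a = (\<Sum>k<d. ?F i k * ?a k)" if "i < d" for i
  proof -
    have "(\<phi>s ! i) a = (\<phi>s ! i) (\<Sum>k<d. ?a k *\<^sub>R pos_onb ! k)" using orthonormal_expansion[OF pos_onb a] by simp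
    also have "\<dots> = (\<Sum>k<d. ?a k * ?F i k)" using pos_onbD by (intro dual_sum[OF dual[OF that]]) auto
    finally show ?thesis by (simp add: mult.commute)
  qed
  have "(\<Sum>i<d. (\<phi>s ! i) a * vol (\<phi>s[i := fl u])) = (\<Sum>i<d. (\<Sum>k<d. ?F i k * ?a k) * fdet d (?F(i := ?v)))"
    by (intro sum.cong refl) (simp add: upd apply_a)
  also have "\<dots> = fdet d (\<lambda>i j. ?F i j + (\<Sum>k<d. ?F i k * ?a k) * ?v j) - fdet d ?F"
    by (simp add: fdet_rank_one)
  also have "\<dots> = fdet d ?F * (\<Sum>i<d. ?a i * ?v i)"
    unfolding fdet_mult_rank_one by (simp add: algebra_simps)
  also have "\<dots> = ip a u * vol \<phi>s" using parseval[OF pos_onb a u] vol_apply[OF \<phi>s] by (simp add: mult.commute)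
  finally show ?thesis .
qed

lemma vector_embed_outside: "\<phi> \<notin> dual_space S \<Longrightarrow> vector_embed S v [\<phi>] = 0"
  by (simp add: wedge_vectors_def)

lemma contract_vol_outside: "u \<in> S \<Longrightarrow> \<phi> \<in> set \<phi>s \<Longrightarrow> \<phi> \<notin> dual_space S \<Longrightarrow> contract_vol u \<phi>s = 0"
  by (rule ext_power_outside[OF contract_vol_ext_power]) auto

text \<open>For every permutation the list in which \<open>u\<close> precedes the permuted covectors is the permuted list
  in which \<open>u\<close> replaces the covector fed to \<open>a\<close>.  Hence all signs cancel and Cramer's rule applies.\<close>

lemma wedge_vector_contract_vol:
  assumes a: "a \<in> S" and u: "u \<in> S"
  shows "wedge 1 (d - 1) (vector_embed S a) (contract_vol u) = ip a u *\<^sub>R vol"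
proof
  fix \<phi>s
  have d: "1 + (d - 1) = d" using dim_positive by simp
  show "wedge 1 (d - 1) (vector_embed S a) (contract_vol u) \<phi>s = (ip a u *\<^sub>R vol) \<phi>s"
  proof (cases "length \<phi>s = d")
    case False
    then show ?thesis using ext_power_outside[OF vol_ext_power, of \<phi>s] d by (simp add: wedge_def scaleR_fun_def)
  next
    case len: True
    let ?t = "\<lambda>\<sigma>. of_int (sign \<sigma>) * vector_embed S a (map (\<lambda>i. \<phi>s ! \<sigma> i) [0..<1]) * contract_vol u (map (\<lambda>i. \<phi>s ! \<sigma> i) [1..<d])"
    have w: "wedge 1 (d - 1) (vector_embed S a) (contract_vol u) \<phi>s = (\<Sum>\<sigma> | \<sigma> permutes {..<d}. ?t \<sigma>) / fact (d - 1)"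
      unfolding wedge_def d using len by simp
    show ?thesis
    proof (cases "set \<phi>s \<subseteq> dual_space S")
      case True
      have "?t \<sigma> = (\<phi>s ! \<sigma> 0) a * vol (\<phi>s[\<sigma> 0 := fl u])" if \<sigma>: "\<sigma> permutes {..<d}" for \<sigma>
      proof -
        have inj: "\<sigma> i = \<sigma> j \<longleftrightarrow> i = j" for i j using permutes_inj[OF \<sigma>] by (simp add: inj_eq)
        have \<sigma>d: "\<sigma> i < d \<longleftrightarrow> i < d" for i using permutes_in_image[OF \<sigma>, of i] by simp
        have "set (\<phi>s[\<sigma> 0 := fl u]) \<subseteq> dual_space S" using True flat_dual[OF u] by (intro set_update_subsetI)
        then have "vol (permute_list \<sigma> (\<phi>s[\<sigma> 0 := fl u])) = of_int (sign \<sigma>) * vol (\<phi>s[\<sigma> 0 := fl u])"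
          using len by (intro ext_power_permute[OF vol_ext_power \<sigma>]) auto
        moreover have "permute_list \<sigma> (\<phi>s[\<sigma> 0 := fl u]) = fl u # map (\<lambda>i. \<phi>s ! \<sigma> i) [1..<d]"
        proof (rule nth_equalityI)
          fix i assume "i < length (permute_list \<sigma> (\<phi>s[\<sigma> 0 := fl u]))"
          then have "i < d" using len by simp
          then show "permute_list \<sigma> (\<phi>s[\<sigma> 0 := fl u]) ! i = (fl u # map (\<lambda>i. \<phi>s ! \<sigma> i) [1..<d]) ! i"
            using len \<sigma>d[of i] inj[of 0 i] nth_upt[of "Suc 0" "i - 1" d]
            by (cases i) (simp_all add: permute_list_def)
        qed (use len dim_positive in simp)
        moreover have "vector_embed S a (map (\<lambda>i. \<phi>s ! \<sigma> i) [0..<1]) = (\<phi>s ! \<sigma> 0) a"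
          using True len \<sigma>d[of 0] dim_positive nth_mem[of "\<sigma> 0" \<phi>s] by (simp add: vector_embed_apply subset_eq)
        ultimately show ?thesis unfolding contract_vol_def by (simp add: sign_def)
      qed
      then have "(\<Sum>\<sigma> | \<sigma> permutes {..<d}. ?t \<sigma>) = (\<Sum>\<sigma> | \<sigma> permutes {..<d}. (\<phi>s ! \<sigma> 0) a * vol (\<phi>s[\<sigma> 0 := fl u]))"
        by (intro sum.cong) auto
      also have "\<dots> = fact (d - 1) * (\<Sum>i<d. (\<phi>s ! i) a * vol (\<phi>s[i := fl u]))"
        by (rule sum_permutations_at[OF dim_positive])
      finally show ?thesis unfolding w by (simp add: vol_replace_sum[OF len True a u] scaleR_fun_def)
    next
      case False
      then obtain k where k: "k < d" "\<phi>s ! k \<notin> dual_space S" using len by (auto simp: set_conv_nth)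
      have "?t \<sigma> = 0" if \<sigma>: "\<sigma> permutes {..<d}" for \<sigma>
      proof -
        obtain i where i: "\<sigma> i = k" using permutes_surj[OF \<sigma>] by (metis surjD)
        have "i < d" using permutes_in_image[OF \<sigma>, of i] i k by simp
        then consider "\<sigma> 0 = k" | "\<phi>s ! k \<in> set (map (\<lambda>i. \<phi>s ! \<sigma> i) [1..<d])"
          using i by (cases "i = 0") auto
        then show ?thesis
          by cases (simp add: vector_embed_outside k, simp add: contract_vol_outside[OF u _ k(2)])
      qed
      then have "(\<Sum>\<sigma> | \<sigma> permutes {..<d}. ?t \<sigma>) = 0" by (intro sum.neutral) blast
      then have "wedge 1 (d - 1) (vector_embed S a) (contract_vol u) \<phi>s = 0" unfolding w by simp
      moreover have "vol \<phi>s = 0" using False by (intro ext_power_outside[OF vol_ext_power]) simp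
      ultimately show ?thesis by (simp add: scaleR_fun_def)
    qed
  qed
qed

text \<open>As before, except that \<open>u\<close> has to be moved past \<open>d - 1\<close> covectors.  This is the sign that the
  definition of the cofactor compensates.\<close>

lemma wedge_contract_vol_vector:
  assumes a: "a \<in> S" and u: "u \<in> S"
  shows "wedge (d - 1) 1 (contract_vol u) (vector_embed S a) = ((-1) ^ (d - 1) * ip a u) *\<^sub>R vol"
proof
  fix \<phi>s
  have d: "d - 1 + 1 = d" using dim_positive by simp
  have "[m..<Suc m] = [m]" for m :: nat by simp
  from this[of "d - 1"] have d': "[d - 1..<d] = [d - 1]" using dim_positive by simp
  show "wedge (d - 1) 1 (contract_vol u) (vector_embed S a) \<phi>s = (((-1) ^ (d - 1) * ip a u) *\<^sub>R vol) \<phi>s"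
  proof (cases "length \<phi>s = d")
    case False
    then show ?thesis using ext_power_outside[OF vol_ext_power, of \<phi>s] d by (simp add: wedge_def scaleR_fun_def)
  next
    case len: True
    let ?t = "\<lambda>\<sigma>. of_int (sign \<sigma>) * contract_vol u (map (\<lambda>i. \<phi>s ! \<sigma> i) [0..<d - 1]) * vector_embed S a [\<phi>s ! \<sigma> (d - 1)]"
    have w: "wedge (d - 1) 1 (contract_vol u) (vector_embed S a) \<phi>s = (\<Sum>\<sigma> | \<sigma> permutes {..<d}. ?t \<sigma>) / fact (d - 1)"
      unfolding wedge_def d d' using len by simp
    show ?thesis
    proof (cases "set \<phi>s \<subseteq> dual_space S")
      case True
      let ?l = "d - 1"
      have "?t \<sigma> = (-1) ^ (d - 1) * ((\<phi>s ! \<sigma> ?l) a * vol (\<phi>s[\<sigma> ?l := fl u]))" if \<sigma>: "\<sigma> permutes {..<d}" for \<sigma>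
      proof -
        have inj: "\<sigma> i = \<sigma> j \<longleftrightarrow> i = j" for i j using permutes_inj[OF \<sigma>] by (simp add: inj_eq)
        have \<sigma>d: "\<sigma> i < d \<longleftrightarrow> i < d" for i using permutes_in_image[OF \<sigma>, of i] by simp
        have sub: "set (\<phi>s[\<sigma> ?l := fl u]) \<subseteq> dual_space S" using True flat_dual[OF u] by (intro set_update_subsetI)
        then have "vol (permute_list \<sigma> (\<phi>s[\<sigma> ?l := fl u])) = of_int (sign \<sigma>) * vol (\<phi>s[\<sigma> ?l := fl u])"
          using len by (intro ext_power_permute[OF vol_ext_power \<sigma>]) auto
        moreover have list: "permute_list \<sigma> (\<phi>s[\<sigma> ?l := fl u]) = map (\<lambda>i. \<phi>s ! \<sigma> i) [0..<?l] @ [fl u]"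
        proof (rule nth_equalityI)
          fix i assume "i < length (permute_list \<sigma> (\<phi>s[\<sigma> ?l := fl u]))"
          then have "i < d" using len by simp
          then show "permute_list \<sigma> (\<phi>s[\<sigma> ?l := fl u]) ! i = (map (\<lambda>i. \<phi>s ! \<sigma> i) [0..<?l] @ [fl u]) ! i"
            using len \<sigma>d[of i] inj[of ?l i] by (cases "i < ?l") (auto simp: permute_list_def nth_append not_less le_less_Suc_eq dest!: le_antisym[of "?l" i])
        qed (use len dim_positive in simp)
        moreover have "vol (map (\<lambda>i. \<phi>s ! \<sigma> i) [0..<?l] @ [fl u]) = (-1) ^ ?l * vol (fl u # map (\<lambda>i. \<phi>s ! \<sigma> i) [0..<?l])"
        proof -
          have "set (map (\<lambda>i. \<phi>s ! \<sigma> i) [0..<?l] @ [fl u]) \<subseteq> dual_space S"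
            unfolding list[symmetric] using sub \<sigma> len by (metis set_permute_list length_list_update)
          then show ?thesis
            using ext_power_move_last[OF vol_ext_power, of "map (\<lambda>i. \<phi>s ! \<sigma> i) [0..<?l]" "fl u" "[]"] dim_positive by simp
        qed
        moreover have "vector_embed S a [\<phi>s ! \<sigma> ?l] = (\<phi>s ! \<sigma> ?l) a"
          using True len \<sigma>d[of ?l] dim_positive nth_mem[of "\<sigma> ?l" \<phi>s] by (simp add: vector_embed_apply subset_eq)
        ultimately have "(-1) ^ ?l * contract_vol u (map (\<lambda>i. \<phi>s ! \<sigma> i) [0..<?l]) = of_int (sign \<sigma>) * vol (\<phi>s[\<sigma> ?l := fl u])"
          and emb: "vector_embed S a [\<phi>s ! \<sigma> ?l] = (\<phi>s ! \<sigma> ?l) a"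
          unfolding contract_vol_def by auto
        then have "(-1) ^ ?l * ((-1) ^ ?l * contract_vol u (map (\<lambda>i. \<phi>s ! \<sigma> i) [0..<?l])) =
            (-1) ^ ?l * (of_int (sign \<sigma>) * vol (\<phi>s[\<sigma> ?l := fl u]))" by simp
        then have g: "contract_vol u (map (\<lambda>i. \<phi>s ! \<sigma> i) [0..<?l]) = (-1) ^ ?l * (of_int (sign \<sigma>) * vol (\<phi>s[\<sigma> ?l := fl u]))"
          by (simp flip: mult.assoc power_mult_distrib)
        show ?thesis unfolding g emb by (simp add: sign_def)
      qed
      then have "(\<Sum>\<sigma> | \<sigma> permutes {..<d}. ?t \<sigma>) =
          (\<Sum>\<sigma> | \<sigma> permutes {..<d}. (-1) ^ (d - 1) * ((\<phi>s ! \<sigma> ?l) a * vol (\<phi>s[\<sigma> ?l := fl u])))"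
        by (intro sum.cong) auto
      also have "\<dots> = fact (d - 1) * (\<Sum>i<d. (-1) ^ (d - 1) * ((\<phi>s ! i) a * vol (\<phi>s[i := fl u])))"
        using dim_positive by (intro sum_permutations_at) simp
      finally show ?thesis unfolding w
        by (simp add: vol_replace_sum[OF len True a u] scaleR_fun_def flip: sum_distrib_left)
    next
      case False
      then obtain k where k: "k < d" "\<phi>s ! k \<notin> dual_space S" using len by (auto simp: set_conv_nth)
      have "?t \<sigma> = 0" if \<sigma>: "\<sigma> permutes {..<d}" for \<sigma>
      proof -
        obtain i where i: "\<sigma> i = k" using permutes_surj[OF \<sigma>] by (metis surjD)
        have "i < d" using permutes_in_image[OF \<sigma>, of i] i k by simp
        then consider "\<sigma> (d - 1) = k" | "\<phi>s ! k \<in> set (map (\<lambda>i. \<phi>s ! \<sigma> i) [0..<d - 1])"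
          using i by (cases "i = d - 1") auto
        then show ?thesis
          by cases (simp add: vector_embed_outside k, simp add: contract_vol_outside[OF u _ k(2)])
      qed
      then have "(\<Sum>\<sigma> | \<sigma> permutes {..<d}. ?t \<sigma>) = 0" by (intro sum.neutral) blast
      then have "wedge (d - 1) 1 (contract_vol u) (vector_embed S a) \<phi>s = 0" unfolding w by simp
      moreover have "vol \<phi>s = 0" using False by (intro ext_power_outside[OF vol_ext_power]) simp
      ultimately show ?thesis by (simp add: scaleR_fun_def)
    qed
  qed
qed

lemma wedge_scalar_left:
  assumes "\<omega> \<in> ext_power d S"
  shows "wedge 0 d (scalar_embed r) \<omega> = r *\<^sub>R \<omega>"
proof
  fix \<phi>s
  show "wedge 0 d (scalar_embed r) \<omega> \<phi>s = (r *\<^sub>R \<omega>) \<phi>s"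
  proof (cases "length \<phi>s = d \<and> set \<phi>s \<subseteq> dual_space S")
    case True
    have "of_int (sign \<sigma>) * (scalar_embed r :: 'v multivector) [] * \<omega> (map (\<lambda>i. \<phi>s ! \<sigma> i) [0..<d]) = r * \<omega> \<phi>s"
      if "\<sigma> permutes {..<d}" for \<sigma>
      using ext_power_permute[OF assms that, of \<phi>s] True
      by (simp add: permute_list_def scalar_embed_def sign_def)
    then have "(\<Sum>\<sigma> | \<sigma> permutes {..<d}. of_int (sign \<sigma>) * (scalar_embed r :: 'v multivector) [] * \<omega> (map (\<lambda>i. \<phi>s ! \<sigma> i) [0..<d])) =
        (\<Sum>\<sigma> | \<sigma> permutes {..<d}. r * \<omega> \<phi>s)"
      by (intro sum.cong) auto
    then show ?thesis using True by (simp add: wedge_def scaleR_fun_def card_permutations)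
  next
    case False
    have "\<omega> (map (\<lambda>i. \<phi>s ! \<sigma> i) [0..<d]) = 0" if "length \<phi>s = d" "\<sigma> permutes {..<d}" for \<sigma>
    proof (rule ext_power_outside[OF assms])
      have "set (map (\<lambda>i. \<phi>s ! \<sigma> i) [0..<d]) = set \<phi>s"
        using set_permute_list[of \<sigma> \<phi>s] that by (simp add: permute_list_def)
      then show "\<not> (length (map (\<lambda>i. \<phi>s ! \<sigma> i) [0..<d]) = d \<and> set (map (\<lambda>i. \<phi>s ! \<sigma> i) [0..<d]) \<subseteq> dual_space S)"
        using False that by simp
    qed
    then show ?thesis using ext_power_outside[OF assms False] by (simp add: wedge_def scaleR_fun_def)
  qed
qed

lemma wedge_scalar_right:
  assumes "\<omega> \<in> ext_power d S"
  shows "wedge d 0 \<omega> (scalar_embed r) = r *\<^sub>R \<omega>"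
proof -
  have "wedge d 0 \<omega> (scalar_embed r) = wedge 0 d (scalar_embed r) \<omega>"
    by (auto simp: wedge_def scalar_embed_def fun_eq_iff intro!: sum.cong)
  then show ?thesis using wedge_scalar_left[OF assms] by simp
qed

end

section \<open>Hodge duals, determinant and cofactor\<close>

context oriented_ips
begin

text \<open>Since \<open>vol\<close> is the wedge of every positive orthonormal basis, the condition in the definition
  of \<open>hodge\<close> reduces to a single equation.\<close>

lemma hodge_eqI:
  assumes \<gamma>: "\<gamma> \<in> ext_power (d - k) S"
    and eq: "\<And>\<alpha>. \<alpha> \<in> ext_power k S \<Longrightarrow> wedge k (d - k) \<alpha> \<gamma> = ext_inner k V \<alpha> \<beta> *\<^sub>R vol"
    and unique: "\<And>\<gamma>'. \<gamma>' \<in> ext_power (d - k) S \<Longrightarrow>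
      (\<And>\<alpha>. \<alpha> \<in> ext_power k S \<Longrightarrow> wedge k (d - k) \<alpha> \<gamma>' = ext_inner k V \<alpha> \<beta> *\<^sub>R vol) \<Longrightarrow> \<gamma>' = \<gamma>"
  shows "hodge k V \<beta> = \<gamma>"
  unfolding hodge_def Let_def
proof (rule the_equality)
  show "\<gamma> \<in> ext_power (d - k) S \<and> (\<forall>\<alpha>\<in>ext_power k S. \<forall>e\<in>ips_positive V. orthonormal_basis V e \<longrightarrow>
      wedge k (d - k) \<alpha> \<gamma> = ext_inner k V \<alpha> \<beta> *\<^sub>R wedge_vectors S e)"
    using \<gamma> eq vol_unique by simp
next
  fix \<gamma>' assume "\<gamma>' \<in> ext_power (d - k) S \<and> (\<forall>\<alpha>\<in>ext_power k S. \<forall>e\<in>ips_positive V. orthonormal_basis V e \<longrightarrow>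
      wedge k (d - k) \<alpha> \<gamma>' = ext_inner k V \<alpha> \<beta> *\<^sub>R wedge_vectors S e)"
  then show "\<gamma>' = \<gamma>" using pos_onb_positive pos_onb vol_def by (intro unique) auto
qed

lemma length_some_orthonormal_basis: "length (some_orthonormal_basis V) = d"
  using orthonormal_basisD(2)[OF some_orthonormal_basis] .

lemma ext_inner_scalar: "ext_inner 0 V (scalar_embed r) (scalar_embed s) = r * s"
proof -
  have "{I. I \<subseteq> {..<d} \<and> card I = 0} = {{}}" by (auto simp: finite_subset)
  then show ?thesis
    unfolding ext_inner_def Let_def length_some_orthonormal_basis by (simp add: scalar_embed_def)
qed

lemma ext_inner_vector:
  assumes "a \<in> S" "v \<in> S"
  shows "ext_inner 1 V (vector_embed S a) (vector_embed S v) = ip a v"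
proof -
  let ?e = "some_orthonormal_basis V"
  note e = orthonormal_basisD[OF some_orthonormal_basis]
  have sets: "{I. I \<subseteq> {..<d} \<and> card I = 1} = (\<lambda>i. {i}) ` {..<d}"
    by (auto simp: card_1_singleton_iff)
  have "ext_inner 1 V (vector_embed S a) (vector_embed S v) =
      (\<Sum>i<d. vector_embed S a [fl (?e ! i)] * vector_embed S v [fl (?e ! i)])"
    unfolding ext_inner_def Let_def length_some_orthonormal_basis sets
    by (subst sum.reindex) auto
  also have "\<dots> = (\<Sum>i<d. ip a (?e ! i) * ip v (?e ! i))"
    using assms e ip_commute by (intro sum.cong refl) (auto simp: vector_embed_flat)
  finally show ?thesis using parseval[OF some_orthonormal_basis assms] by simp
qed

lemma ext_inner_top:
  "ext_inner d V \<omega> \<eta> = \<omega> (map (\<lambda>i. fl (some_orthonormal_basis V ! i)) [0..<d]) *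
    \<eta> (map (\<lambda>i. fl (some_orthonormal_basis V ! i)) [0..<d])"
proof -
  have "{I. I \<subseteq> {..<d} \<and> card I = d} = {{..<d}}" by (auto dest: card_subset_eq[OF finite_lessThan])
  moreover have "sorted_list_of_set {..<d} = [0..<d]" using sorted_list_of_set_range[of 0 d] by (simp add: lessThan_atLeast0)
  ultimately show ?thesis unfolding ext_inner_def Let_def length_some_orthonormal_basis by simp
qed

lemma ext_inner_codim_one:
  "ext_inner (d - 1) V \<omega> \<eta> =
    (\<Sum>j<d. \<omega> (map (\<lambda>i. fl (some_orthonormal_basis V ! i)) (others d j)) *
      \<eta> (map (\<lambda>i. fl (some_orthonormal_basis V ! i)) (others d j)))"
proof -
  have sets: "{I. I \<subseteq> {..<d} \<and> card I = d - 1} = (\<lambda>j. {..<d} - {j}) ` {..<d}"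
  proof
    show "{I. I \<subseteq> {..<d} \<and> card I = d - 1} \<subseteq> (\<lambda>j. {..<d} - {j}) ` {..<d}"
      by (auto elim!: subset_card_pred)
  qed auto
  have "inj_on (\<lambda>j. {..<d} - {j}) {..<d}" by (auto simp: inj_on_def)
  then show ?thesis
    unfolding ext_inner_def Let_def length_some_orthonormal_basis sets others_def
    by (subst sum.reindex) auto
qed

lemma hodge_0: "hodge 0 V (scalar_embed 1) = vol"
proof (rule hodge_eqI)
  show "vol \<in> ext_power (d - 0) S" using vol_ext_power by simp
next
  fix \<alpha> assume "\<alpha> \<in> ext_power 0 S"
  then have \<alpha>: "\<alpha> = scalar_embed (\<alpha> [])" by (rule ext_power_0)
  show "wedge 0 (d - 0) \<alpha> vol = ext_inner 0 V \<alpha> (scalar_embed 1) *\<^sub>R vol"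
    by (subst (1 2) \<alpha>) (simp add: wedge_scalar_left[OF vol_ext_power] ext_inner_scalar)
next
  fix \<gamma>' assume \<gamma>': "\<gamma>' \<in> ext_power (d - 0) S"
    and eq: "\<And>\<alpha>. \<alpha> \<in> ext_power 0 S \<Longrightarrow> wedge 0 (d - 0) \<alpha> \<gamma>' = ext_inner 0 V \<alpha> (scalar_embed 1) *\<^sub>R vol"
  then show "\<gamma>' = vol"
    using eq[OF scalar_embed_ext_power[of 1]] wedge_scalar_left[of \<gamma>' 1] by (simp add: ext_inner_scalar)
qed

lemma hodge_top: "hodge d V \<eta> = scalar_embed (ext_inner d V vol \<eta>)"
proof (rule hodge_eqI)
  show "scalar_embed (ext_inner d V vol \<eta>) \<in> ext_power (d - d) S" by (simp add: scalar_embed_ext_power)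
next
  fix \<alpha> assume "\<alpha> \<in> ext_power d S"
  then have \<alpha>: "\<alpha> = \<alpha> (map fl pos_onb) *\<^sub>R vol" by (rule top_form)
  have "wedge d 0 (c *\<^sub>R vol) (scalar_embed r) = (c * r) *\<^sub>R vol" for c r
    using wedge_scalar_right[OF scaleR_ext_power[OF vol_ext_power]] by (simp add: mult.commute)
  moreover have "ext_inner d V (c *\<^sub>R vol) \<eta> = c * ext_inner d V vol \<eta>" for c
    by (simp add: ext_inner_top scaleR_fun_def)
  ultimately show "wedge d (d - d) \<alpha> (scalar_embed (ext_inner d V vol \<eta>)) = ext_inner d V \<alpha> \<eta> *\<^sub>R vol"
    by (subst (1 2) \<alpha>) simp
next
  fix \<gamma>' assume \<gamma>': "\<gamma>' \<in> ext_power (d - d) S"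
    and eq: "\<And>\<alpha>. \<alpha> \<in> ext_power d S \<Longrightarrow> wedge d (d - d) \<alpha> \<gamma>' = ext_inner d V \<alpha> \<eta> *\<^sub>R vol"
  have s: "\<gamma>' = scalar_embed (\<gamma>' [])" using \<gamma>' by (intro ext_power_0) simp
  have "wedge d 0 vol (scalar_embed (\<gamma>' [])) = ext_inner d V vol \<eta> *\<^sub>R vol"
    using eq[OF vol_ext_power] s by simp
  then have "\<gamma>' [] = ext_inner d V vol \<eta>"
    using wedge_scalar_right[OF vol_ext_power] vol_scale_inject by simp
  then show "\<gamma>' = scalar_embed (ext_inner d V vol \<eta>)" using s by simp
qed

lemma hodge_1:
  assumes v: "v \<in> S"
  shows "hodge 1 V (vector_embed S v) = contract_vol v"
proof (rule hodge_eqI)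
  show "contract_vol v \<in> ext_power (d - 1) S" by (rule contract_vol_ext_power[OF v])
next
  fix \<alpha> assume "\<alpha> \<in> ext_power 1 S"
  then obtain a where "a \<in> S" "\<alpha> = vector_embed S a" by (rule degree_one_form)
  then show "wedge 1 (d - 1) \<alpha> (contract_vol v) = ext_inner 1 V \<alpha> (vector_embed S v) *\<^sub>R vol"
    using wedge_vector_contract_vol ext_inner_vector v by simp
next
  fix \<gamma>' assume "\<gamma>' \<in> ext_power (d - 1) S"
    and eq: "\<And>\<alpha>. \<alpha> \<in> ext_power 1 S \<Longrightarrow> wedge 1 (d - 1) \<alpha> \<gamma>' = ext_inner 1 V \<alpha> (vector_embed S v) *\<^sub>R vol"
  then obtain u where u: "u \<in> S" "\<gamma>' = contract_vol u" by (elim codim_one_form)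
  have "ip u a = ip v a" if a: "a \<in> S" for a
  proof -
    have "vector_embed S a \<in> ext_power 1 S" by (simp add: wedge_vectors_ext_power)
    from eq[OF this] have "ip a u *\<^sub>R vol = ip a v *\<^sub>R vol"
      unfolding u(2) wedge_vector_contract_vol[OF a u(1)] ext_inner_vector[OF a v] .
    then show ?thesis unfolding vol_scale_inject using ip_commute a u v by simp
  qed
  then show "\<gamma>' = contract_vol v" using ip_eqI[OF u(1) v] u(2) by simp
qed

lemma contract_vol_linear:
  assumes "x \<in> S" "y \<in> S"
  shows "contract_vol (a *\<^sub>R x + b *\<^sub>R y) \<phi>s = a * contract_vol x \<phi>s + b * contract_vol y \<phi>s"
proof (cases "length \<phi>s = d - 1 \<and> set \<phi>s \<subseteq> dual_space S")
  case True
  then show ?thesis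
    using ext_power_linear[OF vol_ext_power, of "fl x # \<phi>s" 0 "fl x" "fl y" a b] assms dim_positive
    by (simp add: contract_vol_def flat_linear flat_dual)
next
  case False
  then show ?thesis using ext_power_outside[OF contract_vol_ext_power False] assms space_closed by simp
qed

text \<open>As a function of \<open>u\<close> the inner product with \<open>contract_vol u\<close> is linear; the Riesz vector of this
  functional is the Hodge dual up to sign.\<close>

lemma hodge_codim_1:
  obtains w where "w \<in> S" "hodge (d - 1) V \<eta> = vector_embed S w"
    "\<And>u. u \<in> S \<Longrightarrow> ip w u = (-1) ^ (d - 1) * ext_inner (d - 1) V (contract_vol u) \<eta>"
proof -
  let ?g = "\<lambda>u. (-1) ^ (d - 1) * ext_inner (d - 1) V (contract_vol u) \<eta>"
  have lin: "?g (a *\<^sub>R x + b *\<^sub>R y) = a * ?g x + b * ?g y" if "x \<in> S" "y \<in> S" for a b x y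
    unfolding ext_inner_codim_one using contract_vol_linear[OF that]
    by (simp add: distrib_right distrib_left sum.distrib sum_distrib_left mult.assoc mult.left_commute)
  let ?\<phi> = "\<lambda>u. if u \<in> S then ?g u else 0"
  have "?\<phi> \<in> dual_space S"
    unfolding dual_space_def mem_Collect_eq
  proof (intro conjI ballI allI impI)
    fix x y assume "x \<in> S" "y \<in> S"
    then show "?\<phi> (x + y) = ?\<phi> x + ?\<phi> y" using lin[of x y 1 1] space_closed by simp
  next
    fix a x assume "x \<in> S"
    then show "?\<phi> (a *\<^sub>R x) = a * ?\<phi> x" using lin[of x x a 0] space_closed by simp
  qed auto
  then obtain w where w: "w \<in> S" "?\<phi> = fl w" by (rule riesz)
  have pair: "ip w u = ?g u" if "u \<in> S" for u
    using fun_cong[OF w(2), of u] that by (simp add: flat_apply)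
  have d1: "d - (d - 1) = 1" using dim_positive by simp
  have sq: "(-1) ^ (d - 1) * ((-1) ^ (d - 1) * x) = x" for x :: real
    by (simp flip: mult.assoc power_mult_distrib)
  have "hodge (d - 1) V \<eta> = vector_embed S w"
  proof (rule hodge_eqI; unfold d1)
    show "vector_embed S w \<in> ext_power 1 S" by (simp add: wedge_vectors_ext_power)
  next
    fix \<alpha> assume "\<alpha> \<in> ext_power (d - 1) S"
    then obtain u where u: "u \<in> S" "\<alpha> = contract_vol u" by (rule codim_one_form)
    show "wedge (d - 1) 1 \<alpha> (vector_embed S w) = ext_inner (d - 1) V \<alpha> \<eta> *\<^sub>R vol"
      unfolding u(2) wedge_contract_vol_vector[OF w(1) u(1)] pair[OF u(1)] sq ..
  next
    fix \<gamma>' assume "\<gamma>' \<in> ext_power 1 S"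
      and eq: "\<And>\<alpha>. \<alpha> \<in> ext_power (d - 1) S \<Longrightarrow> wedge (d - 1) 1 \<alpha> \<gamma>' = ext_inner (d - 1) V \<alpha> \<eta> *\<^sub>R vol"
    then obtain w' where w': "w' \<in> S" "\<gamma>' = vector_embed S w'" by (elim degree_one_form)
    have "ip w' u = ip w u" if u: "u \<in> S" for u
    proof -
      have "((-1) ^ (d - 1) * ip w' u) *\<^sub>R vol = ext_inner (d - 1) V (contract_vol u) \<eta> *\<^sub>R vol"
        using eq[OF contract_vol_ext_power[OF u]] unfolding w'(2) wedge_contract_vol_vector[OF w'(1) u] .
      then have "(-1) ^ (d - 1) * ip w' u = ext_inner (d - 1) V (contract_vol u) \<eta>" unfolding vol_scale_inject .
      then show ?thesis unfolding pair[OF u] by (metis sq)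
    qed
    then show "\<gamma>' = vector_embed S w" using ip_eqI[OF w'(1) w(1)] w'(2) by simp
  qed
  with w(1) show ?thesis by (rule that) (rule pair)
qed

end

text \<open>Linearity on a subspace only: a linear map between tangent spaces is arbitrary elsewhere.\<close>

definition linear_between :: "'v::real_vector set \<Rightarrow> 'w::real_vector set \<Rightarrow> ('v \<Rightarrow> 'w) \<Rightarrow> bool"
  where "linear_between V W A \<longleftrightarrow> (\<forall>x\<in>V. A x \<in> W) \<and> (\<forall>x\<in>V. \<forall>y\<in>V. A (x + y) = A x + A y) \<and>
    (\<forall>a. \<forall>x\<in>V. A (a *\<^sub>R x) = a *\<^sub>R A x)"

locale oriented_ips_pair = V: oriented_ips V + W: oriented_ips W
  for V :: "'v::real_vector oriented_ips" and W :: "'w::real_vector oriented_ips" +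
  assumes dim_eq: "dim (ips_space W) = dim (ips_space V)"
begin

abbreviation lin where "lin \<equiv> linear_between V.S W.S"
abbreviation d where "d \<equiv> dim (ips_space V)"

text \<open>The determinant of the matrix in fixed positive orthonormal bases.  For linear \<open>A\<close> this is \<open>Det\<close>
  (\<open>Det_eq\<close>).\<close>

definition det_between where
  "det_between A = fdet d (\<lambda>i j. W.ip (W.pos_onb ! i) (A (V.pos_onb ! j)))"

lemma linD:
  assumes "lin A"
  shows "x \<in> V.S \<Longrightarrow> A x \<in> W.S" "x \<in> V.S \<Longrightarrow> y \<in> V.S \<Longrightarrow> A (x + y) = A x + A y"
    "x \<in> V.S \<Longrightarrow> A (a *\<^sub>R x) = a *\<^sub>R A x"
  using assms unfolding linear_between_def by auto

lemma lin_sum: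
  assumes "lin A" "finite J" "\<And>j. j \<in> J \<Longrightarrow> x j \<in> V.S"
  shows "A (\<Sum>j\<in>J. c j *\<^sub>R x j) = (\<Sum>j\<in>J. c j *\<^sub>R A (x j))"
  using assms(2,3)
proof (induction J rule: finite_induct)
  case empty
  show ?case using linD(3)[OF assms(1) V.space_closed(1), of 0] by simp
next
  case (insert j J)
  then have "(\<Sum>j\<in>J. c j *\<^sub>R x j) \<in> V.S" "c j *\<^sub>R x j \<in> V.S" by (auto intro!: V.space_closed)
  then show ?case using insert linD[OF assms(1)] by simp
qed

lemma det_change_basis:
  assumes A: "lin A" and x: "\<And>i. i < d \<Longrightarrow> x i \<in> W.S" and y: "\<And>j. j < d \<Longrightarrow> y j \<in> V.S"
  shows "fdet d (\<lambda>i j. W.ip (x i) (A (y j))) =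
    fdet d (\<lambda>i j. W.ip (x j) (W.pos_onb ! i)) * det_between A * fdet d (\<lambda>i j. V.ip (y j) (V.pos_onb ! i))"
proof -
  note e = V.pos_onbD and e' = W.pos_onbD[unfolded dim_eq]
  have Ay: "A (y j) = (\<Sum>k<d. V.ip (y j) (V.pos_onb ! k) *\<^sub>R A (V.pos_onb ! k))" if "j < d" for j
    using lin_sum[OF A, of "{..<d}" "\<lambda>k. V.pos_onb ! k" "\<lambda>k. V.ip (y j) (V.pos_onb ! k)"]
      V.orthonormal_expansion[OF V.pos_onb y[OF that]] e by simp
  have "W.ip (x i) (A (y j)) = (\<Sum>k<d. W.ip (x i) (A (V.pos_onb ! k)) * V.ip (y j) (V.pos_onb ! k))"
    if i: "i < d" and j: "j < d" for i j
  proof -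
    have "W.ip (x i) (A (y j)) = (\<Sum>k<d. W.ip (x i) (V.ip (y j) (V.pos_onb ! k) *\<^sub>R A (V.pos_onb ! k)))"
      unfolding Ay[OF j] using x[OF i] e linD[OF A] by (intro W.ip_sum_right W.space_closed(4)) auto
    also have "\<dots> = (\<Sum>k<d. W.ip (x i) (A (V.pos_onb ! k)) * V.ip (y j) (V.pos_onb ! k))"
      using x[OF i] e linD[OF A] by (intro sum.cong refl) (simp add: W.ip_scale_right)
    finally show ?thesis .
  qed
  then have "fdet d (\<lambda>i j. W.ip (x i) (A (y j))) =
      fdet d (\<lambda>i j. \<Sum>k<d. W.ip (x i) (A (V.pos_onb ! k)) * V.ip (y j) (V.pos_onb ! k))"
    by (rule fdet_cong)
  also have "\<dots> = fdet d (\<lambda>i j. W.ip (x i) (A (V.pos_onb ! j))) * fdet d (\<lambda>i j. V.ip (y j) (V.pos_onb ! i))"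
    using fdet_mult[of d "\<lambda>i k. W.ip (x i) (A (V.pos_onb ! k))" "\<lambda>k j. V.ip (y j) (V.pos_onb ! k)"] .
  also have "fdet d (\<lambda>i j. W.ip (x i) (A (V.pos_onb ! j))) =
      fdet d (\<lambda>i j. \<Sum>k<d. W.ip (x i) (W.pos_onb ! k) * W.ip (W.pos_onb ! k) (A (V.pos_onb ! j)))"
  proof (rule fdet_cong)
    fix i j assume i: "i < d" and j: "j < d"
    have Ab: "A (V.pos_onb ! j) \<in> W.S" using e(3)[OF j] by (rule linD(1)[OF A])
    show "W.ip (x i) (A (V.pos_onb ! j)) = (\<Sum>k<d. W.ip (x i) (W.pos_onb ! k) * W.ip (W.pos_onb ! k) (A (V.pos_onb ! j)))"
      unfolding W.parseval[OF W.pos_onb x[OF i] Ab, unfolded dim_eq]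
      by (intro sum.cong refl arg_cong2[where f = "(*)"] W.ip_commute[OF Ab]) (use e'(3) in simp)
  qed
  also have "\<dots> = fdet d (\<lambda>i j. W.ip (x i) (W.pos_onb ! j)) * det_between A"
    unfolding det_between_def by (rule fdet_mult)
  finally show ?thesis by (simp only: fdet_transpose[of d "\<lambda>i j. W.ip (x j) (W.pos_onb ! i)"])
qed

text \<open>A formula without inverse matrices in frames that need not be orthonormal: the matrix of inner
  products \<open>\<langle>b'\<^sub>i, A b\<^sub>j\<rangle>\<close> is multiplied by the two changes of basis, and so are the Gram matrices.
  Positivity of the frames fixes the sign of the root.\<close>

theorem det_between_positive_bases:
  assumes A: "lin A" and b: "b \<in> ips_positive V" and b': "b' \<in> ips_positive W"
  shows "det_between A = fdet d (\<lambda>i j. W.ip (b' ! i) (A (b ! j))) /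
    sqrt (fdet d (\<lambda>i j. V.ip (b ! i) (b ! j)) * fdet d (\<lambda>i j. W.ip (b' ! i) (b' ! j)))"
proof -
  let ?B = "fdet d (\<lambda>i j. V.ip (b ! j) (V.pos_onb ! i))" and ?B' = "fdet d (\<lambda>i j. W.ip (b' ! j) (W.pos_onb ! i))"
  have pos: "?B > 0" "?B' > 0"
    using V.positive_gram[OF b] W.positive_gram[OF b', unfolded dim_eq] by auto
  note m = V.ordered_basis_facts(5)[OF V.positive_basis_ordered[OF b]]
    W.ordered_basis_facts(5)[OF W.positive_basis_ordered[OF b'], unfolded dim_eq]
  have "fdet d (\<lambda>i j. W.ip (b' ! i) (A (b ! j))) = ?B' * det_between A * ?B"
    using m by (intro det_change_basis[OF A]) auto
  moreover have "fdet d (\<lambda>i j. V.ip (b ! i) (b ! j)) = ?B * ?B"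
    using m by (intro V.gram_change_basis[OF V.pos_onb]) auto
  moreover have "fdet d (\<lambda>i j. W.ip (b' ! i) (b' ! j)) = ?B' * ?B'"
    using m by (intro W.gram_change_basis[OF W.pos_onb, unfolded dim_eq]) auto
  ultimately show ?thesis using pos by (simp add: real_sqrt_mult)
qed

text \<open>The transpose of \<open>A\<close> on covectors, extended by zero as elements of \<open>dual_space\<close> have to be.\<close>

definition pull_covector where "pull_covector A \<psi> = (\<lambda>x. if x \<in> V.S then \<psi> (A x) else 0)"

lemma pull_covector_dual:
  assumes A: "lin A" and \<psi>: "\<psi> \<in> dual_space W.S"
  shows "pull_covector A \<psi> \<in> dual_space V.S"
  using \<psi> linD[OF A] V.space_closed unfolding dual_space_def pull_covector_def by simp

lemma ext_map_apply:
  "length \<psi>s = k \<Longrightarrow> set \<psi>s \<subseteq> dual_space W.S \<Longrightarrow> ext_map k V.S W.S A \<omega> \<psi>s = \<omega> (map (pull_covector A) \<psi>s)"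
  unfolding ext_map_def pull_covector_def by simp

abbreviation onbW where "onbW \<equiv> some_orthonormal_basis W"
abbreviation thetas where "thetas \<equiv> map (\<lambda>i. flat W (onbW ! i)) [0..<d]"

text \<open>The inner product on exterior powers is computed in an orthonormal basis of unknown orientation;
  the value of the volume multivector on it, which is \<open>\<plusminus>1\<close>, records the orientation.\<close>

lemma det_between_some_basis:
  assumes A: "lin A"
  shows "det_between A = W.vol thetas * fdet d (\<lambda>i j. W.ip (onbW ! i) (A (V.pos_onb ! j)))"
proof -
  note a = W.orthonormal_basisD[OF W.some_orthonormal_basis, unfolded dim_eq]
    and f = W.map_basis_facts[OF W.some_orthonormal_basis, unfolded dim_eq]
  let ?Q = "fdet d (\<lambda>i j. W.ip (onbW ! j) (W.pos_onb ! i))"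
  have "fdet d (\<lambda>i j. V.ip (V.pos_onb ! j) (V.pos_onb ! i)) = fdet d (\<lambda>i j. if i = j then 1 else 0)"
    using V.pos_onbD by (intro fdet_cong) auto
  then have "fdet d (\<lambda>i j. W.ip (onbW ! i) (A (V.pos_onb ! j))) = ?Q * det_between A"
    using det_change_basis[OF A, of "\<lambda>i. onbW ! i" "\<lambda>i. V.pos_onb ! i"] a V.pos_onbD by (simp add: fdet_identity)
  moreover have "W.vol thetas = ?Q"
  proof -
    have "W.vol thetas = fdet d (\<lambda>i j. W.ip (onbW ! i) (W.pos_onb ! j))"
      unfolding W.vol_apply[unfolded dim_eq, OF f] using W.pos_onbD[unfolded dim_eq]
      by (intro fdet_cong) (simp add: W.flat_apply)
    then show ?thesis by (simp only: fdet_transpose[of d "\<lambda>i j. W.ip (onbW ! j) (W.pos_onb ! i)"])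
  qed
  moreover have "?Q * ?Q = 1" using W.orthonormal_gram[OF W.pos_onb W.some_orthonormal_basis, unfolded dim_eq] .
  ultimately show ?thesis by (simp flip: mult.assoc)
qed

lemma vol_pull_covector:
  assumes A: "lin A"
  shows "V.vol (map (pull_covector A) thetas) = fdet d (\<lambda>i j. W.ip (onbW ! i) (A (V.pos_onb ! j)))"
proof -
  note f = W.map_basis_facts[OF W.some_orthonormal_basis, unfolded dim_eq]
  have "V.vol (map (pull_covector A) thetas) = fdet d (\<lambda>i j. (map (pull_covector A) thetas ! i) (V.pos_onb ! j))"
    using f pull_covector_dual[OF A] by (intro V.vol_apply) auto
  also have "\<dots> = fdet d (\<lambda>i j. W.ip (onbW ! i) (A (V.pos_onb ! j)))"
    using V.pos_onbD linD(1)[OF A] by (intro fdet_cong) (simp add: pull_covector_def W.flat_apply)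
  finally show ?thesis .
qed

theorem Det_eq:
  assumes A: "lin A"
  shows "Det V W A = det_between A"
proof -
  note f = W.map_basis_facts[OF W.some_orthonormal_basis, unfolded dim_eq]
  have "ext_inner d W W.vol (ext_map d V.S W.S A V.vol) = W.vol thetas * V.vol (map (pull_covector A) thetas)"
    unfolding W.ext_inner_top[unfolded dim_eq] ext_map_apply[OF f] ..
  also have "\<dots> = det_between A" unfolding vol_pull_covector[OF A] det_between_some_basis[OF A] ..
  finally have "hodge d W (ext_map d V.S W.S A (hodge 0 V (scalar_embed 1))) = scalar_embed (det_between A)"
    unfolding V.hodge_0 W.hodge_top[unfolded dim_eq] by simp
  moreover have "scalar_embed r = (scalar_embed s :: 'w multivector) \<longleftrightarrow> r = s" for r s
    by (auto simp: scalar_embed_def dest: fun_cong[where x = "[]"])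
  ultimately show ?thesis unfolding Det_def Let_def by simp
qed

lemma lin_rank_one_update:
  assumes A: "lin A" and u: "u \<in> W.S" and v: "v \<in> V.S"
  shows "lin (\<lambda>x. A x + V.ip v x *\<^sub>R u)"
  using linD[OF A] u v
  by (auto simp: linear_between_def W.space_closed V.ip_add_right V.ip_scale_right algebra_simps)

text \<open>The cofactor is the derivative of the determinant.  Unfolding the Hodge duals gives the sum over
  \<open>j\<close> of \<open>\<langle>u, a\<^sub>j\<rangle>\<close> times the determinant of \<open>A\<close> with its \<open>j\<close>-th row replaced by \<open>v\<close>, and by
  the rank-one formula this is the increment of the determinant under \<open>A + u \<otimes> v\<close>.  In this form
  the cofactor inherits the invariance and the regularity of the determinant.\<close>

theorem Cof_eq:
  assumes A: "lin A" and v: "v \<in> V.S"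
  shows "Cof V W A v \<in> W.S"
    and "u \<in> W.S \<Longrightarrow> W.ip (Cof V W A v) u = det_between (\<lambda>x. A x + V.ip v x *\<^sub>R u) - det_between A"
proof -
  let ?\<eta> = "ext_map (d - 1) V.S W.S A (V.contract_vol v)"
  obtain w where w: "w \<in> W.S" "hodge (d - 1) W ?\<eta> = vector_embed W.S w"
    "\<And>u. u \<in> W.S \<Longrightarrow> W.ip w u = (-1) ^ (d - 1) * ext_inner (d - 1) W (W.contract_vol u) ?\<eta>"
    by (rule W.hodge_codim_1[of ?\<eta>, unfolded dim_eq]) blast
  let ?w = "(-1) ^ (d - 1) *\<^sub>R w"
  have w': "?w \<in> W.S" using w(1) by (rule W.space_closed(4))
  have embed: "(-1) ^ (d - 1) *\<^sub>R vector_embed W.S w = vector_embed W.S ?w"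
  proof
    fix \<phi>s
    show "((-1) ^ (d - 1) *\<^sub>R vector_embed W.S w) \<phi>s = vector_embed W.S ?w \<phi>s"
    proof (cases "length \<phi>s = 1 \<and> set \<phi>s \<subseteq> dual_space W.S")
      case True
      then obtain \<phi> where \<phi>: "\<phi>s = [\<phi>]" "\<phi> \<in> dual_space W.S" by (cases \<phi>s) auto
      then have "\<phi> ?w = (-1) ^ (d - 1) * \<phi> w" using w(1) unfolding dual_space_def by blast
      then show ?thesis using \<phi> by (simp add: scaleR_fun_def vector_embed_apply)
    next
      case False
      then show ?thesis by (auto simp: scaleR_fun_def wedge_vectors_def)
    qed
  qed
  have cof: "Cof V W A v = ?w"
    unfolding Cof_def Let_def V.hodge_1[OF v] w(2) embed
    using w' W.vector_embed_inject by (intro the_equality) auto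
  show "Cof V W A v \<in> W.S" unfolding cof by (rule w')
  assume u: "u \<in> W.S"
  note a = W.orthonormal_basisD[OF W.some_orthonormal_basis, unfolded dim_eq]
    and f = W.map_basis_facts[OF W.some_orthonormal_basis, unfolded dim_eq]
  let ?\<theta> = "\<lambda>i. flat W (onbW ! i)" and ?F = "\<lambda>i j. W.ip (onbW ! i) (A (V.pos_onb ! j))"
  let ?v = "\<lambda>j. V.ip v (V.pos_onb ! j)"
  have \<theta>: "?\<theta> i \<in> dual_space W.S" if "i < d" for i using a that by (intro W.flat_dual)
  have summand: "W.contract_vol u (map ?\<theta> (others d j)) * ?\<eta> (map ?\<theta> (others d j)) =
      W.vol thetas * (W.ip u (onbW ! j) * fdet d (?F(j := ?v)))" if j: "j < d" for j
  proof -
    have "?\<eta> (map ?\<theta> (others d j)) = V.contract_vol v (map (\<lambda>i. pull_covector A (?\<theta> i)) (others d j))"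
      using \<theta> others_facts(1)[of d j] others_facts(3)[OF j] by (subst ext_map_apply) (auto simp: comp_def)
    also have "\<dots> = others_sign d j * V.vol ((map (\<lambda>i. pull_covector A (?\<theta> i)) [0..<d])[j := flat V v])"
      unfolding V.contract_vol_def
      by (rule ext_power_others[OF j V.vol_ext_power V.flat_dual[OF v] pull_covector_dual[OF A \<theta>]])
    also have "V.vol ((map (\<lambda>i. pull_covector A (?\<theta> i)) [0..<d])[j := flat V v]) = fdet d (?F(j := ?v))"
    proof -
      have "set ((map (\<lambda>i. pull_covector A (?\<theta> i)) [0..<d])[j := flat V v]) \<subseteq> dual_space V.S"
        using \<theta> v by (intro set_update_subsetI V.flat_dual) (auto intro: pull_covector_dual[OF A])
      then have "V.vol ((map (\<lambda>i. pull_covector A (?\<theta> i)) [0..<d])[j := flat V v]) =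
          fdet d (\<lambda>i k. ((map (\<lambda>i. pull_covector A (?\<theta> i)) [0..<d])[j := flat V v] ! i) (V.pos_onb ! k))"
        by (intro V.vol_apply) auto
      also have "\<dots> = fdet d (?F(j := ?v))"
        using V.pos_onbD linD(1)[OF A] by (intro fdet_cong) (auto simp: nth_list_update pull_covector_def W.flat_apply V.flat_apply)
      finally show ?thesis .
    qed
    finally have 1: "?\<eta> (map ?\<theta> (others d j)) = others_sign d j * fdet d (?F(j := ?v))" .
    have "others_sign d j * x * (others_sign d j * y) = (others_sign d j * others_sign d j) * (x * y)" for x y
      by (simp only: ac_simps)
    then have sq: "others_sign d j * x * (others_sign d j * y) = x * y" for x y
      by (simp add: others_sign_square)
    show ?thesis
      unfolding 1 W.contract_vol_others[OF W.some_orthonormal_basis, unfolded dim_eq, OF j u]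
      unfolding sq by (simp only: ac_simps)
  qed
  have "W.ip ?w u = (-1) ^ (d - 1) * ((-1) ^ (d - 1) * ext_inner (d - 1) W (W.contract_vol u) ?\<eta>)"
    using w u by (simp add: W.ip_scale_left)
  also have "\<dots> = ext_inner (d - 1) W (W.contract_vol u) ?\<eta>" by (simp flip: mult.assoc power_mult_distrib)
  also have "\<dots> = W.vol thetas * (\<Sum>j<d. W.ip u (onbW ! j) * fdet d (?F(j := ?v)))"
    unfolding W.ext_inner_codim_one[unfolded dim_eq] sum_distrib_left
    by (intro sum.cong refl) (simp only: lessThan_iff summand)
  also have "\<dots> = W.vol thetas * (fdet d (\<lambda>i j. ?F i j + W.ip u (onbW ! i) * ?v j) - fdet d ?F)"
    by (simp add: fdet_rank_one)
  also have "fdet d (\<lambda>i j. ?F i j + W.ip u (onbW ! i) * ?v j) =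
      fdet d (\<lambda>i j. W.ip (onbW ! i) (A (V.pos_onb ! j) + V.ip v (V.pos_onb ! j) *\<^sub>R u))"
    using a u linD(1)[OF A] V.pos_onbD W.ip_commute
    by (intro fdet_cong) (simp add: W.ip_add_right W.ip_scale_right W.space_closed)
  also have "W.vol thetas * (\<dots> - fdet d ?F) = det_between (\<lambda>x. A x + V.ip v x *\<^sub>R u) - det_between A"
    unfolding det_between_some_basis[OF A] det_between_some_basis[OF lin_rank_one_update[OF A u v]]
    by (simp add: algebra_simps)
  finally show "W.ip (Cof V W A v) u = det_between (\<lambda>x. A x + V.ip v x *\<^sub>R u) - det_between A"
    unfolding cof .
qed

end

section \<open>The trace identity for the cofactor\<close>

lemma fdet_identity_rank_one: "fdet d (\<lambda>i j. (if i = j then 1 else 0) + u i * v j) = 1 + (\<Sum>i<d. u i * v i)"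
  by (simp add: fdet_rank_one fdet_identity fdet_identity_replace_row)

context oriented_ips_pair
begin

text \<open>The increment of the determinant expanded by the rank-one formula; every summand is linear in \<open>v\<close>.\<close>

lemma Cof_expansion:
  assumes A: "lin A" and v: "v \<in> V.S" and u: "u \<in> W.S"
  shows "W.ip (Cof V W A v) u = (\<Sum>j<d. W.ip (W.pos_onb ! j) u *
    fdet d ((\<lambda>i j. W.ip (W.pos_onb ! i) (A (V.pos_onb ! j)))(j := \<lambda>j. V.ip v (V.pos_onb ! j))))"
proof -
  have "det_between (\<lambda>x. A x + V.ip v x *\<^sub>R u) =
      fdet d (\<lambda>i j. W.ip (W.pos_onb ! i) (A (V.pos_onb ! j)) + W.ip (W.pos_onb ! i) u * V.ip v (V.pos_onb ! j))"
    unfolding det_between_def using W.pos_onbD(3)[unfolded dim_eq] V.pos_onbD(3) linD(1)[OF A] u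
    by (intro fdet_cong) (simp add: W.ip_add_right W.ip_scale_right W.space_closed)
  then show ?thesis unfolding Cof_eq(2)[OF A v u] by (simp add: fdet_rank_one det_between_def)
qed

lemma Cof_lin:
  assumes A: "lin A"
  shows "lin (Cof V W A)"
proof -
  have comb: "Cof V W A (a *\<^sub>R x + b *\<^sub>R y) = a *\<^sub>R Cof V W A x + b *\<^sub>R Cof V W A y"
    if x: "x \<in> V.S" and y: "y \<in> V.S" for a b x y
  proof (rule W.ip_eqI)
    have xy: "a *\<^sub>R x + b *\<^sub>R y \<in> V.S" using x y V.space_closed by simp
    note C = Cof_eq(1)[OF A]
    show "Cof V W A (a *\<^sub>R x + b *\<^sub>R y) \<in> W.S" by (rule C[OF xy])
    show "a *\<^sub>R Cof V W A x + b *\<^sub>R Cof V W A y \<in> W.S" using C x y W.space_closed by simp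
    fix u assume u: "u \<in> W.S"
    let ?F = "\<lambda>i j. W.ip (W.pos_onb ! i) (A (V.pos_onb ! j))"
    have row: "fdet d (?F(j := \<lambda>j. V.ip (a *\<^sub>R x + b *\<^sub>R y) (V.pos_onb ! j))) =
        a * fdet d (?F(j := \<lambda>j. V.ip x (V.pos_onb ! j))) + b * fdet d (?F(j := \<lambda>j. V.ip y (V.pos_onb ! j)))"
      if "j < d" for j
    proof -
      have "fdet d (?F(j := \<lambda>j. V.ip (a *\<^sub>R x + b *\<^sub>R y) (V.pos_onb ! j))) =
          fdet d (?F(j := \<lambda>j. a * V.ip x (V.pos_onb ! j) + b * V.ip y (V.pos_onb ! j)))"
        using V.pos_onbD(3) x y by (intro fdet_cong) (simp add: V.ip_add_left V.ip_scale_left V.space_closed)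
      then show ?thesis unfolding fdet_row_linear[OF that] .
    qed
    have "W.ip (Cof V W A (a *\<^sub>R x + b *\<^sub>R y)) u =
        (\<Sum>j<d. W.ip (W.pos_onb ! j) u * (a * fdet d (?F(j := \<lambda>j. V.ip x (V.pos_onb ! j))) + b * fdet d (?F(j := \<lambda>j. V.ip y (V.pos_onb ! j)))))"
      unfolding Cof_expansion[OF A xy u] by (intro sum.cong refl) (simp only: row lessThan_iff)
    also have "\<dots> = a * W.ip (Cof V W A x) u + b * W.ip (Cof V W A y) u"
      unfolding Cof_expansion[OF A x u] Cof_expansion[OF A y u]
      by (simp add: sum_distrib_left sum.distrib algebra_simps)
    also have "\<dots> = W.ip (a *\<^sub>R Cof V W A x + b *\<^sub>R Cof V W A y) u"
      using C x y u by (simp add: W.ip_add_left W.ip_scale_left W.space_closed)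
    finally show "W.ip (Cof V W A (a *\<^sub>R x + b *\<^sub>R y)) u = W.ip (a *\<^sub>R Cof V W A x + b *\<^sub>R Cof V W A y) u" .
  qed
  show ?thesis
    unfolding linear_between_def
  proof (intro conjI ballI allI)
    show "Cof V W A x \<in> W.S" if "x \<in> V.S" for x using Cof_eq(1)[OF A that] .
    show "Cof V W A (x + y) = Cof V W A x + Cof V W A y" if "x \<in> V.S" "y \<in> V.S" for x y
      using comb[OF that, of 1 1] by simp
    show "Cof V W A (a *\<^sub>R x) = a *\<^sub>R Cof V W A x" if "x \<in> V.S" for a x
      using comb[OF that V.space_closed(1), of a 0] by simp
  qed
qed

text \<open>If \<open>t = A\<^sup>T y\<close>, then \<open>A + u \<otimes> t = (1 + u \<otimes> y) A\<close>, whose determinant is \<open>Det A (1 + \<langle>y, u\<rangle>)\<close>.\<close>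

lemma Cof_adjoint:
  assumes A: "lin A" and y: "y \<in> W.S" and u: "u \<in> W.S" and t: "t \<in> V.S"
    and adj: "\<And>x. x \<in> V.S \<Longrightarrow> V.ip t x = W.ip y (A x)"
  shows "W.ip (Cof V W A t) u = det_between A * W.ip y u"
proof -
  let ?F = "\<lambda>i j. W.ip (W.pos_onb ! i) (A (V.pos_onb ! j))"
  let ?u = "\<lambda>i. W.ip (W.pos_onb ! i) u" and ?y = "\<lambda>k. W.ip y (W.pos_onb ! k)"
  note e' = W.pos_onbD[unfolded dim_eq]
  have t_entry: "V.ip t (V.pos_onb ! j) = (\<Sum>k<d. ?y k * ?F k j)" if j: "j < d" for j
  proof -
    have Ab: "A (V.pos_onb ! j) \<in> W.S" using V.pos_onbD(3)[OF j] by (rule linD(1)[OF A])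
    show ?thesis
      unfolding adj[OF V.pos_onbD(3)[OF j]] W.parseval[OF W.pos_onb y Ab, unfolded dim_eq]
      by (intro sum.cong refl arg_cong2[where f = "(*)"] W.ip_commute[OF Ab]) (use e'(3) in simp)
  qed
  have "det_between (\<lambda>x. A x + V.ip t x *\<^sub>R u) = fdet d (\<lambda>i j. \<Sum>k<d. ((if i = k then 1 else 0) + ?u i * ?y k) * ?F k j)"
    unfolding det_between_def
  proof (rule fdet_cong)
    fix i j assume i: "i < d" and j: "j < d"
    have "W.ip (W.pos_onb ! i) (A (V.pos_onb ! j) + V.ip t (V.pos_onb ! j) *\<^sub>R u) = ?F i j + V.ip t (V.pos_onb ! j) * ?u i"
      using e'(3)[OF i] linD(1)[OF A V.pos_onbD(3)[OF j]] u by (simp add: W.ip_add_right W.ip_scale_right W.space_closed)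
    also have "\<dots> = (\<Sum>k<d. (if i = k then ?F k j else 0) + ?u i * ?y k * ?F k j)"
      unfolding t_entry[OF j] sum.distrib using i by (simp add: sum_distrib_left mult_ac)
    also have "\<dots> = (\<Sum>k<d. ((if i = k then 1 else 0) + ?u i * ?y k) * ?F k j)"
      by (intro sum.cong refl) (simp add: distrib_right)
    finally show "W.ip (W.pos_onb ! i) (A (V.pos_onb ! j) + V.ip t (V.pos_onb ! j) *\<^sub>R u) =
        (\<Sum>k<d. ((if i = k then 1 else 0) + ?u i * ?y k) * ?F k j)" .
  qed
  also have "\<dots> = (1 + (\<Sum>i<d. ?u i * ?y i)) * det_between A"
    unfolding det_between_def
    using fdet_mult[of d "\<lambda>i k. (if i = k then 1 else 0) + ?u i * ?y k" ?F] fdet_identity_rank_one[of d ?u ?y] by simp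
  also have "(\<Sum>i<d. ?u i * ?y i) = W.ip y u"
    unfolding W.parseval[OF W.pos_onb y u, unfolded dim_eq]
    by (intro sum.cong refl) (use e'(3) W.ip_commute[OF u] in simp)
  finally show ?thesis unfolding Cof_eq(2)[OF A t u] by (simp add: algebra_simps)
qed

text \<open>Expanding \<open>A e\<^sub>i\<close> along \<open>a\<close> and summing over \<open>i\<close> replaces the cofactor at \<open>e\<^sub>i\<close> by the cofactor at
  \<open>A\<^sup>T a\<^sub>k\<close>.  Thus the identity is \<open>Cof A \<circ> A\<^sup>T = Det A\<close>, applied under the trace.\<close>

theorem trace_Cof:
  assumes A: "lin A" and L: "linear_between W.S W.S L"
    and e: "orthonormal_basis V e" and a: "orthonormal_basis W a"
  shows "(\<Sum>i<d. W.ip (L (A (e ! i))) (Cof V W A (e ! i))) = (\<Sum>k<d. W.ip (L (a ! k)) (a ! k)) * det_between A"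
proof -
  note e' = V.orthonormal_basisD[OF e] and a' = W.orthonormal_basisD[OF a, unfolded dim_eq]
  have LS: "L x \<in> W.S" if "x \<in> W.S" for x using L that unfolding linear_between_def by blast
  interpret WW: oriented_ips_pair W W by unfold_locales simp
  note C = Cof_lin[OF A]
  define t where "t k = (\<Sum>i<d. W.ip (A (e ! i)) (a ! k) *\<^sub>R e ! i)" for k
  have t: "t k \<in> V.S" for k unfolding t_def using e'(3) by (intro V.space_closed(6) V.space_closed(4)) auto
  have adj: "V.ip (t k) x = W.ip (a ! k) (A x)" if k: "k < d" and x: "x \<in> V.S" for k x
  proof -
    have "V.ip (t k) x = (\<Sum>i<d. V.ip (W.ip (A (e ! i)) (a ! k) *\<^sub>R e ! i) x)"
      unfolding t_def using e'(3) x by (intro V.ip_sum_left V.space_closed(4)) auto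
    also have "\<dots> = (\<Sum>i<d. W.ip (V.ip x (e ! i) *\<^sub>R A (e ! i)) (a ! k))"
    proof (intro sum.cong refl)
      fix i assume "i \<in> {..<d}"
      then have i: "e ! i \<in> V.S" using e'(3) by simp
      show "V.ip (W.ip (A (e ! i)) (a ! k) *\<^sub>R e ! i) x = W.ip (V.ip x (e ! i) *\<^sub>R A (e ! i)) (a ! k)"
        using V.ip_scale_left[OF i x] W.ip_scale_left[OF linD(1)[OF A i] a'(3)[OF k]] V.ip_commute[OF i x] by simp
    qed
    also have "\<dots> = W.ip (\<Sum>i<d. V.ip x (e ! i) *\<^sub>R A (e ! i)) (a ! k)"
      using e'(3) a'(3)[OF k] linD(1)[OF A] by (intro W.ip_sum_left[symmetric] W.space_closed(4)) auto
    also have "(\<Sum>i<d. V.ip x (e ! i) *\<^sub>R A (e ! i)) = A (\<Sum>i<d. V.ip x (e ! i) *\<^sub>R e ! i)"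
      using e'(3) by (intro lin_sum[OF A, symmetric]) auto
    also have "\<dots> = A x" using V.orthonormal_expansion[OF e x] by simp
    finally show ?thesis using W.ip_commute[OF linD(1)[OF A x] a'(3)[OF k]] by simp
  qed
  have "W.ip (L (A (e ! i))) (Cof V W A (e ! i)) =
      (\<Sum>k<d. W.ip (A (e ! i)) (a ! k) * W.ip (L (a ! k)) (Cof V W A (e ! i)))" if i: "i < d" for i
  proof -
    have Ae: "A (e ! i) \<in> W.S" and Ce: "Cof V W A (e ! i) \<in> W.S" using linD(1)[OF A] linD(1)[OF C] e'(3)[OF i] by auto
    have "L (A (e ! i)) = L (\<Sum>k<d. W.ip (A (e ! i)) (a ! k) *\<^sub>R a ! k)"
      using W.orthonormal_expansion[OF a Ae, unfolded dim_eq] by simp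
    also have "\<dots> = (\<Sum>k<d. W.ip (A (e ! i)) (a ! k) *\<^sub>R L (a ! k))"
      using a'(3) by (intro WW.lin_sum[OF L]) auto
    finally have "W.ip (L (A (e ! i))) (Cof V W A (e ! i)) =
        (\<Sum>k<d. W.ip (W.ip (A (e ! i)) (a ! k) *\<^sub>R L (a ! k)) (Cof V W A (e ! i)))"
      using a'(3) LS Ce by (simp, intro W.ip_sum_left W.space_closed(4)) auto
    also have "\<dots> = (\<Sum>k<d. W.ip (A (e ! i)) (a ! k) * W.ip (L (a ! k)) (Cof V W A (e ! i)))"
      using a'(3) LS Ce by (intro sum.cong refl) (simp add: W.ip_scale_left)
    finally show ?thesis .
  qed
  then have "(\<Sum>i<d. W.ip (L (A (e ! i))) (Cof V W A (e ! i))) =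
      (\<Sum>i<d. \<Sum>k<d. W.ip (A (e ! i)) (a ! k) * W.ip (L (a ! k)) (Cof V W A (e ! i)))" by simp
  also have "\<dots> = (\<Sum>k<d. \<Sum>i<d. W.ip (A (e ! i)) (a ! k) * W.ip (L (a ! k)) (Cof V W A (e ! i)))"
    by (rule sum.swap)
  also have "\<dots> = (\<Sum>k<d. W.ip (L (a ! k)) (a ! k) * det_between A)"
  proof (intro sum.cong refl)
    fix k assume "k \<in> {..<d}"
    then have k: "k < d" by simp
    have La: "L (a ! k) \<in> W.S" using LS a'(3)[OF k] .
    have "(\<Sum>i<d. W.ip (A (e ! i)) (a ! k) * W.ip (L (a ! k)) (Cof V W A (e ! i))) =
        (\<Sum>i<d. W.ip (L (a ! k)) (W.ip (A (e ! i)) (a ! k) *\<^sub>R Cof V W A (e ! i)))"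
      using La e'(3) linD(1)[OF C] by (intro sum.cong refl) (simp add: W.ip_scale_right)
    also have "\<dots> = W.ip (L (a ! k)) (\<Sum>i<d. W.ip (A (e ! i)) (a ! k) *\<^sub>R Cof V W A (e ! i))"
      using La e'(3) linD(1)[OF C] by (intro W.ip_sum_right[symmetric] W.space_closed(4)) auto
    also have "(\<Sum>i<d. W.ip (A (e ! i)) (a ! k) *\<^sub>R Cof V W A (e ! i)) = Cof V W A (t k)"
      unfolding t_def using e'(3) by (intro lin_sum[OF C, symmetric]) auto
    also have "W.ip (L (a ! k)) (Cof V W A (t k)) = W.ip (Cof V W A (t k)) (L (a ! k))"
      using La linD(1)[OF C t] by (rule W.ip_commute)
    also have "\<dots> = det_between A * W.ip (a ! k) (L (a ! k))"
      using Cof_adjoint[OF A a'(3)[OF k] La t adj[OF k]] .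
    also have "\<dots> = W.ip (L (a ! k)) (a ! k) * det_between A"
      using W.ip_commute[OF La a'(3)[OF k]] by simp
    finally show "(\<Sum>i<d. W.ip (A (e ! i)) (a ! k) * W.ip (L (a ! k)) (Cof V W A (e ! i))) =
        W.ip (L (a ! k)) (a ! k) * det_between A" .
  qed
  finally show ?thesis by (simp add: sum_distrib_right)
qed

lemma metric_transpose:
  assumes B: "lin B" and w: "w \<in> W.S"
  shows "metric_transpose V W B w \<in> V.S"
    and "u \<in> V.S \<Longrightarrow> V.ip (metric_transpose V W B w) u = W.ip w (B u)"
proof -
  let ?\<phi> = "pull_covector B (flat W w)"
  obtain v where v: "v \<in> V.S" "?\<phi> = flat V v"
    using pull_covector_dual[OF B W.flat_dual[OF w]] by (rule V.riesz)
  have pair: "V.ip v u = W.ip w (B u)" if "u \<in> V.S" for u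
    using fun_cong[OF v(2), of u] that linD(1)[OF B] by (simp add: pull_covector_def V.flat_apply W.flat_apply)
  have "metric_transpose V W B w = v"
    unfolding metric_transpose_def
  proof (rule the_equality)
    show "v \<in> V.S \<and> (\<forall>u\<in>V.S. V.ip v u = W.ip w (B u))" using v pair by simp
    fix v' assume "v' \<in> V.S \<and> (\<forall>u\<in>V.S. V.ip v' u = W.ip w (B u))"
    then show "v' = v" using pair v(1) by (intro V.ip_eqI) auto
  qed
  then show "metric_transpose V W B w \<in> V.S" "u \<in> V.S \<Longrightarrow> V.ip (metric_transpose V W B w) u = W.ip w (B u)"
    using v(1) pair by auto
qed

end

section \<open>Derivatives in charts\<close>

lemma has_real_derivative_along_line:
  fixes f :: "'a::real_normed_vector \<Rightarrow> real"
  assumes "(f has_derivative D) (at (x + \<tau> *\<^sub>R v))"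
  shows "((\<lambda>s. f (x + s *\<^sub>R v)) has_real_derivative D v) (at \<tau>)"
proof -
  have "((\<lambda>s. x + s *\<^sub>R v) has_derivative (\<lambda>s. s *\<^sub>R v)) (at \<tau>)"
    by (auto intro!: derivative_eq_intros)
  then have "((\<lambda>s. f (x + s *\<^sub>R v)) has_derivative (\<lambda>s. D (s *\<^sub>R v))) (at \<tau>)"
    using assms by (rule has_derivative_compose)
  moreover have "D (s *\<^sub>R v) = D v * s" for s
    using has_derivative_linear[OF assms] by (simp add: linear_scale)
  ultimately show ?thesis by (simp add: has_field_derivative_def)
qed

text \<open>The mean value theorem, first along \<open>v\<close> and then along \<open>w\<close>.\<close>

lemma mixed_difference:
  fixes f :: "'a::real_normed_vector \<Rightarrow> real"
  assumes f: "\<And>y. y \<in> U \<Longrightarrow> (f has_derivative f' y) (at y)"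
    and h: "\<And>y. y \<in> U \<Longrightarrow> ((\<lambda>z. f' z v) has_derivative h y) (at y)"
    and t: "t > 0" and U: "\<And>a b. 0 \<le> a \<Longrightarrow> a \<le> t \<Longrightarrow> 0 \<le> b \<Longrightarrow> b \<le> t \<Longrightarrow> x + a *\<^sub>R v + b *\<^sub>R w \<in> U"
  obtains a b where "0 < a" "a < t" "0 < b" "b < t"
    "f (x + t *\<^sub>R v + t *\<^sub>R w) - f (x + t *\<^sub>R v) - f (x + t *\<^sub>R w) + f x = t * (t * h (x + a *\<^sub>R v + b *\<^sub>R w) w)"
proof -
  define \<phi> where "\<phi> s = f ((x + t *\<^sub>R w) + s *\<^sub>R v) - f (x + s *\<^sub>R v)" for s
  have "DERIV \<phi> s :> f' ((x + t *\<^sub>R w) + s *\<^sub>R v) v - f' (x + s *\<^sub>R v) v" if "0 \<le> s" "s \<le> t" for s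
    unfolding \<phi>_def using that U[of s t] U[of s 0] t
    by (intro DERIV_diff has_real_derivative_along_line f) (auto simp: algebra_simps)
  then obtain a where a: "0 < a" "a < t"
    "\<phi> t - \<phi> 0 = (t - 0) * (f' ((x + t *\<^sub>R w) + a *\<^sub>R v) v - f' (x + a *\<^sub>R v) v)"
    using MVT2[OF t, of \<phi> "\<lambda>s. f' ((x + t *\<^sub>R w) + s *\<^sub>R v) v - f' (x + s *\<^sub>R v) v"] by blast
  define \<psi> where "\<psi> s = f' ((x + a *\<^sub>R v) + s *\<^sub>R w) v" for s
  have "DERIV \<psi> s :> h ((x + a *\<^sub>R v) + s *\<^sub>R w) w" if "0 \<le> s" "s \<le> t" for s
    unfolding \<psi>_def using that U[of a s] a
    by (intro has_real_derivative_along_line h) (auto simp: algebra_simps)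
  then obtain b where b: "0 < b" "b < t" "\<psi> t - \<psi> 0 = (t - 0) * h ((x + a *\<^sub>R v) + b *\<^sub>R w) w"
    using MVT2[OF t, of \<psi> "\<lambda>s. h ((x + a *\<^sub>R v) + s *\<^sub>R w) w"] by blast
  have "\<phi> t - \<phi> 0 = t * (\<psi> t - \<psi> 0)" unfolding a(3) \<psi>_def by (simp add: algebra_simps)
  then have "\<phi> t - \<phi> 0 = t * (t * h (x + a *\<^sub>R v + b *\<^sub>R w) w)" unfolding b(3) by simp
  moreover have "\<phi> t - \<phi> 0 = f (x + t *\<^sub>R v + t *\<^sub>R w) - f (x + t *\<^sub>R v) - f (x + t *\<^sub>R w) + f x"
    unfolding \<phi>_def by (simp add: algebra_simps)
  ultimately show ?thesis using that[OF a(1,2) b(1,2)] by simp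
qed

text \<open>Schwarz's theorem.  The second difference over a small parallelogram is symmetric in the two
  directions, and up to the area it is a value of either mixed derivative near \<open>x\<close>.\<close>

lemma mixed_derivatives_commute_real:
  fixes f :: "'a::real_normed_vector \<Rightarrow> real"
  assumes "open U" "x \<in> U"
    and f: "\<And>y. y \<in> U \<Longrightarrow> (f has_derivative f' y) (at y)"
    and hv: "\<And>y. y \<in> U \<Longrightarrow> ((\<lambda>z. f' z v) has_derivative hv y) (at y)"
    and hw: "\<And>y. y \<in> U \<Longrightarrow> ((\<lambda>z. f' z w) has_derivative hw y) (at y)"
    and cv: "continuous_on U (\<lambda>y. hv y w)" and cw: "continuous_on U (\<lambda>y. hw y v)"
  shows "hv x w = hw x v"
proof (rule ccontr)
  assume "hv x w \<noteq> hw x v"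
  define e where "e = \<bar>hv x w - hw x v\<bar> / 2"
  have e: "e > 0" using \<open>hv x w \<noteq> hw x v\<close> unfolding e_def by simp
  obtain r where r: "r > 0" "ball x r \<subseteq> U" using assms(1,2) openE by blast
  have "isCont (\<lambda>y. hv y w) x" "isCont (\<lambda>y. hw y v) x"
    using cv cw assms(1,2) continuous_on_eq_continuous_at by blast+
  then obtain r1 r2 where r1: "r1 > 0" "\<And>y. dist y x < r1 \<Longrightarrow> \<bar>hv y w - hv x w\<bar> < e"
    and r2: "r2 > 0" "\<And>y. dist y x < r2 \<Longrightarrow> \<bar>hw y v - hw x v\<bar> < e"
    using e unfolding continuous_at_eps_delta dist_real_def by metis
  define \<delta> where "\<delta> = min r (min r1 r2)"
  have \<delta>: "\<delta> > 0" "\<delta> \<le> r" "\<delta> \<le> r1" "\<delta> \<le> r2" unfolding \<delta>_def using r(1) r1(1) r2(1) by auto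
  define t where "t = \<delta> / (norm v + norm w + 1)"
  have n: "norm v + norm w + 1 > 0" using norm_ge_zero[of v] norm_ge_zero[of w] by linarith
  have t: "t > 0" unfolding t_def using \<delta>(1) n by simp
  have near: "norm (a *\<^sub>R v + b *\<^sub>R w) < \<delta>" if "0 \<le> a" "a \<le> t" "0 \<le> b" "b \<le> t" for a b
  proof -
    have "norm (a *\<^sub>R v + b *\<^sub>R w) \<le> a * norm v + b * norm w"
      using norm_triangle_ineq[of "a *\<^sub>R v" "b *\<^sub>R w"] that by simp
    also have "\<dots> \<le> t * norm v + t * norm w" using that by (intro add_mono mult_right_mono) auto
    also have "\<dots> < t * (norm v + norm w + 1)" using t by (simp add: algebra_simps)
    also have "\<dots> = \<delta>" unfolding t_def using n by simp
    finally show ?thesis .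
  qed
  have dist: "dist (x + a *\<^sub>R v + b *\<^sub>R w) x < \<delta>" if "0 \<le> a" "a \<le> t" "0 \<le> b" "b \<le> t" for a b
    using near[OF that] by (simp add: dist_norm algebra_simps)
  have inU: "x + a *\<^sub>R v + b *\<^sub>R w \<in> U" if "0 \<le> a" "a \<le> t" "0 \<le> b" "b \<le> t" for a b
    using dist[OF that] \<delta>(2) r(2) by (auto simp: dist_commute subset_iff)
  let ?\<Delta> = "f (x + t *\<^sub>R v + t *\<^sub>R w) - f (x + t *\<^sub>R v) - f (x + t *\<^sub>R w) + f x"
  obtain a b where ab: "0 < a" "a < t" "0 < b" "b < t" "?\<Delta> = t * (t * hv (x + a *\<^sub>R v + b *\<^sub>R w) w)"
    by (rule mixed_difference[OF f hv t inU])
  have inU': "x + a *\<^sub>R w + b *\<^sub>R v \<in> U" if "0 \<le> a" "a \<le> t" "0 \<le> b" "b \<le> t" for a b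
    using inU[OF that(3,4,1,2)] by (simp add: algebra_simps)
  obtain a' b' where ab': "0 < a'" "a' < t" "0 < b'" "b' < t"
    "f (x + t *\<^sub>R w + t *\<^sub>R v) - f (x + t *\<^sub>R w) - f (x + t *\<^sub>R v) + f x = t * (t * hw (x + a' *\<^sub>R w + b' *\<^sub>R v) v)"
    by (rule mixed_difference[OF f hw t inU'])
  have "f (x + t *\<^sub>R w + t *\<^sub>R v) = f (x + t *\<^sub>R v + t *\<^sub>R w)" by (simp add: algebra_simps)
  then have "t * (t * hv (x + a *\<^sub>R v + b *\<^sub>R w) w) = t * (t * hw (x + a' *\<^sub>R w + b' *\<^sub>R v) v)"
    using ab(5) ab'(5) by linarith
  then have eq: "hv (x + a *\<^sub>R v + b *\<^sub>R w) w = hw (x + a' *\<^sub>R w + b' *\<^sub>R v) v" using t by simp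
  have "\<bar>hv (x + a *\<^sub>R v + b *\<^sub>R w) w - hv x w\<bar> < e"
    using dist[of a b] ab \<delta>(3) by (intro r1(2)) auto
  moreover have swap: "x + a' *\<^sub>R w + b' *\<^sub>R v = x + b' *\<^sub>R v + a' *\<^sub>R w" by (simp add: algebra_simps)
  have "\<bar>hw (x + a' *\<^sub>R w + b' *\<^sub>R v) v - hw x v\<bar> < e"
    unfolding swap using dist[of b' a'] ab' \<delta>(4) by (intro r2(2)) auto
  ultimately have "\<bar>hv x w - hw x v\<bar> < 2 * e" using eq by linarith
  then show False unfolding e_def by simp
qed

lemma Ck_on_derivative:
  assumes "Ck_on (Suc k) U g" "y \<in> U"
  shows "(g has_derivative frechet_derivative g (at y)) (at y)"
  using assms by (simp add: frechet_derivative_works[symmetric])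

lemma mixed_derivatives_commute:
  fixes g :: "'a::euclidean_space \<Rightarrow> 'b::euclidean_space"
  assumes "open U" "x \<in> U" and g: "Ck_on (Suc (Suc 0)) U g"
  shows "frechet_derivative (\<lambda>y. frechet_derivative g (at y) v) (at x) w =
    frechet_derivative (\<lambda>y. frechet_derivative g (at y) w) (at x) v"
proof (rule euclidean_eqI)
  fix b :: 'b assume "b \<in> Basis"
  have g1: "Ck_on (Suc 0) U (\<lambda>y. frechet_derivative g (at y) v)" for v using g by simp
  have d0: "((\<lambda>y. g y \<bullet> b) has_derivative (\<lambda>v. frechet_derivative g (at y) v \<bullet> b)) (at y)" if "y \<in> U" for y
    using has_derivative_inner_left[OF Ck_on_derivative[OF g that]] .
  have d1: "((\<lambda>y. frechet_derivative g (at y) v \<bullet> b) has_derivative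
      (\<lambda>w. frechet_derivative (\<lambda>y. frechet_derivative g (at y) v) (at y) w \<bullet> b)) (at y)" if "y \<in> U" for v y
    using has_derivative_inner_left[OF Ck_on_derivative[OF g1 that]] .
  have c: "continuous_on U (\<lambda>y. frechet_derivative (\<lambda>y. frechet_derivative g (at y) v) (at y) w \<bullet> b)" for v w
    using g by (intro continuous_on_inner continuous_on_const) simp
  show "frechet_derivative (\<lambda>y. frechet_derivative g (at y) v) (at x) w \<bullet> b =
      frechet_derivative (\<lambda>y. frechet_derivative g (at y) w) (at x) v \<bullet> b"
    by (rule mixed_derivatives_commute_real[OF assms(1,2) d0 d1 d1 c c])
qed

text \<open>The points at which a derivative relative to \<open>S\<close> is determined by the function.  Boundary points
  of a half space are among them, which is what makes chart derivatives meaningful there.\<close>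

definition axis_accessible :: "'a::euclidean_space set \<Rightarrow> 'a \<Rightarrow> bool"
  where "axis_accessible S x \<longleftrightarrow> (\<forall>i\<in>Basis. \<forall>e>0. \<exists>d. 0 < \<bar>d\<bar> \<and> \<bar>d\<bar> < e \<and> x + d *\<^sub>R i \<in> S)"

lemma axis_accessible_unique:
  assumes "axis_accessible S x" "(f has_derivative D) (at x within S)" "(f has_derivative D') (at x within S)"
  shows "D = D'"
  using assms(1) unfolding axis_accessible_def
  by (intro frechet_derivative_unique_within[OF assms(2,3)]) blast

lemma axis_accessible_open:
  assumes "open S" "x \<in> S"
  shows "axis_accessible S x"
  unfolding axis_accessible_def
proof (intro ballI allI impI)
  fix i :: 'a and e :: real assume "i \<in> Basis" "e > 0"
  obtain r where r: "r > 0" "ball x r \<subseteq> S" using assms openE by blast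
  have "x + (min r e / 2) *\<^sub>R i \<in> ball x r" using r(1) \<open>e > 0\<close> \<open>i \<in> Basis\<close> by (auto simp: dist_norm)
  then show "\<exists>d. 0 < \<bar>d\<bar> \<and> \<bar>d\<bar> < e \<and> x + d *\<^sub>R i \<in> S"
    using r \<open>e > 0\<close> by (intro exI[of _ "min r e / 2"]) auto
qed

lemma axis_accessible_half_space:
  fixes x :: "real ^ 'n"
  assumes "openin (top_of_set {x. 0 \<le> x $ k}) S" "x \<in> S"
  shows "axis_accessible S x"
  unfolding axis_accessible_def
proof (intro ballI allI impI)
  fix i :: "real ^ 'n" and e :: real assume i: "i \<in> Basis" and "e > 0"
  obtain O' where O': "open O'" "S = {x. 0 \<le> x $ k} \<inter> O'" using assms(1) openin_open by blast
  obtain r where r: "r > 0" "ball x r \<subseteq> O'" using O' assms(2) openE by blast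
  let ?d = "min r e / 2"
  have "x + ?d *\<^sub>R i \<in> ball x r" using r(1) \<open>e > 0\<close> i by (auto simp: dist_norm)
  moreover have "0 \<le> (x + ?d *\<^sub>R i) $ k"
  proof -
    obtain j where "i = axis j 1" using i by (auto simp: Basis_vec_def)
    then have "0 \<le> i $ k" by (simp add: axis_def)
    then have "0 \<le> ?d * i $ k" using r(1) \<open>e > 0\<close> by (intro mult_nonneg_nonneg) auto
    then show ?thesis using O'(2) assms(2) by simp
  qed
  ultimately have "x + ?d *\<^sub>R i \<in> S" using O'(2) r(2) by auto
  then show "\<exists>d. 0 < \<bar>d\<bar> \<and> \<bar>d\<bar> < e \<and> x + d *\<^sub>R i \<in> S"
    using r(1) \<open>e > 0\<close> by (intro exI[of _ ?d]) auto
qed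

lemma has_derivative_openin_iff:
  assumes "openin (top_of_set S) T" "x \<in> T"
  shows "(f has_derivative D) (at x within T) \<longleftrightarrow> (f has_derivative D) (at x within S)"
proof -
  obtain O' where "open O'" "T = S \<inter> O'" using assms(1) openin_open by blast
  then have "at x within T = at x within S" using assms(2) by (intro at_within_nhd[of x O']) auto
  then show ?thesis by simp
qed

abbreviation chart_image where "chart_image c \<equiv> snd c ` fst c"

abbreviation has_chart_deriv where
  "has_chart_deriv c h p D \<equiv> ((h \<circ> chart_inv c) has_derivative D) (at (snd c p) within chart_image c)"

definition chart_differentiable :: "('a, 'n::finite) chart \<Rightarrow> ('a \<Rightarrow> 'b::real_normed_vector) \<Rightarrow> 'a \<Rightarrow> bool"
  where "chart_differentiable c h p \<longleftrightarrow> (\<exists>D. has_chart_deriv c h p D)"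

context
  fixes X :: "'a topology" and c :: "('a, 'n::finite) chart"
  assumes chart: "is_chart X c"
begin

lemma chart_domain_open: "openin X (fst c)"
  using chart unfolding is_chart_def by blast

lemma chart_domain_topspace: "topspace (subtopology X (fst c)) = fst c"
  using openin_subset[OF chart_domain_open] by auto

lemma chart_inj: "inj_on (snd c) (fst c)"
  using chart homeomorphic_imp_injective_map chart_domain_topspace unfolding is_chart_def by metis

lemma chart_inv_chart: "p \<in> fst c \<Longrightarrow> chart_inv c (snd c p) = p"
  unfolding chart_inv_def using chart_inj by (rule inv_into_f_f)

lemma chart_chart_inv: "x \<in> chart_image c \<Longrightarrow> snd c (chart_inv c x) = x"
  unfolding chart_inv_def by (rule f_inv_into_f)

lemma chart_image_openin:
  assumes "openin X U" "U \<subseteq> fst c"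
  shows "openin (top_of_set (chart_image c)) (snd c ` U)"
proof -
  have "homeomorphic_map (subtopology X (fst c)) (top_of_set (chart_image c)) (snd c)"
    using chart unfolding is_chart_def by blast
  moreover have "openin (subtopology X (fst c)) U" using assms openin_open_subtopology[OF chart_domain_open] by simp
  ultimately show ?thesis using homeomorphic_map_openness_eq by blast
qed

lemma chart_image_accessible:
  assumes "openin X U" "U \<subseteq> fst c" "p \<in> U"
  shows "axis_accessible (snd c ` U) (snd c p)"
proof -
  note U = chart_image_openin[OF assms(1,2)]
  have p: "snd c p \<in> snd c ` U" using assms(3) by blast
  from chart consider "open (chart_image c)" | i where "openin (top_of_set {x. 0 \<le> x $ i}) (chart_image c)"
    unfolding is_chart_def by blast
  then show ?thesis
  proof cases
    case 1
    then have "open (snd c ` U)" using U openin_open_eq by blast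
    then show ?thesis using p by (rule axis_accessible_open)
  next
    case 2
    then have "openin (top_of_set {x. 0 \<le> x $ i}) (snd c ` U)" using U openin_trans by blast
    then show ?thesis using p by (rule axis_accessible_half_space)
  qed
qed

lemma chart_deriv_eqI:
  assumes "p \<in> fst c" "has_chart_deriv c h p D"
  shows "chart_deriv c h p = D"
proof -
  have "axis_accessible (chart_image c) (snd c p)"
    using chart_domain_open assms(1) by (intro chart_image_accessible) auto
  then show ?thesis
    using axis_accessible_unique[OF _ _ assms(2)] assms(2)
    unfolding chart_deriv_def frechet_derivative_def by (metis (mono_tags, lifting) someI_ex)
qed

lemma has_chart_deriv_chart_deriv:
  assumes "p \<in> fst c" "chart_differentiable c h p"
  shows "has_chart_deriv c h p (chart_deriv c h p)"
  using assms chart_deriv_eqI unfolding chart_differentiable_def by metis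

lemma has_chart_deriv_within:
  assumes "openin X U" "U \<subseteq> fst c" "p \<in> U"
  shows "has_chart_deriv c h p D \<longleftrightarrow> ((h \<circ> chart_inv c) has_derivative D) (at (snd c p) within snd c ` U)"
  using has_derivative_openin_iff[OF chart_image_openin[OF assms(1,2)], of "snd c p"] assms(3) by blast

lemma has_chart_deriv_cong:
  assumes U: "openin X U" "U \<subseteq> fst c" "p \<in> U" and eq: "\<And>q. q \<in> U \<Longrightarrow> h q = h' q"
  shows "has_chart_deriv c h p D \<longleftrightarrow> has_chart_deriv c h' p D"
  unfolding has_chart_deriv_within[OF U]
proof -
  have eq': "(h \<circ> chart_inv c) x = (h' \<circ> chart_inv c) x" if "x \<in> snd c ` U" for x
  proof -
    have "chart_inv c x \<in> U" using that U(2) chart_inv_chart by auto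
    then show ?thesis using eq by simp
  qed
  have p: "snd c p \<in> snd c ` U" using U(3) by blast
  show "((h \<circ> chart_inv c) has_derivative D) (at (snd c p) within snd c ` U) \<longleftrightarrow>
      ((h' \<circ> chart_inv c) has_derivative D) (at (snd c p) within snd c ` U)"
    using has_derivative_transform[OF p, of "h' \<circ> chart_inv c" "h \<circ> chart_inv c" D]
      has_derivative_transform[OF p, of "h \<circ> chart_inv c" "h' \<circ> chart_inv c" D] eq' by metis
qed

lemma chart_differentiable_cong:
  assumes "openin X U" "U \<subseteq> fst c" "p \<in> U" "\<And>q. q \<in> U \<Longrightarrow> h q = h' q"
  shows "chart_differentiable c h p \<longleftrightarrow> chart_differentiable c h' p"
  unfolding chart_differentiable_def using has_chart_deriv_cong[OF assms] by simp

lemma chart_deriv_cong: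
  assumes "openin X U" "U \<subseteq> fst c" "p \<in> U" "\<And>q. q \<in> U \<Longrightarrow> h q = h' q"
  shows "chart_deriv c h p = chart_deriv c h' p"
  unfolding chart_deriv_def frechet_derivative_def using has_chart_deriv_cong[OF assms] by simp

text \<open>Derivatives relative to the chart image agree with those of a smooth extension to an open set, at
  boundary points too.  So the extension supplies the second derivatives and their symmetry.\<close>

lemma chart_deriv_smooth:
  fixes h :: "'a \<Rightarrow> 'b::euclidean_space"
  assumes W: "openin X W" "W \<subseteq> fst c" "p \<in> W" and smooth: "smooth_on (snd c ` W) (h \<circ> chart_inv c)"
  shows "chart_differentiable c h p"
    and "chart_differentiable c (\<lambda>q. chart_deriv c h q v) p"
    and "chart_deriv c (\<lambda>q. chart_deriv c h q v) p w = chart_deriv c (\<lambda>q. chart_deriv c h q w) p v"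
proof -
  have "snd c p \<in> snd c ` W" using W(3) by blast
  then obtain U g where U: "open U" "snd c p \<in> U" and Ck: "\<And>k. Ck_on k U g"
    and ext: "\<And>y. y \<in> U \<inter> snd c ` W \<Longrightarrow> g y = (h \<circ> chart_inv c) y"
    using smooth unfolding smooth_on_def by metis
  obtain W' where W': "openin X W'" "W' \<subseteq> W" "snd c ` W' = U \<inter> snd c ` W"
  proof
    let ?W = "{q \<in> W. snd c q \<in> U}"
    have "continuous_map (subtopology X (fst c)) (top_of_set (chart_image c)) (snd c)"
      using chart homeomorphic_imp_continuous_map unfolding is_chart_def by blast
    then have "continuous_map (subtopology X (fst c)) euclidean (snd c)"
      using continuous_map_in_subtopology by blast
    then have "openin (subtopology X (fst c)) {q \<in> topspace (subtopology X (fst c)). snd c q \<in> U}"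
      using U(1) by (intro openin_continuous_map_preimage) auto
    then have "openin X {q \<in> fst c. snd c q \<in> U}"
      unfolding chart_domain_topspace openin_open_subtopology[OF chart_domain_open] by blast
    then have "openin X ({q \<in> fst c. snd c q \<in> U} \<inter> W)" using W(1) by (rule openin_Int)
    moreover have "{q \<in> fst c. snd c q \<in> U} \<inter> W = ?W" using W(2) by blast
    ultimately show "openin X ?W" by simp
  qed auto
  have p: "p \<in> W'"
  proof -
    have "snd c p \<in> snd c ` W'" unfolding W'(3) using U(2) W(3) by blast
    then obtain q where "q \<in> W'" "snd c p = snd c q" by blast
    then show ?thesis using inj_onD[OF chart_inj, of p q] W W'(2) by auto
  qed
  note W'c = W'(1) subset_trans[OF W'(2) W(2)]
  have transfer: "has_chart_deriv c h' q D"
    if "(g' has_derivative D) (at (snd c q))" "q \<in> W'" "\<And>q. q \<in> W' \<Longrightarrow> h' q = g' (snd c q)" for h' q and g' :: "_ \<Rightarrow> 'b" and D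
    unfolding has_chart_deriv_within[OF W'c that(2)]
  proof (rule has_derivative_transform)
    show "snd c q \<in> snd c ` W'" using that(2) by blast
    show "(g' has_derivative D) (at (snd c q) within snd c ` W')" using that(1) by (rule has_derivative_at_withinI)
    show "(h' \<circ> chart_inv c) x = g' x" if "x \<in> snd c ` W'" for x
    proof -
      obtain r where r: "r \<in> W'" "x = snd c r" using \<open>x \<in> snd c ` W'\<close> by blast
      then show ?thesis using \<open>\<And>q. q \<in> W' \<Longrightarrow> h' q = g' (snd c q)\<close> chart_inv_chart[of r] W'c(2) by auto
    qed
  qed
  have hg: "h q = g (snd c q)" if "q \<in> W'" for q
  proof -
    have "snd c q \<in> U \<inter> snd c ` W" using that W'(3) by blast
    then show ?thesis using ext chart_inv_chart[of q] that W'c(2) by auto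
  qed
  have inU: "snd c q \<in> U" if "q \<in> W'" for q using that W'(3) by blast
  have d1: "has_chart_deriv c h q (frechet_derivative g (at (snd c q)))" if "q \<in> W'" for q
    using Ck_on_derivative[OF Ck[of "Suc 0"] inU[OF that]] that hg by (rule transfer)
  then have cd: "chart_deriv c h q v = frechet_derivative g (at (snd c q)) v" if "q \<in> W'" for q v
    using chart_deriv_eqI that W'c(2) by (metis subsetD)
  have c1: "Ck_on (Suc 0) U (\<lambda>y. frechet_derivative g (at y) v)" for v
    using Ck[of "Suc (Suc 0)"] by simp
  have d2: "has_chart_deriv c (\<lambda>q. chart_deriv c h q v) p
      (frechet_derivative (\<lambda>y. frechet_derivative g (at y) v) (at (snd c p)))" for v
    by (rule transfer[OF Ck_on_derivative[OF c1 inU[OF p]] p cd])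
  then have cd2: "chart_deriv c (\<lambda>q. chart_deriv c h q v) p = frechet_derivative (\<lambda>y. frechet_derivative g (at y) v) (at (snd c p))" for v
    using p W'c(2) by (intro chart_deriv_eqI) auto
  show "chart_differentiable c h p" unfolding chart_differentiable_def using d1[OF p] by blast
  show "chart_differentiable c (\<lambda>q. chart_deriv c h q v) p" unfolding chart_differentiable_def using d2 by blast
  show "chart_deriv c (\<lambda>q. chart_deriv c h q v) p w = chart_deriv c (\<lambda>q. chart_deriv c h q w) p v"
    unfolding cd2 by (rule mixed_derivatives_commute[OF U Ck])
qed

end

section \<open>Smooth maps and tangent spaces\<close>

lemma scaleR_fun_apply: "(a *\<^sub>R g) x = a *\<^sub>R g x"
  by (simp add: scaleR_fun_def)

locale smooth_mfd =
  fixes M :: "('a, 'n::finite) riem_mfd"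
  assumes smooth_mfd: "smooth_manifold_with_boundary M"
begin

lemma atlas_chart: "c \<in> atlas M \<Longrightarrow> is_chart (mfd_top M) c"
  using smooth_mfd unfolding smooth_manifold_with_boundary_def by (elim conjE) (rule bspec)

lemma atlas_covers: "(\<Union>c\<in>atlas M. fst c) = points M"
  using smooth_mfd unfolding smooth_manifold_with_boundary_def by (elim conjE)

lemma atlas_compatible:
  "c \<in> atlas M \<Longrightarrow> c' \<in> atlas M \<Longrightarrow> smooth_on (snd c ` (fst c \<inter> fst c')) (snd c' \<circ> chart_inv c)"
  using smooth_mfd unfolding smooth_manifold_with_boundary_def by (elim conjE) simp

lemma charts_at_iff: "c \<in> charts_at M p \<longleftrightarrow> c \<in> atlas M \<and> p \<in> fst c"
  unfolding charts_at_def by simp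

lemma charts_atD:
  assumes "c \<in> charts_at M p"
  shows "c \<in> atlas M" "is_chart (mfd_top M) c" "p \<in> fst c" "openin (mfd_top M) (fst c)" "p \<in> points M"
proof -
  show c: "c \<in> atlas M" "p \<in> fst c" using assms charts_at_iff by auto
  show ch: "is_chart (mfd_top M) c" by (rule atlas_chart[OF c(1)])
  show o: "openin (mfd_top M) (fst c)" by (rule chart_domain_open[OF ch])
  show "p \<in> points M" using openin_subset[OF o] c(2) by blast
qed

lemma ex_chart:
  assumes "p \<in> points M"
  obtains c where "c \<in> charts_at M p"
proof -
  obtain c where "c \<in> atlas M" "p \<in> fst c" using assms atlas_covers by (metis UN_E)
  then show ?thesis using that[of c] charts_at_iff by simp
qed

lemma chart_at: "p \<in> points M \<Longrightarrow> chart_at M p \<in> charts_at M p"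
  unfolding chart_at_def by (elim ex_chart) (rule someI)

end

text \<open>The identity of a manifold is an instance, so changes of charts and the calculus on a single
  manifold are special cases of statements about maps.\<close>

locale smooth_mfd_map = M: smooth_mfd M + N: smooth_mfd N
  for M :: "('a, 'n::finite) riem_mfd" and N :: "('b, 'm::finite) riem_mfd" +
  fixes f :: "'a \<Rightarrow> 'b"
  assumes smooth_map: "smooth_map M N f"
begin

lemma continuous: "continuous_map (mfd_top M) (mfd_top N) f"
  using smooth_map unfolding smooth_map_def by (elim conjE)

lemma map_points: "p \<in> points M \<Longrightarrow> f p \<in> points N"
  using continuous unfolding continuous_map_def by (elim conjE) (rule funcset_mem)

lemma preimage_openin:
  assumes "c \<in> atlas M" "openin (mfd_top N) V"
  shows "openin (mfd_top M) {p \<in> fst c. f p \<in> V}"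
proof -
  have V: "openin (mfd_top M) {p \<in> points M. f p \<in> V}"
    using continuous assms(2) by (rule openin_continuous_map_preimage)
  have c: "openin (mfd_top M) (fst c)" using chart_domain_open[OF M.atlas_chart[OF assms(1)]] .
  have "{p \<in> fst c. f p \<in> V} = {p \<in> points M. f p \<in> V} \<inter> fst c"
    using openin_subset[OF c] by auto
  then show ?thesis using openin_Int[OF V c] by simp
qed

abbreviation dom where "dom c c' \<equiv> {p \<in> fst c. f p \<in> fst c'}"

lemma dom_facts:
  assumes "c \<in> charts_at M p" "c' \<in> charts_at N (f p)"
  shows "openin (mfd_top M) (dom c c')" "dom c c' \<subseteq> fst c" "p \<in> dom c c'"
  using preimage_openin[of c "fst c'"] M.charts_atD[OF assms(1)] N.charts_atD[OF assms(2)] by auto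

lemma coordinates_smooth:
  assumes "c \<in> charts_at M p" "c' \<in> charts_at N (f p)"
  shows "chart_differentiable c (snd c' \<circ> f) p"
    and "chart_differentiable c (\<lambda>q. chart_deriv c (snd c' \<circ> f) q v) p"
    and "chart_deriv c (\<lambda>q. chart_deriv c (snd c' \<circ> f) q v) p w = chart_deriv c (\<lambda>q. chart_deriv c (snd c' \<circ> f) q w) p v"
proof -
  have "smooth_on (snd c ` dom c c') ((snd c' \<circ> f) \<circ> chart_inv c)"
    using smooth_map M.charts_atD(1)[OF assms(1)] N.charts_atD(1)[OF assms(2)] unfolding smooth_map_def by simp
  note * = chart_deriv_smooth[OF M.charts_atD(2)[OF assms(1)] dom_facts[OF assms] this]
  show "chart_differentiable c (snd c' \<circ> f) p" by (rule *(1))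
  show "chart_differentiable c (\<lambda>q. chart_deriv c (snd c' \<circ> f) q v) p" by (rule *(2))
  show "chart_deriv c (\<lambda>q. chart_deriv c (snd c' \<circ> f) q v) p w = chart_deriv c (\<lambda>q. chart_deriv c (snd c' \<circ> f) q w) p v"
    by (rule *(3))
qed

lemma has_chart_deriv_coordinates:
  assumes "c \<in> charts_at M p" "c' \<in> charts_at N (f p)"
  shows "has_chart_deriv c (snd c' \<circ> f) p (chart_deriv c (snd c' \<circ> f) p)"
  using has_chart_deriv_chart_deriv[OF M.charts_atD(2,3)[OF assms(1)] coordinates_smooth(1)[OF assms]] .

text \<open>The coordinate expression maps the relevant part of one chart image into the other, so that
  derivatives relative to these images compose.\<close>

lemma chain_rule:
  assumes c: "c \<in> charts_at M p" and c': "c' \<in> charts_at N (f p)" and h: "has_chart_deriv c' h (f p) D"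
  shows "has_chart_deriv c (h \<circ> f) p (\<lambda>w. D (chart_deriv c (snd c' \<circ> f) p w))"
proof -
  note cM = M.charts_atD[OF c] and cN = N.charts_atD[OF c'] and W = dom_facts[OF c c']
  let ?F = "(snd c' \<circ> f) \<circ> chart_inv c" and ?W = "snd c ` dom c c'"
  have F: "(?F has_derivative chart_deriv c (snd c' \<circ> f) p) (at (snd c p) within ?W)"
    using has_chart_deriv_coordinates[OF c c'] unfolding has_chart_deriv_within[OF cM(2) W] .
  have inv: "chart_inv c x \<in> dom c c'" if "x \<in> ?W" for x
    using that chart_inv_chart[OF cM(2)] W(2) by auto
  have "?F ` ?W \<subseteq> chart_image c'" using inv by auto
  moreover have "?F (snd c p) = snd c' (f p)" using chart_inv_chart[OF cM(2,3)] by simp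
  ultimately have "((h \<circ> chart_inv c') has_derivative D) (at (?F (snd c p)) within ?F ` ?W)"
    using h by (auto intro: has_derivative_subset)
  from diff_chain_within[OF F this]
  have chain: "((h \<circ> chart_inv c') \<circ> ?F has_derivative D \<circ> chart_deriv c (snd c' \<circ> f) p) (at (snd c p) within ?W)" .
  have "((h \<circ> f) \<circ> chart_inv c has_derivative D \<circ> chart_deriv c (snd c' \<circ> f) p) (at (snd c p) within ?W)"
  proof (rule has_derivative_transform[OF _ _ chain])
    show "snd c p \<in> ?W" using W(3) by blast
    show "((h \<circ> f) \<circ> chart_inv c) x = ((h \<circ> chart_inv c') \<circ> ?F) x" if "x \<in> ?W" for x
      using inv[OF that] chart_inv_chart[OF cN(2)] by simp
  qed
  then have "has_chart_deriv c (h \<circ> f) p (D \<circ> chart_deriv c (snd c' \<circ> f) p)"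
    unfolding has_chart_deriv_within[OF cM(2) W] .
  moreover have "D \<circ> chart_deriv c (snd c' \<circ> f) p = (\<lambda>w. D (chart_deriv c (snd c' \<circ> f) p w))" by auto
  ultimately show ?thesis by metis
qed

lemma chain_rule_deriv:
  assumes c: "c \<in> charts_at M p" and c': "c' \<in> charts_at N (f p)" and h: "chart_differentiable c' h (f p)"
  shows "chart_differentiable c (h \<circ> f) p"
    and "chart_deriv c (h \<circ> f) p w = chart_deriv c' h (f p) (chart_deriv c (snd c' \<circ> f) p w)"
proof -
  note D = chain_rule[OF c c' has_chart_deriv_chart_deriv[OF N.charts_atD(2,3)[OF c'] h]]
  show "chart_differentiable c (h \<circ> f) p" unfolding chart_differentiable_def using D by blast
  show "chart_deriv c (h \<circ> f) p w = chart_deriv c' h (f p) (chart_deriv c (snd c' \<circ> f) p w)"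
    using chart_deriv_eqI[OF M.charts_atD(2,3)[OF c] D] by simp
qed

lemma linear_coordinates:
  assumes "c \<in> charts_at M p" "c' \<in> charts_at N (f p)"
  shows "linear (chart_deriv c (snd c' \<circ> f) p)"
  using has_derivative_linear[OF has_chart_deriv_coordinates[OF assms]] .

end

context smooth_mfd
begin

lemma id_map: "smooth_mfd_map M M id"
proof unfold_locales
  show "smooth_map M M id"
    unfolding smooth_map_def
  proof (intro conjI ballI)
    fix c c' assume "c \<in> atlas M" "c' \<in> atlas M"
    moreover have "{p \<in> fst c. id p \<in> fst c'} = fst c \<inter> fst c'" by auto
    ultimately show "smooth_on (snd c ` {p \<in> fst c. id p \<in> fst c'}) (snd c' \<circ> id \<circ> chart_inv c)"
      using atlas_compatible[of c c'] by simp
  qed simp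
qed

abbreviation trans where "trans c c' p \<equiv> chart_deriv c (snd c') p"

lemma transition_smooth:
  assumes "c \<in> charts_at M p" "c' \<in> charts_at M p"
  shows "chart_differentiable c (snd c') p"
    and "chart_differentiable c (\<lambda>q. trans c c' q v) p"
    and "chart_deriv c (\<lambda>q. trans c c' q v) p w = chart_deriv c (\<lambda>q. trans c c' q w) p v"
  using smooth_mfd_map.coordinates_smooth[OF id_map assms(1), of c'] assms(2) by simp_all

lemma change_chart:
  assumes "c \<in> charts_at M p" "c' \<in> charts_at M p" "chart_differentiable c' h p"
  shows "chart_differentiable c h p" "chart_deriv c h p w = chart_deriv c' h p (trans c c' p w)"
  using smooth_mfd_map.chain_rule_deriv[OF id_map assms(1), of c' h] assms(2,3) by simp_all

lemma linear_trans: "c \<in> charts_at M p \<Longrightarrow> c' \<in> charts_at M p \<Longrightarrow> linear (trans c c' p)"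
  using smooth_mfd_map.linear_coordinates[OF id_map, of c p c'] by simp

lemma trans_self:
  assumes "c \<in> charts_at M p"
  shows "trans c c p w = w"
proof -
  note c = charts_atD[OF assms]
  have "has_chart_deriv c (snd c) p (\<lambda>w. w)"
  proof (rule has_derivative_transform)
    show "snd c p \<in> chart_image c" using c by blast
    show "(snd c \<circ> chart_inv c) x = x" if "x \<in> chart_image c" for x
      using chart_chart_inv[OF c(2) that] by simp
  qed (rule has_derivative_ident)
  from chart_deriv_eqI[OF c(2,3) this] show ?thesis by simp
qed

lemma trans_trans:
  assumes "c \<in> charts_at M p" "c' \<in> charts_at M p" "c'' \<in> charts_at M p"
  shows "trans c' c'' p (trans c c' p w) = trans c c'' p w"
  using change_chart(2)[OF assms(1,2) transition_smooth(1)[OF assms(2,3)]] by simp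

lemma trans_inverse:
  assumes "c \<in> charts_at M p" "c' \<in> charts_at M p"
  shows "trans c' c p (trans c c' p w) = w"
  using trans_trans[OF assms assms(1)] trans_self[OF assms(1)] by simp

lemma tangent_spaceI:
  assumes "\<And>c c'. c \<in> charts_at M p \<Longrightarrow> c' \<in> charts_at M p \<Longrightarrow> v c' = trans c c' p (v c)"
    and "\<And>c. c \<notin> charts_at M p \<Longrightarrow> v c = 0"
  shows "v \<in> tangent_space M p"
  unfolding tangent_space_def by (intro CollectI conjI ballI allI impI) (rule assms; assumption)+

lemma tangent_spaceD:
  assumes "v \<in> tangent_space M p"
  shows "c \<in> charts_at M p \<Longrightarrow> c' \<in> charts_at M p \<Longrightarrow> trans c c' p (v c) = v c'"
    and "c \<notin> charts_at M p \<Longrightarrow> v c = 0"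
proof -
  have "\<forall>c\<in>charts_at M p. \<forall>c'\<in>charts_at M p. v c' = trans c c' p (v c)"
    and "\<forall>c. c \<notin> charts_at M p \<longrightarrow> v c = 0"
    using assms unfolding tangent_space_def mem_Collect_eq by (rule conjunct1, rule conjunct2)
  then show "c \<in> charts_at M p \<Longrightarrow> c' \<in> charts_at M p \<Longrightarrow> trans c c' p (v c) = v c'"
    and "c \<notin> charts_at M p \<Longrightarrow> v c = 0" by metis+
qed

lemma coord_vector_apply: "c' \<in> charts_at M p \<Longrightarrow> coord_vector M c p w c' = trans c c' p w"
  unfolding coord_vector_def by simp

lemma coord_vector_self: "c \<in> charts_at M p \<Longrightarrow> coord_vector M c p w c = w"
  by (simp add: coord_vector_apply trans_self)

lemma coord_vector_tangent: "c \<in> charts_at M p \<Longrightarrow> coord_vector M c p w \<in> tangent_space M p"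
  unfolding tangent_space_def coord_vector_def by (simp add: trans_trans)

lemma tangent_coord_vector:
  assumes "c \<in> charts_at M p" "v \<in> tangent_space M p"
  shows "coord_vector M c p (v c) = v"
proof
  fix c' show "coord_vector M c p (v c) c' = v c'"
    using tangent_spaceD[OF assms(2), of c'] tangent_spaceD(1)[OF assms(2,1), of c']
    by (cases "c' \<in> charts_at M p") (simp_all add: coord_vector_def)
qed

lemma tangent_eqI:
  assumes "c \<in> charts_at M p" "v \<in> tangent_space M p" "w \<in> tangent_space M p" "v c = w c"
  shows "v = w"
proof -
  have "v = coord_vector M c p (v c)" by (rule tangent_coord_vector[OF assms(1,2), symmetric])
  also have "\<dots> = coord_vector M c p (w c)" by (rule arg_cong[OF assms(4)])
  also have "\<dots> = w" by (rule tangent_coord_vector[OF assms(1,3)])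
  finally show ?thesis .
qed

lemma linear_coord_vector:
  assumes "c \<in> charts_at M p"
  shows "linear (coord_vector M c p)"
proof (rule linearI)
  show "coord_vector M c p (v + w) = coord_vector M c p v + coord_vector M c p w" for v w
  proof
    show "coord_vector M c p (v + w) c' = (coord_vector M c p v + coord_vector M c p w) c'" for c'
      using linear_add[OF linear_trans[OF assms, of c']] by (simp add: coord_vector_def)
  qed
  show "coord_vector M c p (r *\<^sub>R v) = r *\<^sub>R coord_vector M c p v" for r v
  proof
    show "coord_vector M c p (r *\<^sub>R v) c' = (r *\<^sub>R coord_vector M c p v) c'" for c'
      using linear_scale[OF linear_trans[OF assms, of c']] by (simp add: coord_vector_def scaleR_fun_def)
  qed
qed

text \<open>A tangent vector is determined by its components in one chart, which are arbitrary.\<close>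

lemma tangent_space_image:
  assumes c: "c \<in> charts_at M p"
  shows "tangent_space M p = range (coord_vector M c p)"
proof
  show "tangent_space M p \<subseteq> range (coord_vector M c p)"
  proof
    fix v assume "v \<in> tangent_space M p"
    from tangent_coord_vector[OF c this, symmetric] show "v \<in> range (coord_vector M c p)" by (rule range_eqI)
  qed
  show "range (coord_vector M c p) \<subseteq> tangent_space M p" using coord_vector_tangent[OF c] by blast
qed

lemma subspace_tangent:
  assumes "p \<in> points M"
  shows "subspace (tangent_space M p)"
proof -
  obtain c where c: "c \<in> charts_at M p" using assms by (rule ex_chart)
  show ?thesis unfolding tangent_space_image[OF c]
    using linear_subspace_image[OF linear_coord_vector[OF c] subspace_UNIV] .
qed

lemma dim_tangent:
  assumes "p \<in> points M"
  shows "dim (tangent_space M p) = CARD('n)"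
proof -
  obtain c where c: "c \<in> charts_at M p" using assms by (rule ex_chart)
  let ?\<kappa> = "coord_vector M c p" and ?B = "Basis :: (real ^ 'n) set"
  have inj: "inj ?\<kappa>" by (rule inj_on_inverseI[where g = "\<lambda>v. v c"]) (rule coord_vector_self[OF c])
  have inj': "inj_on ?\<kappa> T" for T using inj subset_UNIV by (rule inj_on_subset)
  have "independent (?\<kappa> ` ?B)"
    by (rule linear_independent_injective_image[OF linear_coord_vector[OF c] independent_Basis inj'])
  then have "dim (span (?\<kappa> ` ?B)) = card (?\<kappa> ` ?B)" by (rule dim_span_eq_card_independent)
  also have "\<dots> = card ?B" by (rule card_image[OF inj'])
  also have "card ?B = CARD('n)" by simp
  also have "span (?\<kappa> ` ?B) = ?\<kappa> ` span ?B" by (rule linear_span_image[OF linear_coord_vector[OF c]])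
  also have "span ?B = UNIV" by (rule span_Basis)
  finally show ?thesis unfolding tangent_space_image[OF c] .
qed

lemma tangent_deriv_chart:
  assumes "c \<in> charts_at M p" "u \<in> tangent_space M p" "chart_differentiable c h p"
  shows "tangent_deriv M h p u = chart_deriv c h p (u c)"
proof -
  note a = chart_at[OF charts_atD(5)[OF assms(1)]]
  show ?thesis unfolding tangent_deriv_def
    using change_chart(2)[OF a assms(1,3)] tangent_spaceD(1)[OF assms(2) a assms(1)] by simp
qed

end

context smooth_mfd_map
begin

lemma differential_apply:
  assumes "c \<in> charts_at M p" "c' \<in> charts_at N (f p)" "u \<in> tangent_space M p"
  shows "differential M N f p u c' = chart_deriv c (snd c' \<circ> f) p (u c)"
  unfolding differential_def
  using M.tangent_deriv_chart[OF assms(1,3) coordinates_smooth(1)[OF assms(1,2)]] assms(2) by simp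

lemma differential_tangent:
  assumes "p \<in> points M" "u \<in> tangent_space M p"
  shows "differential M N f p u \<in> tangent_space N (f p)"
proof -
  obtain c where c: "c \<in> charts_at M p" using assms(1) by (rule M.ex_chart)
  have "differential M N f p u c'' = N.trans c' c'' (f p) (differential M N f p u c')"
    if c': "c' \<in> charts_at N (f p)" and c'': "c'' \<in> charts_at N (f p)" for c' c''
    unfolding differential_apply[OF c c' assms(2)] differential_apply[OF c c'' assms(2)]
    by (rule chain_rule_deriv(2)[OF c c' N.transition_smooth(1)[OF c' c'']])
  then show ?thesis by (rule N.tangent_spaceI) (simp_all add: differential_def)
qed

lemma differential_linear:
  assumes "p \<in> points M" "u \<in> tangent_space M p" "v \<in> tangent_space M p"
  shows "differential M N f p (u + v) = differential M N f p u + differential M N f p v"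
    and "differential M N f p (a *\<^sub>R u) = a *\<^sub>R differential M N f p u"
proof -
  obtain c where c: "c \<in> charts_at M p" using assms(1) by (rule M.ex_chart)
  obtain c' where c': "c' \<in> charts_at N (f p)" using map_points[OF assms(1)] by (rule N.ex_chart)
  note L = linear_coordinates[OF c c'] and sM = M.subspace_tangent[OF assms(1)]
    and sN = N.subspace_tangent[OF map_points[OF assms(1)]] and dt = differential_tangent[OF assms(1)]
  have uv: "u + v \<in> tangent_space M p" using sM assms(2,3) by (rule subspace_add)
  have au: "a *\<^sub>R u \<in> tangent_space M p" using sM assms(2) by (rule subspace_scale)
  show "differential M N f p (u + v) = differential M N f p u + differential M N f p v"
    by (rule N.tangent_eqI[OF c' dt[OF uv] subspace_add[OF sN dt[OF assms(2)] dt[OF assms(3)]]])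
      (simp add: differential_apply[OF c c'] uv assms linear_add[OF L])
  show "differential M N f p (a *\<^sub>R u) = a *\<^sub>R differential M N f p u"
    by (rule N.tangent_eqI[OF c' dt[OF au] subspace_scale[OF sN dt[OF assms(2)]]])
      (simp add: differential_apply[OF c c'] au assms linear_scale[OF L] scaleR_fun_apply)
qed

end

lemma (in smooth_mfd) differential_id:
  assumes "p \<in> points M" "u \<in> tangent_space M p"
  shows "differential M M id p u = u"
proof -
  interpret I: smooth_mfd_map M M id by (rule id_map)
  obtain c where c: "c \<in> charts_at M p" using assms(1) by (rule ex_chart)
  have c': "c \<in> charts_at M (id p)" using c by simp
  have dt: "differential M M id p u \<in> tangent_space M p" using I.differential_tangent[OF assms] by simp
  have "differential M M id p u c = u c"
    unfolding I.differential_apply[OF c c' assms(2)] using trans_self[OF c] by simp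
  then show ?thesis by (rule tangent_eqI[OF c dt assms(2)])
qed

section \<open>The Levi-Civita form of a chart\<close>

lemma linear_representation:
  fixes L :: "'e::euclidean_space \<Rightarrow> 'b::real_vector"
  assumes "linear L"
  shows "(\<Sum>b\<in>Basis. (v \<bullet> b) *\<^sub>R L b) = L v"
proof -
  have "L (\<Sum>b\<in>Basis. (v \<bullet> b) *\<^sub>R b) = (\<Sum>b\<in>Basis. (v \<bullet> b) *\<^sub>R L b)"
    by (simp only: linear_sum[OF assms] linear_scale[OF assms])
  then show ?thesis by (simp only: euclidean_representation)
qed

text \<open>The product rule for a linear map depending on a parameter, applied to a vector depending on it.
  Only the variation of \<open>s\<close> around its value at \<open>x\<close> has to be expanded in a basis.\<close>

lemma has_derivative_linear_application:
  fixes K :: "'x::real_normed_vector \<Rightarrow> 'e::euclidean_space \<Rightarrow> 'b::real_normed_vector"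
  assumes s: "(s has_derivative s') (at x within S)"
    and K: "\<And>w. ((\<lambda>y. K y w) has_derivative K' w) (at x within S)"
    and lin: "\<And>y. y \<in> S \<Longrightarrow> linear (K y)" and x: "x \<in> S"
  shows "((\<lambda>y. K y (s y)) has_derivative (\<lambda>u. K' (s x) u + K x (s' u))) (at x within S)"
proof -
  have diff: "((\<lambda>y. s y - s x) has_derivative (\<lambda>u. s' u - 0)) (at x within S)"
    by (rule has_derivative_diff[OF s has_derivative_const])
  have "((\<lambda>y. K y (s x) + (\<Sum>b\<in>Basis. ((s y - s x) \<bullet> b) *\<^sub>R K y b)) has_derivative
      (\<lambda>u. K' (s x) u + (\<Sum>b\<in>Basis. ((s x - s x) \<bullet> b) *\<^sub>R K' b u + ((s' u - 0) \<bullet> b) *\<^sub>R K x b))) (at x within S)"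
    by (intro has_derivative_add[OF K] has_derivative_sum has_derivative_scaleR has_derivative_inner_left diff K)
  moreover have "(\<lambda>u. K' (s x) u + (\<Sum>b\<in>Basis. ((s x - s x) \<bullet> b) *\<^sub>R K' b u + ((s' u - 0) \<bullet> b) *\<^sub>R K x b)) =
      (\<lambda>u. K' (s x) u + K x (s' u))"
    using linear_representation[OF lin[OF x]] by simp
  ultimately have D: "((\<lambda>y. K y (s x) + (\<Sum>b\<in>Basis. ((s y - s x) \<bullet> b) *\<^sub>R K y b)) has_derivative
      (\<lambda>u. K' (s x) u + K x (s' u))) (at x within S)" by simp
  show ?thesis
  proof (rule has_derivative_transform[OF x _ D])
    fix y assume "y \<in> S"
    note L = lin[OF this]
    show "K y (s y) = K y (s x) + (\<Sum>b\<in>Basis. ((s y - s x) \<bullet> b) *\<^sub>R K y b)"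
      unfolding linear_representation[OF L] linear_diff[OF L] by simp
  qed
qed

lemma has_chart_deriv_application:
  fixes K :: "'a \<Rightarrow> 'e::euclidean_space \<Rightarrow> 'b::real_normed_vector" and c :: "('a, 'n::finite) chart"
  assumes c: "is_chart X c" and U: "openin X U" "U \<subseteq> fst c" "p \<in> U"
    and s: "has_chart_deriv c s p s'"
    and K: "\<And>w. has_chart_deriv c (\<lambda>q. K q w) p (K' w)"
    and lin: "\<And>q. q \<in> U \<Longrightarrow> linear (K q)"
  shows "has_chart_deriv c (\<lambda>q. K q (s q)) p (\<lambda>u. K' (s p) u + K p (s' u))"
proof -
  have p: "chart_inv c (snd c p) = p" using chart_inv_chart[OF c] U by auto
  have "((\<lambda>y. K (chart_inv c y) ((s \<circ> chart_inv c) y)) has_derivative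
      (\<lambda>u. K' ((s \<circ> chart_inv c) (snd c p)) u + K (chart_inv c (snd c p)) (s' u))) (at (snd c p) within snd c ` U)"
  proof (rule has_derivative_linear_application)
    show "((s \<circ> chart_inv c) has_derivative s') (at (snd c p) within snd c ` U)"
      using s unfolding has_chart_deriv_within[OF c U] .
    show "((\<lambda>y. K (chart_inv c y) w) has_derivative K' w) (at (snd c p) within snd c ` U)" for w
    proof -
      have "((\<lambda>q. K q w) \<circ> chart_inv c has_derivative K' w) (at (snd c p) within snd c ` U)"
        using K[of w] unfolding has_chart_deriv_within[OF c U] .
      then show ?thesis by (simp add: comp_def)
    qed
    show "linear (K (chart_inv c y))" if y: "y \<in> snd c ` U" for y
    proof -
      obtain q where q: "q \<in> U" "y = snd c q" using y by (rule imageE)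
      then have "chart_inv c y = q" using chart_inv_chart[OF c, of q] U(2) by auto
      then show ?thesis using lin[OF q(1)] by simp
    qed
    show "snd c p \<in> snd c ` U" using U(3) by (rule imageI)
  qed
  then show ?thesis unfolding has_chart_deriv_within[OF c U] by (simp add: comp_def p)
qed

lemma chart_differentiableI: "has_chart_deriv c h p D \<Longrightarrow> chart_differentiable c h p"
  unfolding chart_differentiable_def by (rule exI[where x = D])

lemma chart_deriv_add:
  assumes c: "is_chart X c" "p \<in> fst c" and "chart_differentiable c g p" "chart_differentiable c h p"
  shows "chart_deriv c (\<lambda>q. g q + h q) p u = chart_deriv c g p u + chart_deriv c h p u"
    and "chart_deriv c (\<lambda>q. a *\<^sub>R g q) p u = a *\<^sub>R chart_deriv c g p u"
proof -
  note g = has_chart_deriv_chart_deriv[OF c assms(3)] and h = has_chart_deriv_chart_deriv[OF c assms(4)]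
  have "has_chart_deriv c (\<lambda>q. g q + h q) p (\<lambda>u. chart_deriv c g p u + chart_deriv c h p u)"
    using has_derivative_add[OF g h] by (simp add: comp_def)
  from chart_deriv_eqI[OF c this] show "chart_deriv c (\<lambda>q. g q + h q) p u = chart_deriv c g p u + chart_deriv c h p u" by simp
  have "has_chart_deriv c (\<lambda>q. a *\<^sub>R g q) p (\<lambda>u. a *\<^sub>R chart_deriv c g p u)"
    using has_derivative_scaleR_right[OF g] by (simp add: comp_def)
  from chart_deriv_eqI[OF c this] show "chart_deriv c (\<lambda>q. a *\<^sub>R g q) p u = a *\<^sub>R chart_deriv c g p u" by simp
qed

lemma linear_chart_deriv:
  assumes "is_chart X c" "p \<in> fst c" "chart_differentiable c h p"
  shows "linear (chart_deriv c h p)"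
  by (rule has_derivative_linear[OF has_chart_deriv_chart_deriv[OF assms]])

locale oriented_riem =
  fixes M :: "('a, 'n::finite) riem_mfd"
  assumes riem: "oriented_riemannian_manifold_with_boundary M"

sublocale oriented_riem \<subseteq> smooth_mfd M
  using riem unfolding oriented_riemannian_manifold_with_boundary_def by unfold_locales (elim conjE)

lemma ips_tangent [simp]:
  "ips_space (tangent_ips M p) = tangent_space M p"
  "ips_inner (tangent_ips M p) = riem_metric M p"
  "ips_positive (tangent_ips M p) = positive_bases M p"
  by (simp_all add: tangent_ips_def)

context oriented_riem
begin

lemma tangent_oriented_ips:
  assumes "p \<in> points M"
  shows "oriented_ips (tangent_ips M p)"
proof
  show "oriented_inner_product_space (tangent_ips M p)"
    using riem assms unfolding oriented_riemannian_manifold_with_boundary_def by (elim conjE) (rule bspec)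
  show "dim (ips_space (tangent_ips M p)) > 0" using dim_tangent[OF assms] by simp
qed

lemma metric_smooth:
  assumes "c \<in> charts_at M p"
  shows "chart_differentiable c (metric_coeff M c v w) p"
proof -
  note c = charts_atD[OF assms]
  have "smooth_on (snd c ` fst c) (metric_coeff M c v w \<circ> chart_inv c)"
    using riem c(1) unfolding oriented_riemannian_manifold_with_boundary_def by simp
  from chart_deriv_smooth(1)[OF c(2) c(4) subset_refl c(3) this] show ?thesis .
qed

lemma metric_coeff_tangent:
  assumes "c \<in> charts_at M p" "v \<in> tangent_space M p" "w \<in> tangent_space M p"
  shows "metric_coeff M c (v c) (w c) p = riem_metric M p v w"
  unfolding metric_coeff_def tangent_coord_vector[OF assms(1,2)] tangent_coord_vector[OF assms(1,3)] ..

lemma linear_metric_coeff: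
  assumes c: "c \<in> charts_at M p"
  shows "linear (\<lambda>v. metric_coeff M c v w p)" "linear (\<lambda>w. metric_coeff M c v w p)"
proof -
  interpret V: oriented_ips "tangent_ips M p" by (rule tangent_oriented_ips[OF charts_atD(5)[OF c]])
  note L = linear_coord_vector[OF c] and T = coord_vector_tangent[OF c]
  show "linear (\<lambda>v. metric_coeff M c v w p)"
    using V.ip_add_left V.ip_scale_left T
    by (intro linearI) (simp_all add: metric_coeff_def linear_add[OF L] linear_scale[OF L])
  show "linear (\<lambda>w. metric_coeff M c v w p)"
    using V.ip_add_right V.ip_scale_right T
    by (intro linearI) (simp_all add: metric_coeff_def linear_add[OF L] linear_scale[OF L])
qed

lemma metric_coeff_commute:
  assumes c: "c \<in> charts_at M p"
  shows "metric_coeff M c v w p = metric_coeff M c w v p"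
proof -
  interpret V: oriented_ips "tangent_ips M p" by (rule tangent_oriented_ips[OF charts_atD(5)[OF c]])
  show ?thesis using V.ip_commute[of "coord_vector M c p v" "coord_vector M c p w"] coord_vector_tangent[OF c]
    by (simp add: metric_coeff_def)
qed

lemma metric_coeff_eqI:
  assumes c: "c \<in> charts_at M p" and eq: "\<And>w. metric_coeff M c x w p = metric_coeff M c y w p"
  shows "x = y"
proof (rule ccontr)
  interpret V: oriented_ips "tangent_ips M p" by (rule tangent_oriented_ips[OF charts_atD(5)[OF c]])
  note L = linear_coord_vector[OF c]
  assume "x \<noteq> y"
  then have "coord_vector M c p (x - y) c \<noteq> 0" unfolding coord_vector_self[OF c] by simp
  then have "coord_vector M c p (x - y) \<noteq> 0" by (metis zero_fun_apply)
  then have "metric_coeff M c (x - y) (x - y) p > 0"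
    using V.ip_positive[of "coord_vector M c p (x - y)"] coord_vector_tangent[OF c] by (simp add: metric_coeff_def)
  then show False using linear_diff[OF linear_metric_coeff(1)[OF c], of x y "x - y"] eq[of "x - y"] by simp
qed

lemma metric_coeff_riesz:
  assumes c: "c \<in> charts_at M p" and \<phi>: "linear \<phi>"
  obtains x where "\<And>w. metric_coeff M c x w p = \<phi> w"
proof -
  interpret V: oriented_ips "tangent_ips M p" by (rule tangent_oriented_ips[OF charts_atD(5)[OF c]])
  let ?\<psi> = "\<lambda>t. if t \<in> tangent_space M p then \<phi> (t c) else 0"
  note sub = subspace_tangent[OF charts_atD(5)[OF c]]
  have "?\<psi> \<in> dual_space V.S"
    unfolding dual_space_def
    by (simp add: subspace_add[OF sub] subspace_scale[OF sub] linear_add[OF \<phi>] linear_scale[OF \<phi>] scaleR_fun_apply)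
  then obtain v where v: "v \<in> V.S" "?\<psi> = flat (tangent_ips M p) v" by (rule V.riesz)
  have "metric_coeff M c (v c) w p = \<phi> w" for w
  proof -
    let ?t = "coord_vector M c p w"
    have t: "?t \<in> tangent_space M p" by (rule coord_vector_tangent[OF c])
    have "metric_coeff M c (v c) w p = riem_metric M p v ?t"
      using metric_coeff_tangent[OF c _ t, of v] v(1) coord_vector_self[OF c] by simp
    also have "\<dots> = flat (tangent_ips M p) v ?t" using V.flat_apply[of ?t v] t by simp
    also have "\<dots> = ?\<psi> ?t" by (rule fun_cong[OF v(2), symmetric])
    also have "\<dots> = \<phi> w" using t coord_vector_self[OF c] by simp
    finally show ?thesis .
  qed
  then show ?thesis by (rule that)
qed

abbreviation metric_deriv where
  "metric_deriv c p u v w \<equiv> chart_deriv c (metric_coeff M c v w) p u"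

lemma metric_deriv_facts:
  assumes c: "c \<in> charts_at M p"
  shows "linear (\<lambda>u. metric_deriv c p u v w)" "linear (\<lambda>v. metric_deriv c p u v w)"
    "linear (\<lambda>w. metric_deriv c p u v w)" "metric_deriv c p u v w = metric_deriv c p u w v"
proof -
  note cc = charts_atD[OF c] and D = metric_smooth[OF c]
  have at: "c \<in> charts_at M q" if "q \<in> fst c" for q using that cc(1) charts_at_iff by simp
  note cong = chart_deriv_cong[OF cc(2) cc(4) subset_refl cc(3)]
  show sym: "metric_deriv c p u v w = metric_deriv c p u w v" for v w
    using cong[of "metric_coeff M c v w" "metric_coeff M c w v"] metric_coeff_commute[OF at] by simp
  show "linear (\<lambda>u. metric_deriv c p u v w)" using linear_chart_deriv[OF cc(2,3) D] .
  show lin: "linear (\<lambda>v. metric_deriv c p u v w)" for w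
  proof (rule linearI)
    fix x y
    have "metric_coeff M c (x + y) w q = metric_coeff M c x w q + metric_coeff M c y w q" if "q \<in> fst c" for q
      using linear_add[OF linear_metric_coeff(1)[OF at[OF that]]] .
    then show "metric_deriv c p u (x + y) w = metric_deriv c p u x w + metric_deriv c p u y w"
      using cong[of "metric_coeff M c (x + y) w" "\<lambda>q. metric_coeff M c x w q + metric_coeff M c y w q"]
        chart_deriv_add(1)[OF cc(2,3) D D] by simp
  next
    fix r x
    have "metric_coeff M c (r *\<^sub>R x) w q = r *\<^sub>R metric_coeff M c x w q" if "q \<in> fst c" for q
      using linear_scale[OF linear_metric_coeff(1)[OF at[OF that]]] .
    then show "metric_deriv c p u (r *\<^sub>R x) w = r *\<^sub>R metric_deriv c p u x w"
      using cong[of "metric_coeff M c (r *\<^sub>R x) w" "\<lambda>q. r *\<^sub>R metric_coeff M c x w q"]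
        chart_deriv_add(2)[OF cc(2,3) D D] by simp
  qed
  show "linear (\<lambda>w. metric_deriv c p u v w)" unfolding sym[of v] by (rule lin)
qed

text \<open>The property by which \<open>christoffel\<close> is defined.\<close>

definition is_levi_civita_form where
  "is_levi_civita_form c p \<Gamma> \<longleftrightarrow> bilinear \<Gamma> \<and> (\<forall>u v. \<Gamma> u v = \<Gamma> v u) \<and>
    (\<forall>u v w. metric_deriv c p u v w = metric_coeff M c (\<Gamma> u v) w p + metric_coeff M c v (\<Gamma> u w) p)"

text \<open>Koszul's formula: in this combination of three instances of metric compatibility the symmetry of
  \<open>\<Gamma>\<close> leaves a single term.\<close>

lemma koszul:
  assumes c: "c \<in> charts_at M p" and \<Gamma>: "is_levi_civita_form c p \<Gamma>"
  shows "2 * metric_coeff M c (\<Gamma> u v) w p = metric_deriv c p u v w + metric_deriv c p v u w - metric_deriv c p w u v"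
proof -
  have sym: "\<Gamma> u v = \<Gamma> v u" for u v
    using \<Gamma> unfolding is_levi_civita_form_def by (elim conjE) metis
  have comp: "metric_deriv c p u v w = metric_coeff M c (\<Gamma> u v) w p + metric_coeff M c v (\<Gamma> u w) p" for u v w
    using \<Gamma> unfolding is_levi_civita_form_def by (elim conjE) metis
  note com = metric_coeff_commute[OF c]
  show ?thesis
    using comp[where u = u and v = v and w = w] comp[where u = v and v = u and w = w]
      comp[where u = w and v = u and w = v] com[where v = "\<Gamma> u w" and w = v]
    unfolding sym[of v u] sym[of w u] sym[of w v] by linarith
qed

text \<open>Koszul's formula read as a definition; linearity and symmetry follow from those of its right-hand
  side because the metric is nondegenerate.\<close>

lemma ex_levi_civita_form:
  assumes c: "c \<in> charts_at M p"
  shows "\<exists>\<Gamma>. is_levi_civita_form c p \<Gamma>"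
proof -
  note D = metric_deriv_facts[OF c] and B = linear_metric_coeff[OF c] and eqI = metric_coeff_eqI[OF c]
  let ?D = "metric_deriv c p" and ?B = "\<lambda>v w. metric_coeff M c v w p"
  let ?\<phi> = "\<lambda>u v w. (1 / 2) *\<^sub>R (?D u v w + ?D v u w - ?D w u v)"
  define \<Gamma> where "\<Gamma> u v = (SOME x. \<forall>w. ?B x w = ?\<phi> u v w)" for u v
  have \<Gamma>: "?B (\<Gamma> u v) w = ?\<phi> u v w" for u v w
  proof -
    have "linear (?\<phi> u v)"
      using D by (intro linear_compose_scale_right linear_compose_sub linear_compose_add)
    then have "\<exists>x. \<forall>w. ?B x w = ?\<phi> u v w"
    proof (rule metric_coeff_riesz[OF c])
      fix x assume x: "\<And>w. ?B x w = ?\<phi> u v w"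
      show ?thesis by (intro exI[of _ x] allI x)
    qed
    from someI_ex[OF this] show ?thesis unfolding \<Gamma>_def by (rule spec)
  qed
  have sym: "\<Gamma> u v = \<Gamma> v u" for u v
  proof (rule eqI)
    show "?B (\<Gamma> u v) w = ?B (\<Gamma> v u) w" for w unfolding \<Gamma> using D(4)[where u = w and v = u and w = v] by simp
  qed
  have lin: "linear (\<Gamma> u)" for u
  proof (rule linearI)
    fix x y
    show "\<Gamma> u (x + y) = \<Gamma> u x + \<Gamma> u y"
    proof (rule eqI)
      fix w
      show "?B (\<Gamma> u (x + y)) w = ?B (\<Gamma> u x + \<Gamma> u y) w"
        unfolding linear_add[OF B(1)] \<Gamma>
        unfolding linear_add[OF D(2)[where u = u and w = w]] linear_add[OF D(1)[where v = u and w = w]]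
          linear_add[OF D(3)[where u = w and v = u]]
        by (simp add: algebra_simps)
    qed
  next
    fix r x
    show "\<Gamma> u (r *\<^sub>R x) = r *\<^sub>R \<Gamma> u x"
    proof (rule eqI)
      fix w
      show "?B (\<Gamma> u (r *\<^sub>R x)) w = ?B (r *\<^sub>R \<Gamma> u x) w"
        unfolding linear_scale[OF B(1)] \<Gamma>
        unfolding linear_scale[OF D(2)[where u = u and w = w]] linear_scale[OF D(1)[where v = u and w = w]]
          linear_scale[OF D(3)[where u = w and v = u]]
        by (simp add: algebra_simps)
    qed
  qed
  have "linear (\<lambda>u. \<Gamma> u v)" for v unfolding sym[of _ v] by (rule lin)
  then have "bilinear \<Gamma>" unfolding bilinear_def using lin by (intro conjI allI)
  moreover have "?D u v w = ?B (\<Gamma> u v) w + ?B v (\<Gamma> u w)" for u v w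
    unfolding metric_coeff_commute[OF c, of v "\<Gamma> u w"] \<Gamma> using D(4)[where u = u and v = v and w = w] D(4)[where u = v and v = u and w = w] D(4)[where u = w and v = u and w = v]
    by (simp add: field_simps)
  ultimately have "is_levi_civita_form c p \<Gamma>"
    unfolding is_levi_civita_form_def by (intro conjI allI sym)
  then show ?thesis by (rule exI[where x = \<Gamma>])
qed

lemma levi_civita_form_unique:
  assumes c: "c \<in> charts_at M p" and "is_levi_civita_form c p \<Gamma>" "is_levi_civita_form c p \<Gamma>'"
  shows "\<Gamma> = \<Gamma>'"
proof (intro ext)
  fix u v
  show "\<Gamma> u v = \<Gamma>' u v"
  proof (rule metric_coeff_eqI[OF c])
    fix w
    show "metric_coeff M c (\<Gamma> u v) w p = metric_coeff M c (\<Gamma>' u v) w p"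
      using koszul[OF c assms(2), of u v w] koszul[OF c assms(3), of u v w] by simp
  qed
qed

lemma christoffel_eqI:
  assumes c: "c \<in> charts_at M p" and "is_levi_civita_form c p \<Gamma>"
  shows "christoffel M c p = \<Gamma>"
  unfolding christoffel_def is_levi_civita_form_def[symmetric]
proof (rule the_equality)
  show "is_levi_civita_form c p \<Gamma>" by (rule assms(2))
  show "\<Gamma>' = \<Gamma>" if "is_levi_civita_form c p \<Gamma>'" for \<Gamma>'
    by (rule levi_civita_form_unique[OF c that assms(2)])
qed

lemma christoffel_form:
  assumes c: "c \<in> charts_at M p"
  shows "is_levi_civita_form c p (christoffel M c p)"
proof -
  obtain \<Gamma> where \<Gamma>: "is_levi_civita_form c p \<Gamma>" using ex_levi_civita_form[OF c] by (rule exE)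
  show ?thesis unfolding christoffel_eqI[OF c \<Gamma>] by (rule \<Gamma>)
qed

lemma christoffel_facts:
  assumes c: "c \<in> charts_at M p"
  shows "bilinear (christoffel M c p)" "christoffel M c p u v = christoffel M c p v u"
    "metric_deriv c p u v w =
      metric_coeff M c (christoffel M c p u v) w p + metric_coeff M c v (christoffel M c p u w) p"
  using christoffel_form[OF c] unfolding is_levi_civita_form_def by (elim conjE, simp)+

end

section \<open>Change of charts and the pullback connection\<close>

context smooth_mfd
begin

lemma coord_vector_trans:
  assumes "c \<in> charts_at M p" "c' \<in> charts_at M p"
  shows "coord_vector M c' p (trans c c' p w) = coord_vector M c p w"
proof -
  have "coord_vector M c' p (coord_vector M c p w c') = coord_vector M c p w"
    by (rule tangent_coord_vector[OF assms(2) coord_vector_tangent[OF assms(1)]])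
  then show ?thesis unfolding coord_vector_apply[OF assms(2)] .
qed

abbreviation trans2 where "trans2 c c' p u v \<equiv> chart_deriv c (\<lambda>q. trans c c' q v) p u"

lemma trans2_facts:
  assumes c: "c \<in> charts_at M p" and c': "c' \<in> charts_at M p"
  shows "has_chart_deriv c (\<lambda>q. trans c c' q v) p (\<lambda>u. trans2 c c' p u v)"
    and "trans2 c c' p u v = trans2 c c' p v u"
    and "linear (\<lambda>u. trans2 c c' p u v)" and "linear (\<lambda>v. trans2 c c' p u v)"
proof -
  note D = transition_smooth(2)[OF c c'] and cc = charts_atD(2,3)[OF c]
  show "has_chart_deriv c (\<lambda>q. trans c c' q v) p (\<lambda>u. trans2 c c' p u v)"
    by (rule has_chart_deriv_chart_deriv[OF cc D])
  show lin: "linear (\<lambda>u. trans2 c c' p u v)" for v by (rule linear_chart_deriv[OF cc D])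
  show sym: "trans2 c c' p u v = trans2 c c' p v u" for u v by (rule transition_smooth(3)[OF c c'])
  have "(\<lambda>v. trans2 c c' p u v) = (\<lambda>v. trans2 c c' p v u)" by (intro ext sym)
  then show "linear (\<lambda>v. trans2 c c' p u v)" using lin[of u] by simp
qed

end

locale riem_map = smooth_mfd_map M N f + N: oriented_riem N
  for M :: "('a, 'n::finite) riem_mfd" and N :: "('b, 'm::finite) riem_mfd" and f
begin

text \<open>The product rule for the metric evaluated on two moving vectors at a moving point.\<close>

lemma metric_coeff_along:
  assumes c: "c \<in> charts_at M p" and c': "c' \<in> charts_at N (f p)"
    and s: "has_chart_deriv c s p s'" and t: "has_chart_deriv c t p t'"
  shows "has_chart_deriv c (\<lambda>q. metric_coeff N c' (s q) (t q) (f q)) p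
    (\<lambda>u. N.metric_deriv c' (f p) (chart_deriv c (snd c' \<circ> f) p u) (s p) (t p)
      + metric_coeff N c' (s p) (t' u) (f p) + metric_coeff N c' (s' u) (t p) (f p))"
proof -
  let ?J = "chart_deriv c (snd c' \<circ> f) p"
  note ch = M.charts_atD(2)[OF c] and U = dom_facts[OF c c'] and c'N = N.charts_atD[OF c']
  have at: "c' \<in> charts_at N (f q)" if "q \<in> dom c c'" for q using that c'N(1) N.charts_at_iff by simp
  have base: "has_chart_deriv c (\<lambda>q. metric_coeff N c' v w (f q)) p (\<lambda>u. N.metric_deriv c' (f p) (?J u) v w)" for v w
    using chain_rule[OF c c' has_chart_deriv_chart_deriv[OF c'N(2,3) N.metric_smooth[OF c']]] by (simp add: comp_def)
  have inner: "has_chart_deriv c (\<lambda>q. metric_coeff N c' v (t q) (f q)) p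
      (\<lambda>u. N.metric_deriv c' (f p) (?J u) v (t p) + metric_coeff N c' v (t' u) (f p))" for v
    by (rule has_chart_deriv_application[OF ch U t base N.linear_metric_coeff(2)[OF at]])
  show ?thesis
    by (rule has_chart_deriv_application[OF ch U s inner N.linear_metric_coeff(1)[OF at]])
qed

end

context oriented_riem
begin

lemma riem_id_map: "riem_map M M id"
  using id_map riem by (simp add: riem_map_def oriented_riem_def)

text \<open>The right-hand side, rewritten in the components of the second chart, is again symmetric, by the
  symmetry of second derivatives, and compatible with the metric, by differentiating the relation
  between the metric coefficients in the two charts.  Uniqueness then identifies it.\<close>

lemma christoffel_transform:
  assumes c: "c \<in> charts_at M p" and c': "c' \<in> charts_at M p"
  shows "christoffel M c' p (trans c c' p u) (trans c c' p v) =
    trans c c' p (christoffel M c p u v) - trans2 c c' p u v"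
proof -
  interpret I: riem_map M M id by (rule riem_id_map)
  have c'_id: "c' \<in> charts_at M (id p)" using c' by simp
  note cc = charts_atD[OF c] and cc' = charts_atD[OF c']
  let ?T = "trans c c' p" and ?S = "trans c' c p" and ?H = "trans2 c c' p"
  let ?G = "christoffel M c p" and ?m = "\<lambda>x y. metric_coeff M c' x y p"
  note T = linear_trans[OF c c'] and S = linear_trans[OF c' c] and H = trans2_facts[OF c c']
  note G = christoffel_facts[OF c] and TS = trans_inverse[OF c' c] and ST = trans_inverse[OF c c']
  note B = linear_metric_coeff[OF c']
  have bilG1: "linear (?G u)" for u using G(1) unfolding bilinear_def by (elim conjE) (rule spec)
  have bilG2: "linear (\<lambda>u. ?G u v)" for v using G(1) unfolding bilinear_def by (elim conjE) (rule spec)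
  let ?K = "\<lambda>u v. ?T (?G (?S u) (?S v)) - ?H (?S u) (?S v)"
  have "is_levi_civita_form c' p ?K"
    unfolding is_levi_civita_form_def bilinear_def
  proof (intro conjI allI)
    show "linear (\<lambda>v. ?K u v)" for u
      using linear_compose[OF linear_compose[OF S bilG1] T] linear_compose[OF S H(4)]
      unfolding comp_def by (rule linear_compose_sub)
    show "linear (\<lambda>u. ?K u v)" for v
      using linear_compose[OF linear_compose[OF S bilG2] T] linear_compose[OF S H(3)]
      unfolding comp_def by (rule linear_compose_sub)
    show "?K u v = ?K v u" for u v unfolding G(2)[of "?S u" "?S v"] H(2)[of "?S u" "?S v"] ..
    fix u v w
    let ?u = "?S u" and ?v = "?S v" and ?w = "?S w"
    let ?W = "fst c \<inter> fst c'"
    have W: "openin (mfd_top M) ?W" "?W \<subseteq> fst c" "p \<in> ?W" using cc cc' by (auto intro: openin_Int)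
    have same: "metric_coeff M c ?v ?w q = metric_coeff M c' (trans c c' q ?v) (trans c c' q ?w) q" if "q \<in> ?W" for q
    proof -
      have "c \<in> charts_at M q" "c' \<in> charts_at M q" using that cc(1) cc'(1) charts_at_iff by auto
      then show ?thesis unfolding metric_coeff_def by (simp add: coord_vector_trans)
    qed
    have "has_chart_deriv c (\<lambda>q. metric_coeff M c' (trans c c' q ?v) (trans c c' q ?w) q) p
        (\<lambda>u. metric_deriv c' p (?T u) (?T ?v) (?T ?w) + ?m (?T ?v) (?H u ?w) + ?m (?H u ?v) (?T ?w))"
      using I.metric_coeff_along[OF c c'_id H(1)[of ?v] H(1)[of ?w]] by simp
    then have "has_chart_deriv c (metric_coeff M c ?v ?w) p
        (\<lambda>u. metric_deriv c' p (?T u) (?T ?v) (?T ?w) + ?m (?T ?v) (?H u ?w) + ?m (?H u ?v) (?T ?w))"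
      using has_chart_deriv_cong[OF cc(2) W same] by simp
    from chart_deriv_eqI[OF cc(2,3) this]
    have "metric_deriv c p ?u ?v ?w = metric_deriv c' p u v w + ?m v (?H ?u ?w) + ?m (?H ?u ?v) w"
      by (simp add: TS)
    moreover have "metric_deriv c p ?u ?v ?w = ?m (?T (?G ?u ?v)) w + ?m v (?T (?G ?u ?w))"
    proof -
      have m: "metric_coeff M c x y p = ?m (?T x) (?T y)" for x y
        unfolding metric_coeff_def by (simp add: coord_vector_trans[OF c c'])
      show ?thesis unfolding G(3) m TS ..
    qed
    ultimately show "metric_deriv c' p u v w = ?m (?K u v) w + ?m v (?K u w)"
      unfolding linear_diff[OF B(1)] linear_diff[OF B(2)] by simp
  qed
  from christoffel_eqI[OF c' this] show ?thesis by (simp add: ST)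
qed

end

context riem_map
begin

text \<open>A section of \<open>f\<^sup>*TN\<close> near \<open>p\<close> that is differentiable at \<open>p\<close>.  For \<open>f = id\<close> these are the vector
  fields differentiable at \<open>p\<close>.\<close>

definition diff_section where
  "diff_section s p \<longleftrightarrow> (\<exists>U. openin (mfd_top M) U \<and> p \<in> U \<and> (\<forall>q\<in>U. s q \<in> tangent_space N (f q))) \<and>
    (\<exists>c\<in>charts_at M p. \<exists>c'\<in>charts_at N (f p). chart_differentiable c (\<lambda>q. s q c') p)"

text \<open>The second derivative of the coordinate change that appears here is the one that the Christoffel
  forms produce with the opposite sign.\<close>

lemma section_change_chart:
  assumes U: "openin (mfd_top M) U" "p \<in> U" "\<forall>q\<in>U. s q \<in> tangent_space N (f q)"
    and c: "c \<in> charts_at M p" and c': "c' \<in> charts_at N (f p)" and c'': "c'' \<in> charts_at N (f p)"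
    and s: "has_chart_deriv c (\<lambda>q. s q c') p s'"
  shows "has_chart_deriv c (\<lambda>q. s q c'') p
    (\<lambda>u. N.trans2 c' c'' (f p) (chart_deriv c (snd c' \<circ> f) p u) (s p c') + N.trans c' c'' (f p) (s' u))"
proof -
  let ?W = "U \<inter> (dom c c' \<inter> dom c c'')"
  note d' = dom_facts[OF c c'] and d'' = dom_facts[OF c c''] and ch = M.charts_atD(2)[OF c]
  have W: "openin (mfd_top M) ?W" by (intro openin_Int U(1) d'(1) d''(1))
  have sub: "?W \<subseteq> fst c" using d'(2) by auto
  have pW: "p \<in> ?W" using U(2) d'(3) d''(3) by simp
  have at: "c' \<in> charts_at N (f q)" "c'' \<in> charts_at N (f q)" if "q \<in> ?W" for q
    using that N.charts_atD(1)[OF c'] N.charts_atD(1)[OF c''] N.charts_at_iff by auto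
  have K: "has_chart_deriv c (\<lambda>q. N.trans c' c'' (f q) w) p
      (\<lambda>u. N.trans2 c' c'' (f p) (chart_deriv c (snd c' \<circ> f) p u) w)" for w
    using chain_rule[OF c c' N.trans2_facts(1)[OF c' c'', of w]] by (simp add: comp_def)
  have D: "has_chart_deriv c (\<lambda>q. N.trans c' c'' (f q) (s q c')) p
      (\<lambda>u. N.trans2 c' c'' (f p) (chart_deriv c (snd c' \<circ> f) p u) (s p c') + N.trans c' c'' (f p) (s' u))"
    by (rule has_chart_deriv_application[OF ch W sub pW s K N.linear_trans[OF at]])
  have eq: "s q c'' = N.trans c' c'' (f q) (s q c')" if "q \<in> ?W" for q
  proof -
    have "q \<in> U" using that by simp
    from N.tangent_spaceD(1)[OF bspec[OF U(3) this] at[OF that]] show ?thesis by (rule sym)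
  qed
  show ?thesis using has_chart_deriv_cong[OF ch W sub pW eq] D by simp
qed

lemma diff_section_open:
  assumes "diff_section s p"
  obtains U where "openin (mfd_top M) U" "p \<in> U" "\<forall>q\<in>U. s q \<in> tangent_space N (f q)"
proof -
  have "\<exists>U. openin (mfd_top M) U \<and> p \<in> U \<and> (\<forall>q\<in>U. s q \<in> tangent_space N (f q))"
    using assms unfolding diff_section_def by (rule conjunct1)
  then obtain U where "openin (mfd_top M) U" "p \<in> U" "\<forall>q\<in>U. s q \<in> tangent_space N (f q)"
    by (elim exE conjE)
  then show ?thesis by (rule that)
qed

lemma diff_section_tangent:
  assumes "diff_section s p"
  shows "s p \<in> tangent_space N (f p)"
proof -
  obtain U where "p \<in> U" "\<forall>q\<in>U. s q \<in> tangent_space N (f q)" by (rule diff_section_open[OF assms])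
  then show ?thesis by simp
qed

lemma diff_section_components:
  assumes s: "diff_section s p" and c: "c \<in> charts_at M p" and c': "c' \<in> charts_at N (f p)"
  shows "chart_differentiable c (\<lambda>q. s q c') p"
proof -
  obtain U where U: "openin (mfd_top M) U" "p \<in> U" "\<forall>q\<in>U. s q \<in> tangent_space N (f q)"
    by (rule diff_section_open[OF s])
  obtain b b' where b: "b \<in> charts_at M p" "b' \<in> charts_at N (f p)" "chart_differentiable b (\<lambda>q. s q b') p"
    using s unfolding diff_section_def by (elim conjE bexE) (rule that)
  have "chart_differentiable c (\<lambda>q. s q b') p" by (rule M.change_chart(1)[OF c b(1,3)])
  from section_change_chart[OF U c b(2) c' has_chart_deriv_chart_deriv[OF M.charts_atD(2,3)[OF c] this]]
  show ?thesis by (rule chart_differentiableI)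
qed

lemma pullback_connection_apply:
  assumes s: "diff_section s p" and u: "u \<in> tangent_space M p" and c: "c \<in> charts_at M p" and c': "c' \<in> charts_at N (f p)"
  shows "pullback_connection M N f s p u c' = chart_deriv c (\<lambda>q. s q c') p (u c)
    + christoffel N c' (f p) (chart_deriv c (snd c' \<circ> f) p (u c)) (s p c')"
  unfolding pullback_connection_def
  using c' M.tangent_deriv_chart[OF c u diff_section_components[OF s c c']] differential_apply[OF c c' u] by simp

text \<open>The components of the covariant derivative in different charts fit together.  This is needed
  before the metric can be applied to it at all, since the metric is meaningful only on tangent vectors.\<close>

lemma pullback_connection_tangent:
  assumes s: "diff_section s p" and u: "u \<in> tangent_space M p" and p: "p \<in> points M"
  shows "pullback_connection M N f s p u \<in> tangent_space N (f p)"
proof (rule N.tangent_spaceI)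
  fix c' c'' assume c': "c' \<in> charts_at N (f p)" and c'': "c'' \<in> charts_at N (f p)"
  obtain c where c: "c \<in> charts_at M p" using p by (rule M.ex_chart)
  obtain U where U: "openin (mfd_top M) U" "p \<in> U" "\<forall>q\<in>U. s q \<in> tangent_space N (f q)"
    by (rule diff_section_open[OF s])
  note ch = M.charts_atD(2,3)[OF c]
  let ?T = "N.trans c' c'' (f p)" and ?J = "chart_deriv c (snd c' \<circ> f) p (u c)"
  have "chart_deriv c (\<lambda>q. s q c'') p (u c) = N.trans2 c' c'' (f p) ?J (s p c') + ?T (chart_deriv c (\<lambda>q. s q c') p (u c))"
    using chart_deriv_eqI[OF ch section_change_chart[OF U c c' c''
        has_chart_deriv_chart_deriv[OF ch diff_section_components[OF s c c']]]] by simp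
  moreover have "chart_deriv c (snd c'' \<circ> f) p (u c) = ?T ?J"
    by (rule chain_rule_deriv(2)[OF c c' N.transition_smooth(1)[OF c' c'']])
  moreover have "s p c'' = ?T (s p c')"
    using N.tangent_spaceD(1)[OF diff_section_tangent[OF s] c' c''] by simp
  ultimately show "pullback_connection M N f s p u c'' = ?T (pullback_connection M N f s p u c')"
    unfolding pullback_connection_apply[OF s u c c'] pullback_connection_apply[OF s u c c'']
    by (simp add: N.christoffel_transform[OF c' c''] linear_add[OF N.linear_trans[OF c' c'']])
next
  show "pullback_connection M N f s p u c' = 0" if "c' \<notin> charts_at N (f p)" for c'
    using that by (simp add: pullback_connection_def)
qed

text \<open>In a chart the derivative of the metric is compensated by the Christoffel terms.\<close>

theorem pullback_connection_metric:
  assumes s: "diff_section s p" and t: "diff_section t p" and c: "c \<in> charts_at M p"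
  shows "chart_differentiable c (\<lambda>q. riem_metric N (f q) (s q) (t q)) p"
    and "u \<in> tangent_space M p \<Longrightarrow> tangent_deriv M (\<lambda>q. riem_metric N (f q) (s q) (t q)) p u =
      riem_metric N (f p) (pullback_connection M N f s p u) (t p) +
      riem_metric N (f p) (s p) (pullback_connection M N f t p u)"
proof -
  note ch = M.charts_atD[OF c]
  obtain c' where c': "c' \<in> charts_at N (f p)" using map_points[OF ch(5)] by (rule N.ex_chart)
  obtain U where U: "openin (mfd_top M) U" "p \<in> U" "\<forall>q\<in>U. s q \<in> tangent_space N (f q)"
    by (rule diff_section_open[OF s])
  obtain V where V: "openin (mfd_top M) V" "p \<in> V" "\<forall>q\<in>V. t q \<in> tangent_space N (f q)"
    by (rule diff_section_open[OF t])
  let ?W = "U \<inter> (V \<inter> dom c c')"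
  note d = dom_facts[OF c c']
  have W: "openin (mfd_top M) ?W" by (intro openin_Int U(1) V(1) d(1))
  have sub: "?W \<subseteq> fst c" using d(2) by auto
  have pW: "p \<in> ?W" using U(2) V(2) d(3) by simp
  have eq: "riem_metric N (f q) (s q) (t q) = metric_coeff N c' (s q c') (t q c') (f q)" if "q \<in> ?W" for q
  proof -
    have q: "q \<in> U" "q \<in> V" "c' \<in> charts_at N (f q)" using that N.charts_atD(1)[OF c'] N.charts_at_iff by auto
    show ?thesis by (rule N.metric_coeff_tangent[OF q(3) bspec[OF U(3) q(1)] bspec[OF V(3) q(2)], symmetric])
  qed
  let ?s = "chart_deriv c (\<lambda>q. s q c') p" and ?t = "chart_deriv c (\<lambda>q. t q c') p" and ?J = "chart_deriv c (snd c' \<circ> f) p"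
  note Ds = has_chart_deriv_chart_deriv[OF ch(2,3) diff_section_components[OF s c c']]
    and Dt = has_chart_deriv_chart_deriv[OF ch(2,3) diff_section_components[OF t c c']]
  have D: "has_chart_deriv c (\<lambda>q. riem_metric N (f q) (s q) (t q)) p
      (\<lambda>u. N.metric_deriv c' (f p) (?J u) (s p c') (t p c')
        + metric_coeff N c' (s p c') (?t u) (f p) + metric_coeff N c' (?s u) (t p c') (f p))"
    using has_chart_deriv_cong[OF ch(2) W sub pW eq] metric_coeff_along[OF c c' Ds Dt] by simp
  then show diff: "chart_differentiable c (\<lambda>q. riem_metric N (f q) (s q) (t q)) p"
    by (rule chart_differentiableI)
  assume u: "u \<in> tangent_space M p"
  note m = N.metric_coeff_tangent[OF c', symmetric] and B = N.linear_metric_coeff[OF c']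
    and sT = diff_section_tangent[OF s] and tT = diff_section_tangent[OF t]
    and cs = pullback_connection_tangent[OF s u ch(5)] and ct = pullback_connection_tangent[OF t u ch(5)]
  have "tangent_deriv M (\<lambda>q. riem_metric N (f q) (s q) (t q)) p u =
      N.metric_deriv c' (f p) (?J (u c)) (s p c') (t p c')
        + metric_coeff N c' (s p c') (?t (u c)) (f p) + metric_coeff N c' (?s (u c)) (t p c') (f p)"
    unfolding M.tangent_deriv_chart[OF c u diff] chart_deriv_eqI[OF ch(2,3) D] ..
  also have "\<dots> = metric_coeff N c' (pullback_connection M N f s p u c') (t p c') (f p)
      + metric_coeff N c' (s p c') (pullback_connection M N f t p u c') (f p)"
    unfolding pullback_connection_apply[OF s u c c'] pullback_connection_apply[OF t u c c']
      N.christoffel_facts(3)[OF c'] linear_add[OF B(1)] linear_add[OF B(2)] by simp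
  also have "\<dots> = riem_metric N (f p) (pullback_connection M N f s p u) (t p) +
      riem_metric N (f p) (s p) (pullback_connection M N f t p u)"
    unfolding m[OF cs tT] m[OF sT ct] ..
  finally show "tangent_deriv M (\<lambda>q. riem_metric N (f q) (s q) (t q)) p u =
      riem_metric N (f p) (pullback_connection M N f s p u) (t p) +
      riem_metric N (f p) (s p) (pullback_connection M N f t p u)" .
qed

end

text \<open>Hence every statement about the pullback connection specialises to the Levi-Civita connection.\<close>

lemma (in smooth_mfd) levi_civita_pullback:
  assumes "p \<in> points M" "u \<in> tangent_space M p"
  shows "levi_civita M Y p u = pullback_connection M M id Y p u"
  unfolding levi_civita_def pullback_connection_def differential_id[OF assms] id_apply ..

section \<open>Differentiability of the cofactor and the divergence of the Piola transform\<close>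

lemma chart_differentiable_iff:
  "chart_differentiable c h p \<longleftrightarrow> (\<lambda>x. h (chart_inv c x)) differentiable (at (snd c p) within chart_image c)"
  unfolding chart_differentiable_def differentiable_def comp_def ..

lemma differentiable_product:
  fixes g :: "'i \<Rightarrow> 'x::real_normed_vector \<Rightarrow> real"
  assumes "finite I" "\<And>i. i \<in> I \<Longrightarrow> g i differentiable (at x within S)"
  shows "(\<lambda>x. \<Prod>i\<in>I. g i x) differentiable (at x within S)"
  using assms
proof (induction I rule: finite_induct)
  case empty
  show ?case by (simp add: differentiable_const)
next
  case (insert i I)
  have "(\<lambda>x. g i x * (\<Prod>i\<in>I. g i x)) differentiable (at x within S)"
  proof (rule differentiable_mult)
    show "g i differentiable (at x within S)" by (rule insert.prems) simp
    show "(\<lambda>x. \<Prod>i\<in>I. g i x) differentiable (at x within S)" by (rule insert.IH) (rule insert.prems, simp)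
  qed
  then show ?case using insert.hyps by simp
qed

lemma chart_differentiable_sum_signed_products:
  fixes g :: "'i \<Rightarrow> 'i \<Rightarrow> 'a \<Rightarrow> real"
  assumes "finite I" "\<And>i j. i \<in> I \<Longrightarrow> j \<in> I \<Longrightarrow> chart_differentiable c (g i j) p"
  shows "chart_differentiable c (\<lambda>q. \<Sum>\<sigma> | \<sigma> permutes I. of_int (sign \<sigma>) * (\<Prod>i\<in>I. g i (\<sigma> i) q)) p"
  unfolding chart_differentiable_iff
proof (intro differentiable_sum ballI differentiable_mult differentiable_const differentiable_product)
  show "finite {\<sigma>. \<sigma> permutes I}" using assms(1) by (rule finite_permutations)
  fix \<sigma> i assume "\<sigma> \<in> {\<sigma>. \<sigma> permutes I}" and i: "i \<in> I"
  then have "\<sigma> i \<in> I" using permutes_in_image[of \<sigma> I i] by simp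
  from assms(2)[OF i this]
  show "(\<lambda>x. g i (\<sigma> i) (chart_inv c x)) differentiable at (snd c p) within chart_image c"
    unfolding chart_differentiable_iff .
qed (rule assms(1))

lemma chart_differentiable_fdet:
  assumes "\<And>i j. i < k \<Longrightarrow> j < k \<Longrightarrow> chart_differentiable c (\<lambda>q. F q i j) p"
  shows "chart_differentiable c (\<lambda>q. fdet k (F q)) p"
  unfolding fdet_permutations
  by (rule chart_differentiable_sum_signed_products) (use assms in auto)

lemma chart_differentiable_matrix_det:
  fixes G :: "'a \<Rightarrow> real ^ 'k ^ 'k"
  assumes "\<And>i j. chart_differentiable c (\<lambda>q. G q $ i $ j) p"
  shows "chart_differentiable c (\<lambda>q. Determinants.det (G q)) p"
  unfolding Determinants.det_def
  by (rule chart_differentiable_sum_signed_products) (use assms in auto)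

lemma linear_axis_representation:
  fixes \<phi> :: "real ^ 'k \<Rightarrow> real"
  assumes "linear \<phi>"
  shows "(\<Sum>j\<in>UNIV. \<phi> (axis j 1) * x $ j) = \<phi> x"
proof -
  have "\<phi> (\<Sum>j\<in>UNIV. x $ j *\<^sub>R axis j 1) = (\<Sum>j\<in>UNIV. x $ j *\<^sub>R \<phi> (axis j 1))"
    by (simp only: linear_sum[OF assms] linear_scale[OF assms])
  moreover have "(\<Sum>j\<in>UNIV. x $ j *\<^sub>R axis j 1) = x"
    using basis_expansion[of x] by (simp only: scalar_mult_eq_scaleR)
  ultimately show ?thesis by (simp add: mult.commute)
qed

context riem_map
begin

lemma diff_sectionI:
  assumes "openin (mfd_top M) U" "p \<in> U" "\<forall>q\<in>U. s q \<in> tangent_space N (f q)"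
    and "c \<in> charts_at M p" "c' \<in> charts_at N (f p)" "chart_differentiable c (\<lambda>q. s q c') p"
  shows "diff_section s p"
  unfolding diff_section_def
proof
  show "\<exists>U. openin (mfd_top M) U \<and> p \<in> U \<and> (\<forall>q\<in>U. s q \<in> tangent_space N (f q))"
    by (rule exI[where x = U]) (intro conjI assms(1-3))
  have "\<exists>c'\<in>charts_at N (f p). chart_differentiable c (\<lambda>q. s q c') p"
    by (rule bexI[where x = c']) (rule assms)+
  then show "\<exists>c\<in>charts_at M p. \<exists>c'\<in>charts_at N (f p). chart_differentiable c (\<lambda>q. s q c') p"
    using assms(4) by (rule bexI[where x = c])
qed

text \<open>The components solve a linear system whose matrix is the Gram matrix of a chart; by Cramer's rule
  they are quotients of determinants with differentiable entries.\<close>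

lemma diff_section_from_pairings:
  assumes c: "c \<in> charts_at M p" and c': "c' \<in> charts_at N (f p)"
    and U: "openin (mfd_top M) U" "p \<in> U" "\<forall>q\<in>U. s q \<in> tangent_space N (f q)"
    and pair: "\<And>w. chart_differentiable c (\<lambda>q. riem_metric N (f q) (s q) (coord_vector N c' (f q) w)) p"
  shows "diff_section s p"
proof -
  let ?W = "U \<inter> dom c c'"
  note d = dom_facts[OF c c'] and ch = M.charts_atD[OF c] and ch' = N.charts_atD[OF c']
  have W: "openin (mfd_top M) ?W" by (intro openin_Int U(1) d(1))
  have sub: "?W \<subseteq> fst c" using d(2) by auto
  have pW: "p \<in> ?W" using U(2) d(3) by simp
  have at: "c' \<in> charts_at N (f q)" if "q \<in> ?W" for q using that ch'(1) N.charts_at_iff by simp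
  define G :: "'a \<Rightarrow> real ^ 'm ^ 'm" where "G q = (\<chi> i j. metric_coeff N c' (axis j 1) (axis i 1) (f q))" for q
  define h :: "'a \<Rightarrow> real ^ 'm" where "h q = (\<chi> i. riem_metric N (f q) (s q) (coord_vector N c' (f q) (axis i 1)))" for q
  have G_mult: "(G q *v x) $ i = metric_coeff N c' x (axis i 1) (f q)" if "q \<in> ?W" for q x i
    using linear_axis_representation[OF N.linear_metric_coeff(1)[OF at[OF that]], of "axis i 1" x]
    by (simp add: G_def matrix_vector_mult_def)
  have eq: "G q *v (s q c') = h q" if q: "q \<in> ?W" for q
  proof -
    have sq: "s q \<in> tangent_space N (f q)" using bspec[OF U(3), of q] q by simp
    have "(G q *v (s q c')) $ i = h q $ i" for i
      unfolding G_mult[OF q]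
      using N.metric_coeff_tangent[OF at[OF q] sq N.coord_vector_tangent[OF at[OF q], of "axis i 1"]]
      by (simp add: h_def N.coord_vector_self[OF at[OF q]])
    then show ?thesis by (simp add: Finite_Cartesian_Product.vec_eq_iff)
  qed
  have det: "Determinants.det (G q) \<noteq> 0" if q: "q \<in> ?W" for q
  proof -
    have "x = 0" if x: "G q *v x = 0" for x
    proof (rule N.metric_coeff_eqI[OF at[OF q]])
      fix w
      have "metric_coeff N c' x (axis i 1) (f q) = 0" for i
        using G_mult[OF q, of x i] x by simp
      then have "metric_coeff N c' x w (f q) = 0"
        using linear_axis_representation[OF N.linear_metric_coeff(2)[OF at[OF q]], of x w] by simp
      then show "metric_coeff N c' x w (f q) = metric_coeff N c' 0 w (f q)"
        using linear_0[OF N.linear_metric_coeff(1)[OF at[OF q], of w]] by simp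
    qed
    then have "invertible (G q)" unfolding invertible_left_inverse matrix_left_invertible_ker by (intro allI impI)
    then show ?thesis unfolding invertible_det_nz .
  qed
  have dG: "chart_differentiable c (\<lambda>q. G q $ i $ j) p" for i j
    unfolding G_def using chain_rule_deriv(1)[OF c c' N.metric_smooth[OF c', of "axis j 1" "axis i 1"]] by (simp add: comp_def)
  have dh: "chart_differentiable c (\<lambda>q. h q $ i) p" for i
    unfolding h_def using pair[of "axis i 1"] by simp
  let ?C = "\<lambda>k q. (\<chi> i j. if j = k then h q $ i else G q $ i $ j) :: real ^ 'm ^ 'm"
  have dC: "chart_differentiable c (\<lambda>q. Determinants.det (?C k q)) p" for k
  proof (rule chart_differentiable_matrix_det)
    show "chart_differentiable c (\<lambda>q. ?C k q $ i $ j) p" for i j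
      using dG[of i j] dh[of i] by (cases "j = k") simp_all
  qed
  have comp: "chart_differentiable c (\<lambda>q. s q c' $ k) p" for k
  proof -
    have "chart_differentiable c (\<lambda>q. Determinants.det (?C k q) / Determinants.det (G q)) p"
      using dC[of k] chart_differentiable_matrix_det[OF dG] det[OF pW] chart_inv_chart[OF ch(2,3)]
      unfolding chart_differentiable_iff by (intro differentiable_divide) simp_all
    moreover have "s q c' $ k = Determinants.det (?C k q) / Determinants.det (G q)" if q: "q \<in> ?W" for q
    proof -
      have "s q c' = (\<chi> k. Determinants.det (?C k q) / Determinants.det (G q))"
        using cramer[OF det[OF q], of "s q c'" "h q"] eq[OF q] by simp
      from arg_cong[OF this, where f = "\<lambda>x. x $ k"] show ?thesis by (simp only: vec_lambda_beta)
    qed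
    ultimately show ?thesis using chart_differentiable_cong[OF ch(2) W sub pW, of "\<lambda>q. s q c' $ k"] by simp
  qed
  have diff: "chart_differentiable c (\<lambda>q. s q c') p"
    unfolding chart_differentiable_iff
  proof (rule iffD2[OF differentiable_componentwise_within], rule ballI)
    fix b :: "real ^ 'm" assume "b \<in> Basis"
    then have "\<exists>k. b = axis k 1" by (auto simp: Basis_vec_def)
    then obtain k where "b = axis k 1" by (rule exE)
    then show "(\<lambda>x. s (chart_inv c x) c' \<bullet> b) differentiable at (snd c p) within chart_image c"
      using comp[of k] unfolding chart_differentiable_iff by (simp add: inner_axis)
  qed
  show ?thesis by (rule diff_sectionI[OF U c c' diff])
qed

lemma coord_vector_section:
  assumes p: "p \<in> points M" and c': "c' \<in> charts_at N (f p)"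
  shows "diff_section (\<lambda>q. coord_vector N c' (f q) w) p"
proof -
  obtain c where c: "c \<in> charts_at M p" using p by (rule M.ex_chart)
  note d = dom_facts[OF c c'] and ch = M.charts_atD[OF c]
  have at: "c' \<in> charts_at N (f q)" if "q \<in> dom c c'" for q
    using that N.charts_atD(1)[OF c'] N.charts_at_iff by simp
  have "has_chart_deriv c (\<lambda>q. w) p (\<lambda>u. 0)" by (simp add: comp_def)
  then have "has_chart_deriv c (\<lambda>q. coord_vector N c' (f q) w c') p (\<lambda>u. 0)"
    using has_chart_deriv_cong[OF ch(2) d, of "\<lambda>q. coord_vector N c' (f q) w c'" "\<lambda>q. w"] N.coord_vector_self[OF at] by simp
  then have diff: "chart_differentiable c (\<lambda>q. coord_vector N c' (f q) w c') p" by (rule chart_differentiableI)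
  have "\<forall>q\<in>dom c c'. coord_vector N c' (f q) w \<in> tangent_space N (f q)"
    using N.coord_vector_tangent[OF at] by simp
  from diff_sectionI[OF d(1,3) this c c' diff] show ?thesis .
qed

text \<open>The covariant derivative of \<open>X \<circ> f\<close> along \<open>u\<close> is that of \<open>X\<close> along \<open>df u\<close>.\<close>

lemma compose_section:
  assumes X: "smooth_vector_field N X" and p: "p \<in> points M"
  shows "diff_section (\<lambda>q. X (f q)) p"
    and "u \<in> tangent_space M p \<Longrightarrow>
      pullback_connection M N f (\<lambda>q. X (f q)) p u = levi_civita N X (f p) (differential M N f p u)"
proof -
  obtain c where c: "c \<in> charts_at M p" using p by (rule M.ex_chart)
  note ch = M.charts_atD[OF c]
  have XT: "X y \<in> tangent_space N y" if "y \<in> points N" for y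
    using X that unfolding smooth_vector_field_def by (elim conjE) (rule bspec)
  have Xd: "chart_differentiable c' (\<lambda>y. X y c') (f p)" if c': "c' \<in> charts_at N (f p)" for c'
  proof -
    note ch' = N.charts_atD[OF c']
    have "smooth_on (snd c' ` fst c') ((\<lambda>y. X y c') \<circ> chart_inv c')"
      using X ch'(1) unfolding smooth_vector_field_def by (elim conjE) (rule bspec)
    from chart_deriv_smooth(1)[OF ch'(2) ch'(4) subset_refl ch'(3) this] show ?thesis .
  qed
  have comp: "chart_differentiable c (\<lambda>q. X (f q) c') p"
    "chart_deriv c (\<lambda>q. X (f q) c') p w = chart_deriv c' (\<lambda>y. X y c') (f p) (chart_deriv c (snd c' \<circ> f) p w)"
    if c': "c' \<in> charts_at N (f p)" for c' w
    using chain_rule_deriv[OF c c' Xd[OF c']] by (simp_all add: comp_def)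
  obtain c' where c': "c' \<in> charts_at N (f p)" using map_points[OF p] by (rule N.ex_chart)
  have sT: "\<forall>q\<in>fst c. X (f q) \<in> tangent_space N (f q)"
  proof
    fix q assume "q \<in> fst c"
    then have "q \<in> points M" using openin_subset[OF ch(4)] by auto
    then show "X (f q) \<in> tangent_space N (f q)" by (intro XT map_points)
  qed
  show s: "diff_section (\<lambda>q. X (f q)) p"
    by (rule diff_sectionI[OF ch(4,3) sT c c' comp(1)[OF c']])
  assume u: "u \<in> tangent_space M p"
  show "pullback_connection M N f (\<lambda>q. X (f q)) p u = levi_civita N X (f p) (differential M N f p u)"
  proof
    fix c''
    show "pullback_connection M N f (\<lambda>q. X (f q)) p u c'' = levi_civita N X (f p) (differential M N f p u) c''"
    proof (cases "c'' \<in> charts_at N (f p)")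
      case True
      have "tangent_deriv M (\<lambda>q. X (f q) c'') p u = chart_deriv c'' (\<lambda>y. X y c'') (f p) (chart_deriv c (snd c'' \<circ> f) p (u c))"
        unfolding M.tangent_deriv_chart[OF c u comp(1)[OF True]] comp(2)[OF True] ..
      also have "\<dots> = tangent_deriv N (\<lambda>y. X y c'') (f p) (differential M N f p u)"
        unfolding N.tangent_deriv_chart[OF True differential_tangent[OF p u] Xd[OF True]] differential_apply[OF c True u] ..
      finally show ?thesis using True by (simp add: pullback_connection_def levi_civita_def)
    next
      case False
      then show ?thesis by (simp add: pullback_connection_def levi_civita_def)
    qed
  qed
qed

end

context oriented_riem
begin

lemma vector_field_section:
  assumes X: "smooth_vector_field M X" and p: "p \<in> points M"
  shows "riem_map.diff_section M M id X p"
proof -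
  interpret I: riem_map M M id by (rule riem_id_map)
  show ?thesis using I.compose_section(1)[OF X p] by simp
qed

lemma levi_civita_linear:
  assumes Y: "riem_map.diff_section M M id Y p" and p: "p \<in> points M"
  shows "linear_between (tangent_space M p) (tangent_space M p) (levi_civita M Y p)"
proof -
  interpret I: riem_map M M id by (rule riem_id_map)
  obtain c where c: "c \<in> charts_at M p" using p by (rule ex_chart)
  have c': "c \<in> charts_at M (id p)" using c by simp
  note sub = subspace_tangent[OF p] and ch = charts_atD[OF c]
  have T: "levi_civita M Y p u \<in> tangent_space M p" if "u \<in> tangent_space M p" for u
    using I.pullback_connection_tangent[OF Y that p] levi_civita_pullback[OF p that] by simp
  have val: "levi_civita M Y p u c = chart_deriv c (\<lambda>q. Y q c) p (u c) + christoffel M c p (u c) (Y p c)"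
    if "u \<in> tangent_space M p" for u
    using I.pullback_connection_apply[OF Y that c c'] levi_civita_pullback[OF p that] trans_self[OF c] by simp
  have D: "linear (chart_deriv c (\<lambda>q. Y q c) p)"
    by (rule linear_chart_deriv[OF ch(2,3) I.diff_section_components[OF Y c c']])
  have G: "linear (\<lambda>u. christoffel M c p u v)" for v
    using christoffel_facts(1)[OF c] unfolding bilinear_def by (elim conjE) (rule spec)
  show ?thesis
    unfolding linear_between_def
  proof (intro conjI ballI allI)
    show "levi_civita M Y p u \<in> tangent_space M p" if "u \<in> tangent_space M p" for u by (rule T[OF that])
  next
    fix u v assume u: "u \<in> tangent_space M p" and v: "v \<in> tangent_space M p"
    have uv: "u + v \<in> tangent_space M p" by (rule subspace_add[OF sub u v])
    show "levi_civita M Y p (u + v) = levi_civita M Y p u + levi_civita M Y p v"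
      by (rule tangent_eqI[OF c T[OF uv] subspace_add[OF sub T[OF u] T[OF v]]])
        (simp add: val[OF u] val[OF v] val[OF uv] linear_add[OF D] linear_add[OF G])
  next
    fix a u assume u: "u \<in> tangent_space M p"
    have au: "a *\<^sub>R u \<in> tangent_space M p" by (rule subspace_scale[OF sub u])
    show "levi_civita M Y p (a *\<^sub>R u) = a *\<^sub>R levi_civita M Y p u"
      by (rule tangent_eqI[OF c T[OF au] subspace_scale[OF sub T[OF u]]])
        (simp add: val[OF u] val[OF au] linear_scale[OF D] linear_scale[OF G] scaleR_fun_apply scaleR_add_right)
  qed
qed

text \<open>Continuity of the orientation: near \<open>p\<close> a frame with constant components stays positive, so that
  determinants in it carry no varying sign.\<close>

lemma local_positive_frame:
  assumes p: "p \<in> points M"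
  obtains c U bs where "c \<in> charts_at M p" "openin (mfd_top M) U" "p \<in> U" "U \<subseteq> fst c"
    "\<forall>q\<in>U. map (coord_vector M c q) bs \<in> positive_bases M q" "length bs = CARD('n)"
proof -
  have "\<exists>c\<in>charts_at M p. \<exists>U bs. openin (mfd_top M) U \<and> p \<in> U \<and> U \<subseteq> fst c \<and>
      (\<forall>q\<in>U. map (coord_vector M c q) bs \<in> positive_bases M q)"
    using riem p unfolding oriented_riemannian_manifold_with_boundary_def by (elim conjE) (rule bspec)
  then obtain c U bs where b: "c \<in> charts_at M p" "openin (mfd_top M) U" "p \<in> U" "U \<subseteq> fst c"
    and pos: "\<forall>q\<in>U. map (coord_vector M c q) bs \<in> positive_bases M q"
    by (elim bexE exE conjE)
  interpret V: oriented_ips "tangent_ips M p" by (rule tangent_oriented_ips[OF p])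
  have "length (map (coord_vector M c p) bs) = CARD('n)"
    using V.ordered_basis_facts(1)[OF V.positive_basis_ordered, of "map (coord_vector M c p) bs"] bspec[OF pos b(3)]
    by (simp add: dim_tangent[OF p])
  then have "length bs = CARD('n)" by simp
  from that[OF b pos this] show ?thesis .
qed

end

lemma (in oriented_ips) positive_gram_det:
  assumes "b \<in> ips_positive V"
  shows "fdet d (\<lambda>i j. ip (b ! i) (b ! j)) > 0"
proof -
  note b = ordered_basis_facts[OF positive_basis_ordered[OF assms]]
  have "fdet d (\<lambda>i j. ip (b ! i) (b ! j)) = fdet d (\<lambda>i j. ip (b ! j) (pos_onb ! i)) * fdet d (\<lambda>i j. ip (b ! j) (pos_onb ! i))"
    by (rule gram_change_basis[OF pos_onb b(5) b(5)])
  then show ?thesis using positive_gram[OF assms] by simp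
qed

locale oriented_riem_map = riem_map M N f + M: oriented_riem M
  for M :: "('a, 'n::finite) riem_mfd" and N :: "('b, 'n) riem_mfd" and f
begin

lemma tangent_pair:
  assumes p: "p \<in> points M"
  shows "oriented_ips_pair (tangent_ips M p) (tangent_ips N (f p))"
  using M.tangent_oriented_ips[OF p] N.tangent_oriented_ips[OF map_points[OF p]]
  by (simp add: oriented_ips_pair_def oriented_ips_pair_axioms_def M.dim_tangent[OF p] N.dim_tangent[OF map_points[OF p]])

lemma differential_lin:
  assumes p: "p \<in> points M"
  shows "linear_between (tangent_space M p) (tangent_space N (f p)) (differential M N f p)"
  unfolding linear_between_def
  using differential_tangent[OF p] differential_linear(1)[OF p] differential_linear(2)[OF p] by simp

lemma Cof_d_linear:
  assumes p: "p \<in> points M"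
  shows "linear_between (tangent_space M p) (tangent_space N (f p)) (Cof_d M N f p)"
proof -
  interpret P: oriented_ips_pair "tangent_ips M p" "tangent_ips N (f p)" by (rule tangent_pair[OF p])
  show ?thesis using P.Cof_lin[of "differential M N f p"] differential_lin[OF p] by (simp add: Cof_d_def)
qed

lemma Piola_adjoint:
  assumes p: "p \<in> points M" and X: "X (f p) \<in> tangent_space N (f p)"
  shows "Piola M N f X p \<in> tangent_space M p"
    and "u \<in> tangent_space M p \<Longrightarrow> riem_metric M p (Piola M N f X p) u = riem_metric N (f p) (X (f p)) (Cof_d M N f p u)"
proof -
  interpret P: oriented_ips_pair "tangent_ips M p" "tangent_ips N (f p)" by (rule tangent_pair[OF p])
  note T = P.metric_transpose[of "Cof_d M N f p" "X (f p)"]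
  show "Piola M N f X p \<in> tangent_space M p" using T(1) Cof_d_linear[OF p] X by (simp add: Piola_def)
  show "u \<in> tangent_space M p \<Longrightarrow> riem_metric M p (Piola M N f X p) u = riem_metric N (f p) (X (f p)) (Cof_d M N f p u)"
    using T(2) Cof_d_linear[OF p] X by (simp add: Piola_def)
qed

text \<open>Both determinants in \<open>Cof_eq\<close> are expressed in positive frames with the same normalising root.\<close>

lemma Cof_d_in_frames:
  assumes p: "p \<in> points M" and b: "b \<in> positive_bases M p" and b': "b' \<in> positive_bases N (f p)"
    and v: "v \<in> tangent_space M p" and w: "w \<in> tangent_space N (f p)"
  shows "riem_metric N (f p) (Cof_d M N f p v) w =
    (fdet CARD('n) (\<lambda>i j. riem_metric N (f p) (b' ! i) (differential M N f p (b ! j))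
        + riem_metric M p v (b ! j) * riem_metric N (f p) (b' ! i) w)
      - fdet CARD('n) (\<lambda>i j. riem_metric N (f p) (b' ! i) (differential M N f p (b ! j))))
    / sqrt (fdet CARD('n) (\<lambda>i j. riem_metric M p (b ! i) (b ! j)) *
        fdet CARD('n) (\<lambda>i j. riem_metric N (f p) (b' ! i) (b' ! j)))"
proof -
  interpret P: oriented_ips_pair "tangent_ips M p" "tangent_ips N (f p)" by (rule tangent_pair[OF p])
  let ?A = "differential M N f p" and ?n = "CARD('n)"
  have dim: "dim (ips_space (tangent_ips M p)) = ?n" "dim (ips_space (tangent_ips N (f p))) = ?n"
    by (simp_all add: M.dim_tangent[OF p] N.dim_tangent[OF map_points[OF p]])
  have A: "P.lin ?A" using differential_lin[OF p] by simp
  have V: "v \<in> P.V.S" and W: "w \<in> P.W.S" using v w by simp_all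
  have B: "b \<in> ips_positive (tangent_ips M p)" and B': "b' \<in> ips_positive (tangent_ips N (f p))" using b b' by simp_all
  note bS = P.V.ordered_basis_facts(5)[OF P.V.positive_basis_ordered[OF B], unfolded dim]
    and bS' = P.W.ordered_basis_facts(5)[OF P.W.positive_basis_ordered[OF B'], unfolded dim]
  have "fdet ?n (\<lambda>i j. P.W.ip (b' ! i) (?A (b ! j) + P.V.ip v (b ! j) *\<^sub>R w)) =
      fdet ?n (\<lambda>i j. P.W.ip (b' ! i) (?A (b ! j)) + P.V.ip v (b ! j) * P.W.ip (b' ! i) w)"
  proof (rule fdet_cong)
    fix i j assume i: "i < ?n" and j: "j < ?n"
    have Ab: "?A (b ! j) \<in> P.W.S" by (rule P.linD(1)[OF A bS[OF j]])
    show "P.W.ip (b' ! i) (?A (b ! j) + P.V.ip v (b ! j) *\<^sub>R w) =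
        P.W.ip (b' ! i) (?A (b ! j)) + P.V.ip v (b ! j) * P.W.ip (b' ! i) w"
      unfolding P.W.ip_add_right[OF Ab P.W.space_closed(4)[OF W] bS'[OF i]] P.W.ip_scale_right[OF W bS'[OF i]] ..
  qed
  then show ?thesis
    using P.Cof_eq(2)[OF A V W] P.det_between_positive_bases[OF A B B']
      P.det_between_positive_bases[OF P.lin_rank_one_update[OF A W V] B B']
    by (simp add: Cof_d_def dim[simplified] diff_divide_distrib)
qed

abbreviation diff_field where "diff_field Y p \<equiv> riem_map.diff_section M M id Y p"

lemma differential_section:
  assumes Y: "diff_field Y p" and p: "p \<in> points M"
  shows "diff_section (\<lambda>q. differential M N f q (Y q)) p"
proof -
  interpret I: riem_map M M id by (rule M.riem_id_map)
  obtain c where c: "c \<in> charts_at M p" using p by (rule M.ex_chart)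
  obtain c' where c': "c' \<in> charts_at N (f p)" using map_points[OF p] by (rule N.ex_chart)
  have c_id: "c \<in> charts_at M (id p)" using c by simp
  obtain U where U: "openin (mfd_top M) U" "p \<in> U" "\<forall>q\<in>U. Y q \<in> tangent_space M (id q)"
    by (rule I.diff_section_open[OF Y])
  let ?W = "U \<inter> dom c c'"
  note d = dom_facts[OF c c'] and ch = M.charts_atD[OF c]
  have W: "openin (mfd_top M) ?W" by (intro openin_Int U(1) d(1))
  have sub: "?W \<subseteq> fst c" using d(2) by auto
  have pW: "p \<in> ?W" using U(2) d(3) by simp
  have at: "c \<in> charts_at M q" "c' \<in> charts_at N (f q)" "Y q \<in> tangent_space M q" if "q \<in> ?W" for q
    using that ch(1) N.charts_atD(1)[OF c'] M.charts_at_iff N.charts_at_iff bspec[OF U(3), of q] by auto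
  have D: "has_chart_deriv c (\<lambda>q. chart_deriv c (snd c' \<circ> f) q (Y q c)) p
      (\<lambda>u. chart_deriv c (\<lambda>q. chart_deriv c (snd c' \<circ> f) q (Y p c)) p u
        + chart_deriv c (snd c' \<circ> f) p (chart_deriv c (\<lambda>q. Y q c) p u))"
    by (rule has_chart_deriv_application[OF ch(2) W sub pW
        has_chart_deriv_chart_deriv[OF ch(2,3) I.diff_section_components[OF Y c c_id]]
        has_chart_deriv_chart_deriv[OF ch(2,3) coordinates_smooth(2)[OF c c']] linear_coordinates[OF at(1,2)]])
  have eq: "differential M N f q (Y q) c' = chart_deriv c (snd c' \<circ> f) q (Y q c)" if "q \<in> ?W" for q
    by (rule differential_apply[OF at[OF that]])
  have diff: "chart_differentiable c (\<lambda>q. differential M N f q (Y q) c') p"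
    using chart_differentiable_cong[OF ch(2) W sub pW eq] chart_differentiableI[OF D] by simp
  have "\<forall>q\<in>?W. differential M N f q (Y q) \<in> tangent_space N (f q)"
    using differential_tangent[OF M.charts_atD(5)[OF at(1)] at(3)] by blast
  from diff_sectionI[OF W pW this c c' diff] show ?thesis .
qed

text \<open>In frames with constant components all entries of the formula in \<open>Cof_d_in_frames\<close> are pairings
  of differentiable sections, and the Gram determinants under the root are positive.\<close>

lemma Cof_pairing_differentiable:
  assumes Y: "diff_field Y p" and t: "diff_section t p" and p: "p \<in> points M" and c: "c \<in> charts_at M p"
  shows "chart_differentiable c (\<lambda>q. riem_metric N (f q) (Cof_d M N f q (Y q)) (t q)) p"
proof -
  interpret I: riem_map M M id by (rule M.riem_id_map)
  obtain c0 U bs where fr: "c0 \<in> charts_at M p" "openin (mfd_top M) U" "p \<in> U" "U \<subseteq> fst c0"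
    "\<forall>q\<in>U. map (coord_vector M c0 q) bs \<in> positive_bases M q" "length bs = CARD('n)"
    by (rule M.local_positive_frame[OF p])
  obtain c1 U' bs' where fr': "c1 \<in> charts_at N (f p)" "openin (mfd_top N) U'" "f p \<in> U'" "U' \<subseteq> fst c1"
    "\<forall>y\<in>U'. map (coord_vector N c1 y) bs' \<in> positive_bases N y" "length bs' = CARD('n)"
    by (rule N.local_positive_frame[OF map_points[OF p]])
  obtain UY where UY: "openin (mfd_top M) UY" "p \<in> UY" "\<forall>q\<in>UY. Y q \<in> tangent_space M (id q)"
    by (rule I.diff_section_open[OF Y])
  obtain Ut where Ut: "openin (mfd_top M) Ut" "p \<in> Ut" "\<forall>q\<in>Ut. t q \<in> tangent_space N (f q)"
    by (rule diff_section_open[OF t])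
  note ch = M.charts_atD[OF c]
  let ?W = "(U \<inter> {q \<in> fst c. f q \<in> U'}) \<inter> (UY \<inter> Ut)"
  have W: "openin (mfd_top M) ?W" by (intro openin_Int fr(2) UY(1) Ut(1) preimage_openin[OF ch(1) fr'(2)])
  have sub: "?W \<subseteq> fst c" by auto
  have pW: "p \<in> ?W" using fr(3) fr'(3) UY(2) Ut(2) ch(3) by simp
  define b where "b j q = coord_vector M c0 q (bs ! j)" for j q
  define b' where "b' i q = coord_vector N c1 (f q) (bs' ! i)" for i q
  let ?n = "CARD('n)"
  let ?A = "\<lambda>q i j. riem_metric N (f q) (b' i q) (differential M N f q (b j q))"
  let ?g = "\<lambda>q i j. riem_metric M q (b i q) (b j q)" and ?g' = "\<lambda>q i j. riem_metric N (f q) (b' i q) (b' j q)"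
  let ?B = "\<lambda>q i j. ?A q i j + riem_metric M q (Y q) (b j q) * riem_metric N (f q) (b' i q) (t q)"
  have bd: "diff_field (b j) p" for j
    using I.coord_vector_section[OF p, of c0 "bs ! j"] fr(1) by (simp add: b_def[abs_def])
  have bd': "diff_section (b' i) p" for i
    using coord_vector_section[OF p fr'(1), of "bs' ! i"] by (simp add: b'_def[abs_def])
  note pairM = I.pullback_connection_metric(1)[OF _ _ c] and pairN = pullback_connection_metric(1)[OF _ _ c]
  have gM: "chart_differentiable c (\<lambda>q. ?g q i j) p" for i j using pairM[OF bd[of i] bd[of j]] by simp
  have gY: "chart_differentiable c (\<lambda>q. riem_metric M q (Y q) (b j q)) p" for j using pairM[OF Y bd[of j]] by simp
  have gN: "chart_differentiable c (\<lambda>q. ?g' q i j) p" for i j by (rule pairN[OF bd' bd'])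
  have gt: "chart_differentiable c (\<lambda>q. riem_metric N (f q) (b' i q) (t q)) p" for i by (rule pairN[OF bd' t])
  have gA: "chart_differentiable c (\<lambda>q. ?A q i j) p" for i j by (rule pairN[OF bd' differential_section[OF bd p]])
  have gB: "chart_differentiable c (\<lambda>q. ?B q i j) p" for i j
    using gA[of i j] gY[of j] gt[of i] unfolding chart_differentiable_iff
    by (intro differentiable_add differentiable_mult)
  have formula: "riem_metric N (f q) (Cof_d M N f q (Y q)) (t q) =
      (fdet ?n (?B q) - fdet ?n (?A q)) / sqrt (fdet ?n (?g q) * fdet ?n (?g' q))" if q: "q \<in> ?W" for q
  proof -
    have qq: "q \<in> points M" "q \<in> U" "f q \<in> U'" "Y q \<in> tangent_space M q" "t q \<in> tangent_space N (f q)"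
      using q openin_subset[OF W] bspec[OF UY(3), of q] bspec[OF Ut(3), of q] by auto
    show ?thesis
      unfolding Cof_d_in_frames[OF qq(1) bspec[OF fr(5) qq(2)] bspec[OF fr'(5) qq(3)] qq(4,5)]
      by (intro arg_cong2[where f = "(/)"] arg_cong2[where f = "(-)"] arg_cong[where f = sqrt]
          arg_cong2[where f = "(*)"] fdet_cong) (simp_all add: b_def b'_def fr(6) fr'(6))
  qed
  have posM: "fdet ?n (?g p) > 0"
  proof -
    interpret V: oriented_ips "tangent_ips M p" by (rule M.tangent_oriented_ips[OF p])
    have "fdet ?n (\<lambda>i j. riem_metric M p (map (coord_vector M c0 p) bs ! i) (map (coord_vector M c0 p) bs ! j)) > 0"
      using V.positive_gram_det[of "map (coord_vector M c0 p) bs"] bspec[OF fr(5) fr(3)] by (simp add: M.dim_tangent[OF p])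
    also have "fdet ?n (\<lambda>i j. riem_metric M p (map (coord_vector M c0 p) bs ! i) (map (coord_vector M c0 p) bs ! j)) = fdet ?n (?g p)"
      by (rule fdet_cong) (simp add: b_def fr(6))
    finally show ?thesis .
  qed
  have posN: "fdet ?n (?g' p) > 0"
  proof -
    interpret W: oriented_ips "tangent_ips N (f p)" by (rule N.tangent_oriented_ips[OF map_points[OF p]])
    have "fdet ?n (\<lambda>i j. riem_metric N (f p) (map (coord_vector N c1 (f p)) bs' ! i) (map (coord_vector N c1 (f p)) bs' ! j)) > 0"
      using W.positive_gram_det[of "map (coord_vector N c1 (f p)) bs'"] bspec[OF fr'(5) fr'(3)]
      by (simp add: N.dim_tangent[OF map_points[OF p]])
    also have "fdet ?n (\<lambda>i j. riem_metric N (f p) (map (coord_vector N c1 (f p)) bs' ! i) (map (coord_vector N c1 (f p)) bs' ! j)) = fdet ?n (?g' p)"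
      by (rule fdet_cong) (simp add: b'_def fr'(6))
    finally show ?thesis .
  qed
  have pos: "fdet ?n (?g p) * fdet ?n (?g' p) > 0" using posM posN by (rule mult_pos_pos)
  have num: "chart_differentiable c (\<lambda>q. fdet ?n (?B q) - fdet ?n (?A q)) p"
    using chart_differentiable_fdet[of ?n c ?B p, OF gB] chart_differentiable_fdet[of ?n c ?A p, OF gA]
    unfolding chart_differentiable_iff by (rule differentiable_diff)
  have "chart_differentiable c (\<lambda>q. fdet ?n (?g q) * fdet ?n (?g' q)) p"
    using chart_differentiable_fdet[of ?n c ?g p, OF gM] chart_differentiable_fdet[of ?n c ?g' p, OF gN]
    unfolding chart_differentiable_iff by (rule differentiable_mult)
  then obtain D where D: "((\<lambda>x. fdet ?n (?g (chart_inv c x)) * fdet ?n (?g' (chart_inv c x))) has_derivative D)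
      (at (snd c p) within chart_image c)"
    unfolding chart_differentiable_iff differentiable_def by (rule exE)
  have inv: "chart_inv c (snd c p) = p" by (rule chart_inv_chart[OF ch(2,3)])
  have root: "(\<lambda>x. sqrt (fdet ?n (?g (chart_inv c x)) * fdet ?n (?g' (chart_inv c x)))) differentiable
      (at (snd c p) within chart_image c)"
    by (rule differentiableI[OF has_derivative_real_sqrt[OF _ D]]) (simp only: inv pos)
  have nz: "sqrt (fdet ?n (?g (chart_inv c (snd c p))) * fdet ?n (?g' (chart_inv c (snd c p)))) \<noteq> 0"
    unfolding inv using posM posN by simp
  have "chart_differentiable c (\<lambda>q. (fdet ?n (?B q) - fdet ?n (?A q)) / sqrt (fdet ?n (?g q) * fdet ?n (?g' q))) p"
    using differentiable_divide[OF num[unfolded chart_differentiable_iff] root nz] unfolding chart_differentiable_iff .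
  then show ?thesis using chart_differentiable_cong[OF ch(2) W sub pW formula] by simp
qed

lemma Cof_section:
  assumes Y: "diff_field Y p" and p: "p \<in> points M"
  shows "diff_section (\<lambda>q. Cof_d M N f q (Y q)) p"
proof -
  interpret I: riem_map M M id by (rule M.riem_id_map)
  obtain c where c: "c \<in> charts_at M p" using p by (rule M.ex_chart)
  obtain c' where c': "c' \<in> charts_at N (f p)" using map_points[OF p] by (rule N.ex_chart)
  obtain U where U: "openin (mfd_top M) U" "p \<in> U" "\<forall>q\<in>U. Y q \<in> tangent_space M (id q)"
    by (rule I.diff_section_open[OF Y])
  show ?thesis
  proof (rule diff_section_from_pairings[OF c c' U(1,2)])
    show "\<forall>q\<in>U. Cof_d M N f q (Y q) \<in> tangent_space N (f q)"
    proof
      fix q assume q: "q \<in> U"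
      then have "q \<in> points M" using openin_subset[OF U(1)] by auto
      from Cof_d_linear[OF this] show "Cof_d M N f q (Y q) \<in> tangent_space N (f q)"
        using bspec[OF U(3) q] unfolding linear_between_def by simp
    qed
    show "chart_differentiable c (\<lambda>q. riem_metric N (f q) (Cof_d M N f q (Y q)) (coord_vector N c' (f q) w)) p" for w
      by (rule Cof_pairing_differentiable[OF Y coord_vector_section[OF p c'] p c])
  qed
qed

lemma Piola_section:
  assumes X: "smooth_vector_field N X" and p: "p \<in> points M"
  shows "diff_field (Piola M N f X) p"
proof -
  interpret I: riem_map M M id by (rule M.riem_id_map)
  obtain c where c: "c \<in> charts_at M p" using p by (rule M.ex_chart)
  have c_id: "c \<in> charts_at M (id p)" using c by simp
  note ch = M.charts_atD[OF c]
  have XT: "X y \<in> tangent_space N y" if "y \<in> points N" for y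
    using X that unfolding smooth_vector_field_def by (elim conjE) (rule bspec)
  have pt: "q \<in> points M" if "q \<in> fst c" for q using that openin_subset[OF ch(4)] by auto
  show ?thesis
  proof (rule I.diff_section_from_pairings[OF c c_id ch(4,3)])
    show "\<forall>q\<in>fst c. Piola M N f X q \<in> tangent_space M (id q)"
      using Piola_adjoint(1)[where X = X, OF pt XT[OF map_points[OF pt]]] by simp
    fix w
    have W: "diff_field (\<lambda>q. coord_vector M c q w) p" using I.coord_vector_section[OF p c_id, of w] by simp
    have eq: "riem_metric M (id q) (Piola M N f X q) (coord_vector M c (id q) w) =
        riem_metric N (f q) (Cof_d M N f q (coord_vector M c q w)) (X (f q))" if q: "q \<in> fst c" for q
    proof -
      note q' = pt[OF q]
      have cq: "c \<in> charts_at M q" using q ch(1) M.charts_at_iff by simp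
      note wT = M.coord_vector_tangent[OF cq, of w] and xT = XT[OF map_points[OF q']]
      interpret W: oriented_ips "tangent_ips N (f q)" by (rule N.tangent_oriented_ips[OF map_points[OF q']])
      have CT: "Cof_d M N f q (coord_vector M c q w) \<in> tangent_space N (f q)"
        using Cof_d_linear[OF q'] wT unfolding linear_between_def by simp
      show ?thesis using Piola_adjoint(2)[where X = X, OF q' xT wT] W.ip_commute[of "X (f q)" "Cof_d M N f q (coord_vector M c q w)"] CT xT
        by simp
    qed
    show "chart_differentiable c (\<lambda>q. riem_metric M (id q) (Piola M N f X q) (coord_vector M c (id q) w)) p"
      using chart_differentiable_cong[OF ch(2) ch(4) subset_refl ch(3) eq]
        Cof_pairing_differentiable[OF W compose_section(1)[OF X p] p c] by simp
  qed
qed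

text \<open>Both sides come from differentiating \<open>\<langle>Piola X, W\<rangle> = \<langle>X \<circ> f, Cof df W\<rangle>\<close> along \<open>e\<close>, where \<open>W\<close> is
  the field with constant components in a chart and \<open>W(p) = e\<close>.  The terms containing \<open>\<nabla>W\<close> combine
  into the covariant derivative of the cofactor.\<close>

lemma divergence_integrand:
  assumes X: "smooth_vector_field N X" and p: "p \<in> points M" and e: "e \<in> tangent_space M p"
  shows "riem_metric M p (levi_civita M (Piola M N f X) p e) e =
    riem_metric N (f p) (levi_civita N X (f p) (differential M N f p e)) (Cof_d M N f p e)
    + riem_metric N (f p) (X (f p)) (hom_connection M N f (Cof_d M N f) p e e)"
    and "hom_connection M N f (Cof_d M N f) p e e \<in> tangent_space N (f p)"
proof -
  interpret I: riem_map M M id by (rule M.riem_id_map)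
  interpret P: oriented_ips_pair "tangent_ips M p" "tangent_ips N (f p)" by (rule tangent_pair[OF p])
  define c where "c = chart_at M p"
  have c: "c \<in> charts_at M p" unfolding c_def by (rule M.chart_at[OF p])
  have c_id: "c \<in> charts_at M (id p)" using c by simp
  note ch = M.charts_atD[OF c]
  define W where "W q = coord_vector M c q (e c)" for q
  define t where "t q = Cof_d M N f q (W q)" for q
  let ?Y = "Piola M N f X" and ?s = "\<lambda>q. X (f q)"
  have We: "W p = e" unfolding W_def by (rule M.tangent_coord_vector[OF c e])
  have Wd: "diff_field W p" using I.coord_vector_section[OF p c_id, of "e c"] by (simp add: W_def[abs_def])
  have td: "diff_section t p" unfolding t_def[abs_def] by (rule Cof_section[OF Wd p])
  have Yd: "diff_field ?Y p" by (rule Piola_section[OF X p])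
  have sd: "diff_section ?s p" by (rule compose_section(1)[OF X p])
  note LC = M.levi_civita_pullback[OF p e]
  have LWT: "levi_civita M W p e \<in> tangent_space M p"
    using M.levi_civita_linear[OF Wd p] e unfolding linear_between_def by simp
  have XT: "X y \<in> tangent_space N y" if "y \<in> points N" for y
    using X that unfolding smooth_vector_field_def by (elim conjE) (rule bspec)
  note xT = XT[OF map_points[OF p]]
  have Ce: "Cof_d M N f p u \<in> tangent_space N (f p)" if "u \<in> tangent_space M p" for u
    using Cof_d_linear[OF p] that unfolding linear_between_def by simp
  have hom: "hom_connection M N f (Cof_d M N f) p e e =
      pullback_connection M N f t p e - Cof_d M N f p (levi_civita M W p e)"
    unfolding hom_connection_def Let_def c_def[symmetric] t_def[abs_def] W_def[abs_def] ..
  have tT: "pullback_connection M N f t p e \<in> tangent_space N (f p)" by (rule pullback_connection_tangent[OF td e p])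
  show "hom_connection M N f (Cof_d M N f) p e e \<in> tangent_space N (f p)"
    unfolding hom by (rule subspace_diff[OF N.subspace_tangent[OF map_points[OF p]] tT Ce[OF LWT]])
  have same: "riem_metric M q (?Y q) (W q) = riem_metric N (f q) (?s q) (t q)" if q: "q \<in> fst c" for q
  proof -
    have q': "q \<in> points M" using q openin_subset[OF ch(4)] by auto
    have cq: "c \<in> charts_at M q" using q ch(1) M.charts_at_iff by simp
    have "W q \<in> tangent_space M q" unfolding W_def by (rule M.coord_vector_tangent[OF cq])
    from Piola_adjoint(2)[where X = X, OF q' XT[OF map_points[OF q']] this] show ?thesis unfolding t_def .
  qed
  have "tangent_deriv M (\<lambda>q. riem_metric M q (?Y q) (W q)) p e = tangent_deriv M (\<lambda>q. riem_metric N (f q) (?s q) (t q)) p e"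
    unfolding tangent_deriv_def c_def[symmetric]
    using chart_deriv_cong[OF ch(2) ch(4) subset_refl ch(3) same] by simp
  moreover have "tangent_deriv M (\<lambda>q. riem_metric M q (?Y q) (W q)) p e =
      riem_metric M p (levi_civita M ?Y p e) e + riem_metric M p (?Y p) (levi_civita M W p e)"
    using I.pullback_connection_metric(2)[OF Yd Wd c e] We by (simp add: LC)
  moreover have "tangent_deriv M (\<lambda>q. riem_metric N (f q) (?s q) (t q)) p e =
      riem_metric N (f p) (levi_civita N X (f p) (differential M N f p e)) (Cof_d M N f p e)
      + riem_metric N (f p) (X (f p)) (pullback_connection M N f t p e)"
    using pullback_connection_metric(2)[OF sd td c e] We by (simp add: compose_section(2)[OF X p e] t_def)
  moreover have "riem_metric M p (?Y p) (levi_civita M W p e) =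
      riem_metric N (f p) (X (f p)) (Cof_d M N f p (levi_civita M W p e))"
    by (rule Piola_adjoint(2)[where X = X, OF p xT LWT])
  moreover have "riem_metric N (f p) (X (f p)) (hom_connection M N f (Cof_d M N f) p e e) =
      riem_metric N (f p) (X (f p)) (pullback_connection M N f t p e)
      - riem_metric N (f p) (X (f p)) (Cof_d M N f p (levi_civita M W p e))"
  proof -
    have "P.W.ip (X (f p)) (pullback_connection M N f t p e + - Cof_d M N f p (levi_civita M W p e)) =
        P.W.ip (X (f p)) (pullback_connection M N f t p e) + P.W.ip (X (f p)) (- Cof_d M N f p (levi_civita M W p e))"
      using xT tT P.W.space_closed(5)[of "Cof_d M N f p (levi_civita M W p e)"] Ce[OF LWT]
      by (intro P.W.ip_add_right) simp_all
    also have "P.W.ip (X (f p)) (- Cof_d M N f p (levi_civita M W p e)) = - P.W.ip (X (f p)) (Cof_d M N f p (levi_civita M W p e))"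
      using xT Ce[OF LWT] by (intro P.W.ip_minus_right) simp_all
    finally show ?thesis unfolding hom diff_conv_add_uminus ips_tangent .
  qed
  ultimately show "riem_metric M p (levi_civita M (Piola M N f X) p e) e =
    riem_metric N (f p) (levi_civita N X (f p) (differential M N f p e)) (Cof_d M N f p e)
    + riem_metric N (f p) (X (f p)) (hom_connection M N f (Cof_d M N f) p e e)" by linarith
qed

text \<open>Summing \<open>divergence_integrand\<close> over an orthonormal basis, the second terms give the coderivative
  and the first ones the trace of \<open>(Cof df)\<^sup>T \<circ> \<nabla>X \<circ> df\<close>, which is \<open>Det df\<close> times the divergence of
  \<open>X\<close>.\<close>

theorem divergence_Piola:
  assumes X: "smooth_vector_field N X" and p: "p \<in> points M"
  shows "divergence M (Piola M N f X) p = divergence N X (f p) * Det_d M N f p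
    - riem_metric N (f p) (X (f p)) (coderivative M N f (Cof_d M N f) p)"
proof -
  interpret P: oriented_ips_pair "tangent_ips M p" "tangent_ips N (f p)" by (rule tangent_pair[OF p])
  let ?n = "CARD('n)"
  define e where "e = some_orthonormal_basis (tangent_ips M p)"
  define a where "a = some_orthonormal_basis (tangent_ips N (f p))"
  have e: "orthonormal_basis (tangent_ips M p) e" and a: "orthonormal_basis (tangent_ips N (f p)) a"
    unfolding e_def a_def by (rule P.V.some_orthonormal_basis, rule P.W.some_orthonormal_basis)
  note dim = M.dim_tangent[OF p] N.dim_tangent[OF map_points[OF p]]
  note eD = P.V.orthonormal_basisD[OF e, unfolded ips_tangent, unfolded dim] and aD = P.W.orthonormal_basisD[OF a, unfolded ips_tangent, unfolded dim]
  let ?A = "differential M N f p" and ?C = "Cof_d M N f p" and ?L = "levi_civita N X (f p)"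
  let ?h = "\<lambda>i. hom_connection M N f (Cof_d M N f) p (e ! i) (e ! i)"
  have xT: "X (f p) \<in> tangent_space N (f p)"
    using X map_points[OF p] unfolding smooth_vector_field_def by (elim conjE) (rule bspec)
  have A: "P.lin ?A" using differential_lin[OF p] by simp
  have L: "linear_between P.W.S P.W.S ?L"
    using N.levi_civita_linear[OF N.vector_field_section[OF X map_points[OF p]] map_points[OF p]] by simp
  have hT: "?h i \<in> tangent_space N (f p)" if "i < ?n" for i by (rule divergence_integrand(2)[OF X p eD(3)[OF that]])
  have "divergence M (Piola M N f X) p = (\<Sum>i<?n. riem_metric M p (levi_civita M (Piola M N f X) p (e ! i)) (e ! i))"
    unfolding divergence_def e_def[symmetric] by (simp add: sum_list_sum_nth eD(2) atLeast0LessThan)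
  also have "\<dots> = (\<Sum>i<?n. riem_metric N (f p) (?L (?A (e ! i))) (?C (e ! i)) + riem_metric N (f p) (X (f p)) (?h i))"
    by (intro sum.cong refl divergence_integrand(1)[OF X p]) (simp add: eD(3))
  also have "\<dots> = (\<Sum>i<?n. riem_metric N (f p) (?L (?A (e ! i))) (?C (e ! i))) + (\<Sum>i<?n. riem_metric N (f p) (X (f p)) (?h i))"
    by (rule sum.distrib)
  also have "(\<Sum>i<?n. riem_metric N (f p) (?L (?A (e ! i))) (?C (e ! i))) =
      (\<Sum>k<?n. riem_metric N (f p) (?L (a ! k)) (a ! k)) * P.det_between ?A"
    using P.trace_Cof[OF A L e a] by (simp only: dim ips_tangent Cof_d_def)
  also have "(\<Sum>k<?n. riem_metric N (f p) (?L (a ! k)) (a ! k)) = divergence N X (f p)"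
    unfolding divergence_def a_def[symmetric] by (simp add: sum_list_sum_nth aD(2) atLeast0LessThan)
  also have "P.det_between ?A = Det_d M N f p" unfolding Det_d_def by (rule P.Det_eq[OF A, symmetric])
  also have "(\<Sum>i<?n. riem_metric N (f p) (X (f p)) (?h i)) = riem_metric N (f p) (X (f p)) (\<Sum>i<?n. ?h i)"
    using P.W.ip_sum_right[of "{..<?n}" ?h "X (f p)"] hT xT by simp
  also have "\<dots> = - riem_metric N (f p) (X (f p)) (coderivative M N f (Cof_d M N f) p)"
  proof -
    have S: "(\<Sum>i<?n. ?h i) \<in> tangent_space N (f p)"
      using hT by (intro subspace_sum[OF N.subspace_tangent[OF map_points[OF p]]]) simp
    have "coderivative M N f (Cof_d M N f) p = - (\<Sum>i<?n. ?h i)"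
      unfolding coderivative_def e_def[symmetric] by (simp add: sum_list_sum_nth eD(2) atLeast0LessThan)
    then show ?thesis using P.W.ip_minus_right[of "\<Sum>i<?n. ?h i" "X (f p)"] S xT by simp
  qed
  finally show ?thesis by simp
qed

end

theorem proposition3p4:
  fixes M1 :: "('a, 'n::finite) riem_mfd"
    and M2 :: "('b, 'n) riem_mfd"
    and f :: "'a \<Rightarrow> 'b"
    and X :: "'b \<Rightarrow> ('b, 'n) tangent_vector"
  assumes "oriented_riemannian_manifold_with_boundary M1" and "compact_space (mfd_top M1)"
    and "oriented_riemannian_manifold_with_boundary M2" and "compact_space (mfd_top M2)"
    and "smooth_map M1 M2 f"
    and "smooth_vector_field M2 X"
  shows "\<forall>p\<in>points M1.
    divergence M1 (Piola M1 M2 f X) p =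
      divergence M2 X (f p) * Det_d M1 M2 f p
      - riem_metric M2 (f p) (X (f p)) (coderivative M1 M2 f (Cof_d M1 M2 f) p)"
proof
  interpret M1: oriented_riem M1 by unfold_locales (rule assms(1))
  interpret M2: oriented_riem M2 by unfold_locales (rule assms(3))
  interpret oriented_riem_map M1 M2 f by unfold_locales (rule assms(5))
  fix p assume "p \<in> points M1"
  then show "divergence M1 (Piola M1 M2 f X) p =
      divergence M2 X (f p) * Det_d M1 M2 f p
      - riem_metric M2 (f p) (X (f p)) (coderivative M1 M2 f (Cof_d M1 M2 f) p)"
    by (rule divergence_Piola[OF assms(6)])
qed

end
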